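(* Let $S$ be a training set of $m$ i.i.d. samples from $\mathcal{D}$ and run $\mathrm{LW}_{\mathrm{CNN}}$ with $T_1>0$, $\eta_1 \le \frac{1}{4k(T_1+1)}$, $\eta_2 < 8k$, initialization radius $r \le \frac{\eta_1}{200}$, and $k > 8d^3$. Then for every $\delta\in(0,1)$, with probability at least $(1-\delta)(1-4e^{-d}-4e^{-m/36})$ over the sample and the initialization: (1) $\lim_{T_2\to\infty}\mathcal{L}_2\big(W^{(T_1)},a^{(T_2)}\big)=0$; and (2) $\limsup_{T_2\to\infty}\mathbb{P}_{(x,y)\sim\mathcal{D}}\big(\mathrm{sign}(N_{(W^{(T_1)},a^{(T_2)})}(x))\ne y\big) \le C\left(\sqrt{\frac{d}{m}}+\sqrt{\frac{\log(1/\delta)}{m}}\right)$, where $C$ is an absolute constant.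
   Context: Fix $n\ge1$, $d\ge3$ and orthonormal vectors $o_1,\dots,o_d\in\mathbb{R}^d$ (the number of patterns equals $d$). Inputs are $x=(x[1],\dots,x[n])\in\mathbb{R}^{nd}$ with $x[j]\in\mathbb{R}^d$. The distribution $\mathcal{D}$ on $\mathbb{R}^{nd}\times\{\pm1\}$: $y$ uniform on $\{\pm1\}$; given $y=1$, an index $j_+$ uniform on $\{1,\dots,n\}$ is drawn, $x[j_+]=o_1$, and for each $j\ne j_+$ independently $x[j]=o_{i_j}$ with $i_j$ uniform on $\{3,\dots,d\}$; given $y=-1$, the same with $o_2$ instead of $o_1$. Network: for $W\in\mathbb{R}^{k\times d}$ with rows $w_i$ and $a\in\mathbb{R}^k$, $N_{(W,a)}(x)=\sum_{i=1}^k a_i\max_{1\le j\le n}\sigma(w_i\cdot x[j])$, $\sigma(z)=\max\{0,z\}$, and $\mathrm{sign}(0)=-1$. Loss $\ell(z)=\log(1+e^{-z})$. The sample $S=\{(x_1,y_1),\dots,(x_m,y_m)\}$ is split into $S_1$ (the first $\lceil m/2\rceil$ samples) and $S_2$ (the rest); $m_i=|S_i|$ and $\mathcal{L}_i(W,a)=\frac{1}{m_i}\sum_{(x,y)\in S_i}\ell(yN_{(W,a)}(x))$. Algorithm $\mathrm{LW}_{\mathrm{CNN}}$: initialize each row $w_i^{(0)}$ independently uniformly on the sphere $\{z\in\mathbb{R}^d:\|z\|=r\}$, and each $a_i^{(0)}$ independently uniformly on $\{\pm1\}$, independent of $W^{(0)}$. For $t=1,\dots,T_1$: $W^{(t)}=W^{(t-1)}-\eta_1\nabla_W\mathcal{L}_1(W^{(t-1)},a^{(0)})$.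 Then for $t=1,\dots,T_2$: $a^{(t)}=a^{(t-1)}-\eta_2\nabla_a\mathcal{L}_2(W^{(T_1)},a^{(t-1)})$. Output $(W^{(T_1)},a^{(T_2)})$. The gradient with respect to $w_i$ uses the convention $\frac{\partial}{\partial w_i}\max_j\sigma(w_i\cdot x[j]) = p_i(x)$, where $p_i(x)=x[j^*]$ for $j^*\in\arg\max_j w_i\cdot x[j]$ if $w_i\cdot x[j^*]>0$, and $p_i(x)=0$ otherwise. *)

theory Defs
  imports "HOL-Probability.Probability"
begin

text \<open>Vectors of R^d are represented as functions nat => real; only the coordinates
  0..d-1 matter. An input x is a list of n patches.\<close>

type_synonym vec = "nat \<Rightarrow> real"
type_synonym inp = "vec list"

definition ip :: "nat \<Rightarrow> vec \<Rightarrow> vec \<Rightarrow> real" where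
  "ip d u v = (\<Sum>c<d. u c * v c)"

definition vnorm :: "nat \<Rightarrow> vec \<Rightarrow> real" where
  "vnorm d u = sqrt (ip d u u)"

definition relu :: "real \<Rightarrow> real" where
  "relu z = max 0 z"

definition sgn1 :: "real \<Rightarrow> real" where
  "sgn1 z = (if z > 0 then 1 else -1)"

definition logloss :: "real \<Rightarrow> real" where
  "logloss z = ln (1 + exp (- z))"

definition logloss' :: "real \<Rightarrow> real" where
  "logloss' z = - 1 / (1 + exp z)"

definition maxact :: "nat \<Rightarrow> vec \<Rightarrow> inp \<Rightarrow> real" where
  "maxact d w x = Max ((\<lambda>v. relu (ip d w v)) ` set x)"

definition net :: "nat \<Rightarrow> nat \<Rightarrow> (nat \<Rightarrow> vec) \<Rightarrow> (nat \<Rightarrow> real) \<Rightarrow> inp \<Rightarrow> real" where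
  "net d k W a x = (\<Sum>i<k. a i * maxact d (W i) x)"

definition pvec :: "nat \<Rightarrow> vec \<Rightarrow> inp \<Rightarrow> vec" where
  "pvec d w x =
     (let js = (LEAST j. j < length x \<and> (\<forall>j'<length x. ip d w (x ! j') \<le> ip d w (x ! j)))
      in if ip d w (x ! js) > 0 then x ! js else (\<lambda>_. 0))"

definition emp_loss :: "nat \<Rightarrow> nat \<Rightarrow> (nat \<Rightarrow> vec) \<Rightarrow> (nat \<Rightarrow> real) \<Rightarrow> (inp \<times> real) list \<Rightarrow> real" where
  "emp_loss d k W a S = (\<Sum>(x, y)\<leftarrow>S. logloss (y * net d k W a x)) / real (length S)"

definition gradW :: "nat \<Rightarrow> nat \<Rightarrow> (nat \<Rightarrow> vec) \<Rightarrow> (nat \<Rightarrow> real) \<Rightarrow> (inp \<times> real) list \<Rightarrow> nat \<Rightarrow> vec" where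
  "gradW d k W a S i = (\<lambda>c.
     (\<Sum>(x, y)\<leftarrow>S. logloss' (y * net d k W a x) * y * a i * pvec d (W i) x c) / real (length S))"

definition grada :: "nat \<Rightarrow> nat \<Rightarrow> (nat \<Rightarrow> vec) \<Rightarrow> (nat \<Rightarrow> real) \<Rightarrow> (inp \<times> real) list \<Rightarrow> nat \<Rightarrow> real" where
  "grada d k W a S i =
     (\<Sum>(x, y)\<leftarrow>S. logloss' (y * net d k W a x) * y * maxact d (W i) x) / real (length S)"

definition W_iter :: "nat \<Rightarrow> nat \<Rightarrow> real \<Rightarrow> (nat \<Rightarrow> real) \<Rightarrow> (inp \<times> real) list \<Rightarrow> nat \<Rightarrow> (nat \<Rightarrow> vec) \<Rightarrow> (nat \<Rightarrow> vec)" where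
  "W_iter d k \<eta> a S t W0 =
     ((\<lambda>W. \<lambda>i c. W i c - \<eta> * gradW d k W a S i c) ^^ t) W0"

definition a_iter :: "nat \<Rightarrow> nat \<Rightarrow> real \<Rightarrow> (nat \<Rightarrow> vec) \<Rightarrow> (inp \<times> real) list \<Rightarrow> nat \<Rightarrow> (nat \<Rightarrow> real) \<Rightarrow> (nat \<Rightarrow> real)" where
  "a_iter d k \<eta> W S t a0 =
     ((\<lambda>a. \<lambda>i. a i - \<eta> * grada d k W a S i) ^^ t) a0"

definition Dist :: "nat \<Rightarrow> nat \<Rightarrow> (nat \<Rightarrow> vec) \<Rightarrow> (inp \<times> real) pmf" where
  "Dist n d pat =
     bind_pmf (pmf_of_set {1, -1 :: real}) (\<lambda>y.
     bind_pmf (pmf_of_set {..<n}) (\<lambda>jp.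
     bind_pmf (pmf_of_set ({..<n} \<rightarrow>\<^sub>E {3..d})) (\<lambda>f.
       return_pmf (map (\<lambda>j. if j = jp then (if y = 1 then pat 1 else pat 2) else pat (f j)) [0..<n], y))))"

fun iid_pmf :: "nat \<Rightarrow> 'a pmf \<Rightarrow> 'a list pmf" where
  "iid_pmf 0 D = return_pmf []"
| "iid_pmf (Suc m) D = do { z \<leftarrow> D; zs \<leftarrow> iid_pmf m D; return_pmf (z # zs) }"

text \<open>Uniform distribution on the sphere of radius r in R^d, realised as the (normalised)
  cone measure: push the uniform distribution on the closed unit ball forward under
  x |-> r x / |x|.\<close>
definition Rd :: "nat \<Rightarrow> vec measure" where
  "Rd d = PiM {..<d} (\<lambda>_. lborel)"

definition sphere_unif :: "nat \<Rightarrow> real \<Rightarrow> vec measure" where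
  "sphere_unif d r =
     distr (uniform_measure (Rd d) {x \<in> space (Rd d). vnorm d x \<le> 1}) (Rd d)
           (\<lambda>x. restrict (\<lambda>c. r * x c / vnorm d x) {..<d})"

definition initW :: "nat \<Rightarrow> nat \<Rightarrow> real \<Rightarrow> (nat \<Rightarrow> vec) measure" where
  "initW d k r = PiM {..<k} (\<lambda>_. sphere_unif d r)"

definition inita :: "nat \<Rightarrow> (nat \<Rightarrow> real) measure" where
  "inita k = PiM {..<k} (\<lambda>_. measure_pmf (pmf_of_set {1, -1 :: real}))"

definition Omega :: "nat \<Rightarrow> nat \<Rightarrow> nat \<Rightarrow> (nat \<Rightarrow> vec) \<Rightarrow> nat \<Rightarrow> real
     \<Rightarrow> ((inp \<times> real) list \<times> (nat \<Rightarrow> vec) \<times> (nat \<Rightarrow> real)) measure" where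
  "Omega n d k pat m r = measure_pmf (iid_pmf m (Dist n d pat)) \<Otimes>\<^sub>M (initW d k r \<Otimes>\<^sub>M inita k)"

definition S1 :: "'a list \<Rightarrow> 'a list" where
  "S1 S = take ((length S + 1) div 2) S"

definition S2 :: "'a list \<Rightarrow> 'a list" where
  "S2 S = drop ((length S + 1) div 2) S"

definition LW_W :: "nat \<Rightarrow> nat \<Rightarrow> real \<Rightarrow> nat \<Rightarrow> (inp \<times> real) list \<Rightarrow> (nat \<Rightarrow> vec) \<Rightarrow> (nat \<Rightarrow> real) \<Rightarrow> (nat \<Rightarrow> vec)" where
  "LW_W d k \<eta>1 T1 S W0 a0 = W_iter d k \<eta>1 a0 (S1 S) T1 W0"

definition LW_a :: "nat \<Rightarrow> nat \<Rightarrow> real \<Rightarrow> nat \<Rightarrow> real \<Rightarrow> nat \<Rightarrow> (inp \<times> real) list \<Rightarrow> (nat \<Rightarrow> vec) \<Rightarrow> (nat \<Rightarrow> real) \<Rightarrow> (nat \<Rightarrow> real)" where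
  "LW_a d k \<eta>1 T1 \<eta>2 T2 S W0 a0 = a_iter d k \<eta>2 (LW_W d k \<eta>1 T1 S W0 a0) (S2 S) T2 a0"

definition test_err :: "nat \<Rightarrow> nat \<Rightarrow> (nat \<Rightarrow> vec) \<Rightarrow> nat \<Rightarrow> (nat \<Rightarrow> vec) \<Rightarrow> (nat \<Rightarrow> real) \<Rightarrow> real" where
  "test_err n d pat k W a = measure_pmf.prob (Dist n d pat) {(x, y). sgn1 (net d k W a x) \<noteq> y}"

end

(*
Every quantity is read off from the inner products of the neurons with the patterns. Each gradient step
changes the coordinate of a neuron along o_l only through samples on which o_l is its most active pattern.
A neuron with sign +1 that initially prefers o_1 to all of o_3, ..., o_d ("good"; by the reflection
symmetry of the sphere this has probability at least 1/(2d)) therefore grows along o_1 at a constant rate,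
while its other coordinates never increase; likewise for sign -1 and o_2. Putting equal weights on the
good neurons separates all inputs of the support with normalised margin of order 1/sqrt d. Gradient descent
for the logistic loss on the second layer drives the loss to 0, and its iterates eventually attain a constant
fraction of that margin. The test error of any such classifier is bounded by a PAC-Bayes
argument on the fresh sample S2, with the uniform prior on sign vectors and the posterior of
independent biased signs whose mean is proportional to the weights.
*)
theory Submission
  imports Defs
begin

section \<open>Inner products and Lebesgue measure\<close>

text \<open>The neurons interact only through the loss derivative. The step size keeps every network
  output within 1/4 throughout the first phase, so this derivative has absolute value between 2/5
  and 1 and each neuron can be followed on its own. The test error must be controlled for all large
  \<open>T2\<close> at once, while the second layer depends on the very sample used to bound it. The
  PAC-Bayes prior and threshold depend on the parameters alone, the features only on the
  initialization and the first half of the sample; the second layer enters only as a posterior mean,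
  and the bound holds for all posteriors simultaneously. One event therefore serves every
  \<open>T2\<close>. Repeating each neuron permits any norm of the posterior mean; taking its square
  of order d ln(m/d) and bounding that logarithm by a square root leaves no logarithm of m/d in the
  rate. The event is cut out by conditions on sample and initialization that imply the conclusion,
  so no limit has to be shown measurable.\<close>

lemma ip_add_left: "ip d (\<lambda>c. u c + v c) w = ip d u w + ip d v w"
  by (simp add: ip_def algebra_simps sum.distrib)

lemma ip_scale_left: "ip d (\<lambda>c. t * u c) w = t * ip d u w"
  by (simp add: ip_def algebra_simps sum_distrib_left)

lemma ip_commute: "ip d u v = ip d v u"
  by (simp add: ip_def mult.commute)

lemma ip_add_right: "ip d w (\<lambda>c. u c + v c) = ip d w u + ip d w v"
  by (simp add: ip_def algebra_simps sum.distrib)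

lemma ip_scale_right: "ip d w (\<lambda>c. t * u c) = t * ip d w u"
  by (simp add: ip_def algebra_simps sum_distrib_left)

lemma ip_diff_right: "ip d w (\<lambda>c. u c - v c) = ip d w u - ip d w v"
  by (simp add: ip_def algebra_simps sum_subtractf)

lemma ip_diff_left: "ip d (\<lambda>c. u c - v c) w = ip d u w - ip d v w"
  by (simp add: ip_def algebra_simps sum_subtractf)

lemma ip_uminus_right: "ip d w (\<lambda>c. - u c) = - ip d w u"
  by (simp add: ip_def sum_negf)

lemma ip_restrict_right [simp]: "ip d w (restrict u {..<d}) = ip d w u"
  by (simp add: ip_def)

lemma ip_restrict_left [simp]: "ip d (restrict u {..<d}) w = ip d u w"
  by (simp add: ip_def)

lemma ip_self_nonneg [simp]: "ip d u u \<ge> 0"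
  by (simp add: ip_def sum_nonneg)

lemma vnorm_nonneg [simp]: "vnorm d u \<ge> 0"
  by (simp add: vnorm_def)

lemma vnorm_power2: "(vnorm d u)\<^sup>2 = ip d u u"
  by (simp add: vnorm_def)

lemma vnorm_eq_L2: "vnorm d u = L2_set u {..<d}"
  by (simp add: vnorm_def ip_def L2_set_def power2_eq_square)

lemma abs_ip_le: "\<bar>ip d u v\<bar> \<le> vnorm d u * vnorm d v"
proof -
  have "\<bar>ip d u v\<bar> \<le> (\<Sum>c<d. \<bar>u c\<bar> * \<bar>v c\<bar>)"
    unfolding ip_def by (rule order_trans[OF sum_abs]) (simp add: abs_mult)
  also have "\<dots> \<le> vnorm d u * vnorm d v"
    unfolding vnorm_eq_L2 by (rule L2_set_mult_ineq)
  finally show ?thesis .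
qed

lemma vnorm_add: "vnorm d (\<lambda>c. u c + v c) \<le> vnorm d u + vnorm d v"
  unfolding vnorm_eq_L2 by (rule L2_set_triangle_ineq)

section \<open>Lebesgue measure on coordinate vectors and its elementary invariances\<close>

interpretation lborel_PiM: product_sigma_finite "\<lambda>_::nat. lborel :: real measure"
  by standard

lemma sigma_finite_Rd: "sigma_finite_measure (Rd d)"
proof -
  interpret finite_product_sigma_finite "\<lambda>_::nat. lborel :: real measure" "{..<d}"
    by standard simp
  show ?thesis unfolding Rd_def by (rule sigma_finite_measure_axioms)
qed

lemma space_Rd: "space (Rd d) = extensional {..<d}"
  by (simp add: Rd_def space_PiM PiE_def)

lemma measurable_Rd_component [measurable]: "c < d \<Longrightarrow> (\<lambda>x. x c) \<in> borel_measurable (Rd d)"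
  unfolding Rd_def using measurable_component_singleton[of c "{..<d}" "\<lambda>_. lborel :: real measure"] by simp

lemma measurable_ip_Rd [measurable]: "(\<lambda>x. ip d v x) \<in> borel_measurable (Rd d)"
  unfolding ip_def by (intro borel_measurable_sum borel_measurable_times measurable_Rd_component) auto

lemma measurable_ip_self_Rd [measurable]: "(\<lambda>x. ip d x x) \<in> borel_measurable (Rd d)"
  unfolding ip_def by (intro borel_measurable_sum borel_measurable_times measurable_Rd_component) auto

lemma measurable_vnorm_Rd [measurable]: "(\<lambda>x. vnorm d x) \<in> borel_measurable (Rd d)"
  unfolding vnorm_def by measurable

text \<open>Points of the product space are extensional functions, so every map into
  \<open>Rd d\<close> has to be wrapped in \<open>restrict\<close>.\<close>

lemma measurable_into_Rd:
  assumes "\<And>c. c < d \<Longrightarrow> (\<lambda>x. f x c) \<in> borel_measurable M"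
  shows "(\<lambda>x. restrict (f x) {..<d}) \<in> measurable M (Rd d)"
  unfolding Rd_def by (rule measurable_restrict) (use assms in auto)

text \<open>Boxes determine the product measure, so maps acting on each coordinate separately
  inherit invariance from the real line. This covers translations and negation; a reflection mixes
  coordinates and needs \<open>distr_Rd_reflect\<close>.\<close>

lemma distr_Rd_componentwise:
  assumes m: "\<And>c. c < d \<Longrightarrow> f c \<in> borel_measurable borel"
    and inv: "\<And>c. c < d \<Longrightarrow> distr lborel borel (f c) = lborel"
  shows "distr (Rd d) (Rd d) (\<lambda>x. restrict (\<lambda>c. f c (x c)) {..<d}) = Rd d"
proof -
  have meas: "(\<lambda>x. restrict (\<lambda>c. f c (x c)) {..<d}) \<in> measurable (Rd d) (Rd d)"
    by (rule measurable_into_Rd)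
       (rule measurable_compose[OF measurable_Rd_component m], auto)
  have "distr (Rd d) (Rd d) (\<lambda>x. restrict (\<lambda>c. f c (x c)) {..<d}) = PiM {..<d} (\<lambda>_. lborel)"
  proof (rule lborel_PiM.PiM_eqI)
    fix A :: "nat \<Rightarrow> real set" assume A: "\<And>i. i \<in> {..<d} \<Longrightarrow> A i \<in> sets lborel"
    have PA: "Pi\<^sub>E {..<d} A \<in> sets (Rd d)" unfolding Rd_def
      by (rule sets_PiM_I_finite) (use A in auto)
    have eq: "(\<lambda>x. restrict (\<lambda>c. f c (x c)) {..<d}) -` Pi\<^sub>E {..<d} A \<inter> space (Rd d)
        = Pi\<^sub>E {..<d} (\<lambda>c. f c -` A c)"
      by (auto simp: space_Rd PiE_def Pi_def)
    have V: "f c -` A c \<in> sets lborel" if "c < d" for c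
      using measurable_sets[OF m[OF that], of "A c"] A[of c] that by simp
    have "emeasure (distr (Rd d) (Rd d) (\<lambda>x. restrict (\<lambda>c. f c (x c)) {..<d})) (Pi\<^sub>E {..<d} A)
       = emeasure (Rd d) (Pi\<^sub>E {..<d} (\<lambda>c. f c -` A c))"
      by (subst emeasure_distr[OF meas PA]) (simp add: eq)
    also have "\<dots> = (\<Prod>c<d. emeasure lborel (f c -` A c))"
      unfolding Rd_def by (rule lborel_PiM.emeasure_PiM) (use V in auto)
    also have "\<dots> = (\<Prod>c<d. emeasure lborel (A c))"
    proof (rule prod.cong)
      fix c assume c: "c \<in> {..<d}"
      have "emeasure lborel (A c) = emeasure (distr lborel borel (f c)) (A c)" using inv c by simp
      also have "\<dots> = emeasure lborel (f c -` A c)"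
        by (subst emeasure_distr) (use m c A in auto)
      finally show "emeasure lborel (f c -` A c) = emeasure lborel (A c)" by simp
    qed simp
    finally show "emeasure (distr (Rd d) (Rd d) (\<lambda>x. restrict (\<lambda>c. f c (x c)) {..<d})) (Pi\<^sub>E {..<d} A) = (\<Prod>i\<in>{..<d}. emeasure lborel (A i))" .
  qed (auto simp: Rd_def)
  then show ?thesis by (simp add: Rd_def)
qed

definition translate :: "nat \<Rightarrow> vec \<Rightarrow> vec \<Rightarrow> vec" where
  "translate d v x = restrict (\<lambda>c. v c + x c) {..<d}"

text \<open>An orthogonal reflection only if \<open>ip d v v = 2\<close>.\<close>
definition reflect :: "nat \<Rightarrow> vec \<Rightarrow> vec \<Rightarrow> vec" where
  "reflect d v x = restrict (\<lambda>c. x c - ip d v x * v c) {..<d}"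

lemma distr_Rd_translate: "distr (Rd d) (Rd d) (translate d v) = Rd d"
  unfolding translate_def
  using distr_Rd_componentwise[of d "\<lambda>c. (+) (v c)"] by (simp add: lborel_distr_plus)

lemma distr_Rd_uminus: "distr (Rd d) (Rd d) (\<lambda>x. restrict (\<lambda>c. - x c) {..<d}) = Rd d"
  using distr_Rd_componentwise[of d "\<lambda>c. uminus"] by (simp add: lborel_distr_uminus)

lemma translate_commute: "translate d v x = translate d x v"
  by (simp add: translate_def add.commute)

lemma measurable_translate_pair [measurable]:
  "(\<lambda>(v, x). translate d v x) \<in> measurable (Rd d \<Otimes>\<^sub>M Rd d) (Rd d)"
  unfolding translate_def case_prod_beta
  by (rule measurable_into_Rd) measurable

lemma measurable_translate [measurable]: "translate d v \<in> measurable (Rd d) (Rd d)"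
  unfolding translate_def[abs_def] by (rule measurable_into_Rd) measurable

lemma measurable_reflect [measurable]: "reflect d v \<in> measurable (Rd d) (Rd d)"
  unfolding reflect_def[abs_def] by (rule measurable_into_Rd) measurable

lemma nn_integral_Rd_translate:
  assumes [measurable]: "f \<in> borel_measurable (Rd d)"
  shows "(\<integral>\<^sup>+x. f (translate d v x) \<partial>Rd d) = (\<integral>\<^sup>+x. f x \<partial>Rd d)"
  using nn_integral_distr[of "translate d v" "Rd d" "Rd d" f] distr_Rd_translate[of d v]
  by simp

text \<open>A reference set of finite positive measure: it normalizes the uniform distribution
  behind \<open>sphere_unif\<close>, and it is the factor cancelled in the invariance proof for
  reflections.\<close>

definition Bd :: "nat \<Rightarrow> vec set" where
  "Bd d = {x \<in> space (Rd d). vnorm d x \<le> 1}"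

lemma Bd_sets [measurable]: "Bd d \<in> sets (Rd d)"
  unfolding Bd_def by measurable

lemma emeasure_Bd_finite: "emeasure (Rd d) (Bd d) < \<infinity>"
proof -
  have sub: "Bd d \<subseteq> Pi\<^sub>E {..<d} (\<lambda>_. {-1..1})"
  proof
    fix x assume x: "x \<in> Bd d"
    have "\<bar>x c\<bar> \<le> 1" if "c < d" for c
    proof -
      have "\<bar>x c\<bar> \<le> L2_set (\<lambda>c. \<bar>x c\<bar>) {..<d}"
        by (rule member_le_L2_set) (use that in auto)
      also have "\<dots> = vnorm d x" by (simp add: vnorm_eq_L2 L2_set_def)
      finally show ?thesis using x by (simp add: Bd_def)
    qed
    then have "x c \<in> {-1..1}" if "c < d" for c using that by (auto simp: abs_le_iff)
    then show "x \<in> Pi\<^sub>E {..<d} (\<lambda>_. {-1..1})" using x by (auto simp: Bd_def space_Rd PiE_def)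
  qed
  have "emeasure (Rd d) (Bd d) \<le> emeasure (Rd d) (Pi\<^sub>E {..<d} (\<lambda>_. {-1..1}))"
    by (rule emeasure_mono[OF sub]) (simp add: Rd_def sets_PiM_I_finite)
  also have "\<dots> = (\<Prod>c<d. emeasure lborel {-1..1::real})"
    unfolding Rd_def by (rule lborel_PiM.emeasure_PiM) auto
  also have "\<dots> < \<infinity>" by (simp add: ennreal_power flip: ennreal_numeral)
  finally show ?thesis .
qed

lemma emeasure_Bd_pos: "emeasure (Rd d) (Bd d) > 0"
proof (cases "d = 0")
  case True
  then have "Bd d = space (Rd d)" by (auto simp: Bd_def vnorm_def ip_def)
  then show ?thesis using True by (simp add: Rd_def PiM_empty)
next
  case False
  have sub: "Pi\<^sub>E {..<d} (\<lambda>_. {0..1/real d}) \<subseteq> Bd d"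
  proof
    fix x assume x: "x \<in> Pi\<^sub>E {..<d} (\<lambda>_. {0..1/real d})"
    have "ip d x x \<le> (\<Sum>c<d. 1 / real d * 1)" unfolding ip_def
    proof (rule sum_mono)
      fix c assume c: "c \<in> {..<d}"
      have a: "x c \<in> {0..1/real d}" using PiE_mem[OF x c] .
      moreover have "1 / real d \<le> 1" using False by simp
      ultimately have "x c \<le> 1" "0 \<le> x c" "x c \<le> 1 / real d" by auto
      then show "x c * x c \<le> 1 / real d * 1" by (intro mult_mono) auto
    qed
    also have "\<dots> = 1" using False by simp
    finally have "vnorm d x \<le> 1" by (simp add: vnorm_def)
    then show "x \<in> Bd d" using x by (auto simp: Bd_def space_Rd PiE_def)
  qed
  have "0 < (\<Prod>c<d. emeasure lborel {0..1/real d})"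
    using False by (auto simp: ennreal_power)
  also have "\<dots> = emeasure (Rd d) (Pi\<^sub>E {..<d} (\<lambda>_. {0..1/real d}))"
    unfolding Rd_def by (rule lborel_PiM.emeasure_PiM[symmetric]) auto
  also have "\<dots> \<le> emeasure (Rd d) (Bd d)"
    by (rule emeasure_mono[OF sub]) auto
  finally show ?thesis .
qed

section \<open>Invariance of Lebesgue measure under reflections\<close>

context
  fixes d :: nat and v :: vec
  assumes v2: "ip d v v = 2"
begin

lemma reflect_space: "reflect d v x \<in> space (Rd d)"
  by (simp add: reflect_def space_Rd)

lemma ip_reflect_right: "ip d w (reflect d v x) = ip d w x - ip d v x * ip d w v"
  unfolding reflect_def by (simp add: ip_diff_right ip_scale_right)

lemma reflect_reflect:
  assumes "x \<in> space (Rd d)"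
  shows "reflect d v (reflect d v x) = x"
proof
  fix c
  have "ip d v (reflect d v x) = - ip d v x" using v2 by (simp add: ip_reflect_right)
  then show "reflect d v (reflect d v x) c = x c"
    unfolding reflect_def[of d v "reflect d v x"] using assms
    by (auto simp: reflect_def space_Rd extensional_def)
qed

lemma ip_self_reflect: "ip d (reflect d v x) (reflect d v x) = ip d x x"
proof -
  have "ip d (reflect d v x) (reflect d v x) = ip d (reflect d v x) x - ip d v x * ip d (reflect d v x) v"
    by (rule ip_reflect_right)
  also have "\<dots> = ip d x x"
    using v2 by (simp add: ip_commute[of d "reflect d v x"] ip_reflect_right ip_commute[of d x v])
  finally show ?thesis .
qed

lemma reflect_add:
  "reflect d v (translate d y x) = translate d (reflect d v y) (reflect d v x)"
  by (rule ext) (auto simp: reflect_def translate_def ip_add_right algebra_simps)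

text \<open>The uniqueness argument for Haar measure: integrate \<open>\<lambda>(x, y). 1\<^sub>A (T y) 1\<^sub>B (x)\<close> with the
  unit ball \<open>B\<close>, translating by \<open>T x\<close> and by \<open>T y\<close>.\<close>
lemma distr_Rd_reflect: "distr (Rd d) (Rd d) (reflect d v) = Rd d"
proof (rule measure_eqI)
  fix A assume "A \<in> sets (distr (Rd d) (Rd d) (reflect d v))"
  then have A [measurable]: "A \<in> sets (Rd d)" by simp
  interpret sf: sigma_finite_measure "Rd d" by (rule sigma_finite_Rd)
  interpret P: pair_sigma_finite "Rd d" "Rd d" ..
  let ?T = "reflect d v" and ?M = "Rd d" and ?B = "Bd d"
  let ?neg = "\<lambda>x. restrict (\<lambda>c. - x c) {..<d}"
  have [measurable]: "?neg \<in> measurable ?M ?M" by (rule measurable_into_Rd) measurable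
  have tr: "translate d u x \<in> space ?M" for u x by (simp add: translate_def space_Rd)
  have "emeasure ?M (?T -` A \<inter> space ?M) * emeasure ?M ?B
      = (\<integral>\<^sup>+x. (\<integral>\<^sup>+y. indicator A (?T y) * indicator ?B x \<partial>?M) \<partial>?M)"
  proof -
    have "(\<integral>\<^sup>+y. indicator A (?T y) * indicator ?B x \<partial>?M)
      = emeasure ?M (?T -` A \<inter> space ?M) * indicator ?B x" for x
    proof -
      have "(\<integral>\<^sup>+y. indicator A (?T y) * indicator ?B x \<partial>?M)
          = (\<integral>\<^sup>+y. indicator (?T -` A \<inter> space ?M) y * indicator ?B x \<partial>?M)"
        by (rule nn_integral_cong) (simp add: indicator_def)
      also have "\<dots> = emeasure ?M (?T -` A \<inter> space ?M) * indicator ?B x"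
        by (simp add: nn_integral_multc)
      finally show ?thesis .
    qed
    then show ?thesis by (simp add: nn_integral_cmult)
  qed
  \<comment> \<open>Translating by \<open>T x\<close> is useful because T is a linear involution:
    \<open>T (T x + y) = x + T y\<close>.\<close>
  also have "\<dots> = (\<integral>\<^sup>+x. (\<integral>\<^sup>+y. indicator A (?T (translate d (?T x) y)) * indicator ?B x \<partial>?M) \<partial>?M)"
    by (rule nn_integral_cong, rule nn_integral_Rd_translate[symmetric]) measurable
  also have "\<dots> = (\<integral>\<^sup>+x. (\<integral>\<^sup>+y. indicator A (translate d (?T y) x) * indicator ?B x \<partial>?M) \<partial>?M)"
    by (intro nn_integral_cong) (simp add: reflect_add reflect_reflect translate_commute)
  also have "\<dots> = (\<integral>\<^sup>+y. (\<integral>\<^sup>+x. indicator A (translate d (?T y) x) * indicator ?B x \<partial>?M) \<partial>?M)"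
    by (rule P.Fubini') measurable
  also have "\<dots> = (\<integral>\<^sup>+y. (\<integral>\<^sup>+x. indicator A x * indicator ?B (translate d (?neg (?T y)) x) \<partial>?M) \<partial>?M)"
  proof (rule nn_integral_cong)
    fix y assume y: "y \<in> space ?M"
    have "(\<integral>\<^sup>+x. indicator A x * indicator ?B (translate d (?neg (?T y)) x) \<partial>?M)
        = (\<integral>\<^sup>+x. indicator A (translate d (?T y) x) * indicator ?B (translate d (?neg (?T y)) (translate d (?T y) x)) \<partial>?M)"
      by (rule nn_integral_Rd_translate[symmetric]) measurable
    also have "\<dots> = (\<integral>\<^sup>+x. indicator A (translate d (?T y) x) * indicator ?B x \<partial>?M)"
    proof (rule nn_integral_cong)
      fix x assume "x \<in> space ?M"
      then have "translate d (?neg (?T y)) (translate d (?T y) x) = x"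
        by (auto simp: translate_def space_Rd extensional_def)
      then show "indicator A (translate d (?T y) x) * indicator ?B (translate d (?neg (?T y)) (translate d (?T y) x))
        = (indicator A (translate d (?T y) x) * indicator ?B x :: ennreal)" by simp
    qed
    finally show "(\<integral>\<^sup>+x. indicator A (translate d (?T y) x) * indicator ?B x \<partial>?M)
      = (\<integral>\<^sup>+x. indicator A x * indicator ?B (translate d (?neg (?T y)) x) \<partial>?M)" by simp
  qed
  also have "\<dots> = (\<integral>\<^sup>+x. (\<integral>\<^sup>+y. indicator A x * indicator ?B (translate d (?neg (?T y)) x) \<partial>?M) \<partial>?M)"
    by (rule P.Fubini'[symmetric]) measurable
  \<comment> \<open>The key symmetry: T is self-adjoint and isometric, so the squared norm of
    \<open>x - T y\<close> equals that of \<open>y - T x\<close>, and membership in the ball depends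
    on the norm alone. Now the ball is translated by a vector depending on the outer variable
    only.\<close>
  also have "\<dots> = (\<integral>\<^sup>+x. (\<integral>\<^sup>+y. indicator A x * indicator ?B (translate d (?neg (?T x)) y) \<partial>?M) \<partial>?M)"
  proof (intro nn_integral_cong)
    fix x y assume "x \<in> space ?M" "y \<in> space ?M"
    have sq: "ip d (translate d (?neg z) x) (translate d (?neg z) x) = ip d x x - 2 * ip d x z + ip d z z" for x z
    proof -
      have "translate d (?neg z) x = restrict (\<lambda>c. x c - z c) {..<d}"
        by (auto simp: translate_def)
      then show ?thesis
        by (simp add: ip_diff_left ip_diff_right ip_commute[of d z x])
    qed
    have "ip d (translate d (?neg (?T y)) x) (translate d (?neg (?T y)) x)
        = ip d x x - 2 * ip d x (?T y) + ip d y y"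
      by (simp add: sq ip_self_reflect)
    moreover have "ip d (translate d (?neg (?T x)) y) (translate d (?neg (?T x)) y)
        = ip d y y - 2 * ip d y (?T x) + ip d x x"
      by (simp add: sq ip_self_reflect)
    moreover have "ip d x (?T y) = ip d y (?T x)"
      by (simp add: ip_reflect_right ip_commute)
    ultimately show "indicator A x * indicator ?B (translate d (?neg (?T y)) x)
      = (indicator A x * indicator ?B (translate d (?neg (?T x)) y) :: ennreal)"
      by (simp add: Bd_def vnorm_def tr indicator_def)
  qed
  also have "\<dots> = (\<integral>\<^sup>+x. (\<integral>\<^sup>+y. indicator A x * indicator ?B y \<partial>?M) \<partial>?M)"
    by (rule nn_integral_cong, rule nn_integral_Rd_translate) measurable
  also have "\<dots> = emeasure ?M A * emeasure ?M ?B"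
    by (simp add: nn_integral_cmult nn_integral_multc)
  finally have "emeasure ?M (?T -` A \<inter> space ?M) * emeasure ?M ?B = emeasure ?M A * emeasure ?M ?B" .
  moreover have "emeasure ?M ?B \<noteq> 0" "emeasure ?M ?B \<noteq> \<infinity>"
    using emeasure_Bd_pos[of d] emeasure_Bd_finite[of d] by auto
  ultimately have "emeasure ?M (?T -` A \<inter> space ?M) = emeasure ?M A"
    by (metis ennreal_mult_cancel_left infinity_ennreal_def mult.commute)
  then show "emeasure (distr ?M ?M ?T) A = emeasure ?M A"
    by (simp add: emeasure_distr)
qed simp

end

text \<open>Parallel hyperplanes are translates, hence of equal measure. Integrating this common
  value over all levels t gives, by Fubini, the integral of the Lebesgue measure of single points,
  which is 0; as the line has infinite measure, the common value is 0.\<close>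

lemma emeasure_Rd_hyperplane:
  assumes v: "ip d v v > 0"
  shows "emeasure (Rd d) {x \<in> space (Rd d). ip d v x = 0} = 0"
proof -
  interpret sf: sigma_finite_measure "Rd d" by (rule sigma_finite_Rd)
  interpret P: pair_sigma_finite "Rd d" "lborel :: real measure" ..
  let ?M = "Rd d"
  let ?f = "\<lambda>x t. indicator {0} (ip d v x - t) :: ennreal"
  have eq: "(\<integral>\<^sup>+x. ?f x t \<partial>?M) = emeasure ?M {x \<in> space ?M. ip d v x = 0}" for t :: real
  proof -
    define w where "w = (\<lambda>c. (t / ip d v v) * v c)"
    have w: "ip d v w = t" unfolding w_def ip_scale_right using v by simp
    have "(\<integral>\<^sup>+x. ?f x t \<partial>?M) = (\<integral>\<^sup>+x. ?f (translate d w x) t \<partial>?M)"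
      by (rule nn_integral_Rd_translate[symmetric]) measurable
    also have "\<dots> = (\<integral>\<^sup>+x. indicator {x \<in> space ?M. ip d v x = 0} x \<partial>?M)"
    proof (rule nn_integral_cong)
      fix x assume x: "x \<in> space ?M"
      have "ip d v (translate d w x) = t + ip d v x"
        using w by (simp add: translate_def ip_add_right)
      then show "?f (translate d w x) t = indicator {x \<in> space ?M. ip d v x = 0} x"
        using x by (auto simp: indicator_def)
    qed
    also have "\<dots> = emeasure ?M {x \<in> space ?M. ip d v x = 0}"
      by (rule nn_integral_indicator) measurable
    finally show ?thesis .
  qed
  have "(\<integral>\<^sup>+t. (\<integral>\<^sup>+x. ?f x t \<partial>?M) \<partial>(lborel::real measure)) = (\<integral>\<^sup>+x. (\<integral>\<^sup>+t. ?f x t \<partial>(lborel::real measure)) \<partial>?M)"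
    by (rule P.Fubini') measurable
  also have "\<dots> = (\<integral>\<^sup>+x. 0 \<partial>?M)"
  proof (rule nn_integral_cong)
    fix x
    have "(\<integral>\<^sup>+t. ?f x t \<partial>(lborel::real measure)) = (\<integral>\<^sup>+t. indicator {ip d v x} t \<partial>(lborel::real measure))"
      by (rule nn_integral_cong) (auto simp: indicator_def)
    then show "(\<integral>\<^sup>+t. ?f x t \<partial>(lborel::real measure)) = 0" by simp
  qed
  finally have "emeasure ?M {x \<in> space ?M. ip d v x = 0} * emeasure lborel (UNIV :: real set) = 0"
    by (simp add: eq)
  then show ?thesis by (simp add: ennreal_mult_eq_top_iff ennreal_top_mult)
qed


section \<open>The uniform distribution on the sphere\<close>

lemma measurable_uminus_Rd [measurable]:
  "(\<lambda>x. restrict (\<lambda>c. - x c) {..<d}) \<in> measurable (Rd d) (Rd d)"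
  by (rule measurable_into_Rd) measurable

lemma vnorm_uminus: "vnorm d (restrict (\<lambda>c. - x c) {..<d}) = vnorm d x"
  by (simp add: vnorm_def ip_def)

lemma emeasure_Bd_reflect:
  assumes "ip d v v = 2" and [measurable]: "A \<in> sets (Rd d)"
  shows "emeasure (Rd d) {x \<in> Bd d. reflect d v x \<in> A} = emeasure (Rd d) (Bd d \<inter> A)"
proof -
  have "emeasure (Rd d) (Bd d \<inter> A) = emeasure (distr (Rd d) (Rd d) (reflect d v)) (Bd d \<inter> A)"
    using distr_Rd_reflect[OF assms(1)] by simp
  also have "\<dots> = emeasure (Rd d) (reflect d v -` (Bd d \<inter> A) \<inter> space (Rd d))"
    by (rule emeasure_distr) measurable
  also have "reflect d v -` (Bd d \<inter> A) \<inter> space (Rd d) = {x \<in> Bd d. reflect d v x \<in> A}"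
    using reflect_space[OF assms(1)] ip_self_reflect[OF assms(1)]
    by (auto simp: Bd_def vnorm_def)
  finally show ?thesis by simp
qed

lemma emeasure_Bd_uminus:
  assumes [measurable]: "A \<in> sets (Rd d)"
  shows "emeasure (Rd d) {x \<in> Bd d. restrict (\<lambda>c. - x c) {..<d} \<in> A} = emeasure (Rd d) (Bd d \<inter> A)"
proof -
  let ?neg = "\<lambda>x::vec. restrict (\<lambda>c. - x c) {..<d}"
  have "emeasure (Rd d) (Bd d \<inter> A) = emeasure (distr (Rd d) (Rd d) ?neg) (Bd d \<inter> A)"
    by (simp add: distr_Rd_uminus)
  also have "\<dots> = emeasure (Rd d) (?neg -` (Bd d \<inter> A) \<inter> space (Rd d))"
    by (rule emeasure_distr) measurable
  also have "?neg -` (Bd d \<inter> A) \<inter> space (Rd d) = {x \<in> Bd d. ?neg x \<in> A}"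
    by (auto simp: Bd_def vnorm_uminus space_Rd)
  finally show ?thesis by simp
qed

text \<open>The pattern of the opposite label is left out of the comparison because it never shares
  an input with \<open>pat s\<close>. The absolute values make the condition symmetric under sign
  changes of the noise coordinates and, for \<open>d \<ge> 3\<close>, force the leading coordinate
  to be positive.\<close>

definition dominant :: "nat \<Rightarrow> (nat \<Rightarrow> vec) \<Rightarrow> nat \<Rightarrow> vec \<Rightarrow> bool" where
  "dominant d pat s w \<longleftrightarrow> (\<forall>l\<in>{3..d}. \<bar>ip d w (pat l)\<bar> < ip d w (pat s))"

lemma measurable_dominant [measurable]: "{x \<in> space (Rd d). dominant d pat s x} \<in> sets (Rd d)"
  unfolding dominant_def ip_commute[of d _ "pat _"] by measurable

definition orthonormal_system :: "nat \<Rightarrow> (nat \<Rightarrow> vec) \<Rightarrow> bool" where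
  "orthonormal_system d pat \<longleftrightarrow>
     (\<forall>i\<in>{1..d}. \<forall>j\<in>{1..d}. ip d (pat i) (pat j) = (if i = j then 1 else 0))"

text \<open>By symmetry under the reflections exchanging \<open>pat s\<close> and \<open>pat l\<close>, each of the \<open>d - 1\<close> coordinates
  is the largest in absolute value with the same probability; the sign costs a further factor 2.\<close>
lemma emeasure_Bd_dominant:
  assumes on: "orthonormal_system d pat" and d: "d \<ge> 3" and s: "s \<in> {1, 2}"
  shows "emeasure (Rd d) (Bd d) \<le> ennreal (2 * real d) * emeasure (Rd d) (Bd d \<inter> {x. dominant d pat s x})"
proof -
  let ?M = "Rd d"
  define u where "u l x = ip d (pat l) x" for l x
  have u_meas [measurable]: "(\<lambda>x. u l x) \<in> borel_measurable ?M" for l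
    unfolding u_def by (rule measurable_ip_Rd)
  define I where "I = insert s {3..d}"
  have I: "finite I" "I \<subseteq> {1..d}" "I \<noteq> {}" "card I \<le> d" "3 \<in> I" "s \<in> I"
    using s d by (auto simp: I_def)
  have onr: "ip d (pat i) (pat j) = (if i = j then 1 else 0)" if "i \<in> I" "j \<in> I" for i j
    using on that subsetD[OF I(2)] unfolding orthonormal_system_def by blast
  define F where "F l = {x \<in> space ?M. \<forall>l'\<in>I. \<bar>u l' x\<bar> \<le> \<bar>u l x\<bar>}" for l
  define G where "G = {x \<in> space ?M. dominant d pat s x}"
  have G_alt: "x \<in> G \<longleftrightarrow> x \<in> space ?M \<and> (\<forall>l\<in>{3..d}. \<bar>u l x\<bar> < u s x)" for x
    by (simp add: G_def dominant_def u_def ip_commute)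
  have F_meas [measurable]: "F l \<in> sets ?M" for l 
    unfolding F_def
    by (intro sets.sets_Collect_finite_All I(1) borel_measurable_le borel_measurable_abs u_meas)
  have G_meas [measurable]: "G \<in> sets ?M" unfolding G_def by measurable
  \<comment> \<open>The mirror image of G: the points where coordinate s is largest in absolute
    value but negative.\<close>
  define NG where "NG = {x \<in> Bd d. restrict (\<lambda>c. - x c) {..<d} \<in> G}"
  have NG_meas [measurable]: "NG \<in> sets ?M"
  proof -
    have "NG = (\<lambda>x. restrict (\<lambda>c. - x c) {..<d}) -` G \<inter> space ?M \<inter> Bd d"
      by (auto simp: NG_def Bd_def)
    then show ?thesis by simp
  qed
  \<comment> \<open>The ties \<open>\<bar>u l\<bar> = \<bar>u s\<bar>\<close>, a finite union of
    hyperplanes. Off this null set the weak maximality in \<open>F s\<close> becomes the strict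
    inequality required by \<open>dominant\<close>.\<close>
  define H where "H = (\<Union>l\<in>{3..d}. {x \<in> space ?M. ip d (\<lambda>c. pat s c - pat l c) x = 0} \<union>
       {x \<in> space ?M. ip d (\<lambda>c. pat s c + pat l c) x = 0})"
  have H_meas [measurable]: "H \<in> sets ?M" unfolding H_def by measurable
  have sl: "s \<noteq> l" if "l \<in> {3..d}" for l using s that by auto
  have H0: "emeasure ?M H = 0"
  proof -
    have "H \<in> null_sets ?M" unfolding H_def
    proof (rule null_sets_UN')
      fix l assume l: "l \<in> {3..d}"
      have "l \<in> I" "s \<in> I" "s \<noteq> l" using l sl I by (auto simp: I_def)
      then have "ip d (\<lambda>c. pat s c - pat l c) (\<lambda>c. pat s c - pat l c) > 0"
        "ip d (\<lambda>c. pat s c + pat l c) (\<lambda>c. pat s c + pat l c) > 0"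
        by (simp_all add: ip_diff_left ip_diff_right ip_add_left ip_add_right onr)
      then show "{x \<in> space ?M. ip d (\<lambda>c. pat s c - pat l c) x = 0} \<union>
          {x \<in> space ?M. ip d (\<lambda>c. pat s c + pat l c) x = 0} \<in> null_sets ?M"
        by (intro null_sets.Un null_setsI emeasure_Rd_hyperplane) measurable
    qed auto
    then show ?thesis by auto
  qed
  have swap: "emeasure ?M (Bd d \<inter> F l) = emeasure ?M (Bd d \<inter> F s)" if l: "l \<in> I" for l
  proof (cases "l = s")
    case False
    \<comment> \<open>The difference of two orthonormal vectors has squared norm 2, exactly the
      normalization \<open>reflect\<close> asks for. Reflecting in it exchanges coordinates s and l
      and fixes the other coordinates in I.\<close>
    define v where "v = (\<lambda>c. pat s c - pat l c)"
    have v2: "ip d v v = 2"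
      unfolding v_def using l I False by (simp add: ip_diff_left ip_diff_right onr)
    have ur: "u l' (reflect d v x) = (if l' = s then u l x else if l' = l then u s x else u l' x)"
      if "l' \<in> I" for l' x
    proof -
      have "u l' (reflect d v x) = u l' x - (u s x - u l x) * (ip d (pat l') (pat s) - ip d (pat l') (pat l))"
        unfolding u_def by (subst ip_reflect_right[OF v2]) (simp add: v_def ip_diff_left ip_diff_right)
      then show ?thesis using that l I False by (simp add: onr)
    qed
    have "{x \<in> Bd d. reflect d v x \<in> F s} = Bd d \<inter> F l"
    proof -
      have "reflect d v x \<in> F s \<longleftrightarrow> x \<in> F l" if "x \<in> space ?M" for x
      proof -
        have "(\<forall>l'\<in>I. \<bar>u l' (reflect d v x)\<bar> \<le> \<bar>u s (reflect d v x)\<bar>) \<longleftrightarrow>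
              (\<forall>l'\<in>I. \<bar>u l' x\<bar> \<le> \<bar>u l x\<bar>)"
        proof -
          have us: "u s (reflect d v x) = u l x" and ul: "u l (reflect d v x) = u s x"
            using ur[OF I(6)] ur[OF l] False by auto
          have uo: "u l' (reflect d v x) = u l' x" if "l' \<in> I" "l' \<noteq> s" "l' \<noteq> l" for l'
            using ur[OF that(1)] that by simp
          show ?thesis unfolding us by (metis us ul uo l I(6) order_refl)
        qed
        then show ?thesis using that reflect_space[OF v2] by (simp add: F_def)
      qed
      then show ?thesis by (auto simp: Bd_def)
    qed
    then show ?thesis using emeasure_Bd_reflect[OF v2 F_meas[of s]] by simp
  qed simp
  have cover: "Bd d \<subseteq> (\<Union>l\<in>I. Bd d \<inter> F l)"
  proof
    fix x assume x: "x \<in> Bd d"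
    obtain l where "l \<in> I" "\<And>l'. l' \<in> I \<Longrightarrow> \<bar>u l' x\<bar> \<le> \<bar>u l x\<bar>"
    proof -
      have ne: "(\<lambda>l. \<bar>u l x\<bar>) ` I \<noteq> {}" "finite ((\<lambda>l. \<bar>u l x\<bar>) ` I)" using I by auto
      obtain l where "l \<in> I" "Max ((\<lambda>l. \<bar>u l x\<bar>) ` I) = \<bar>u l x\<bar>" using Max_in[OF ne(2,1)] by auto
      then show ?thesis using that[of l] Max_ge[OF ne(2)] by auto
    qed
    then show "x \<in> (\<Union>l\<in>I. Bd d \<inter> F l)" using x by (auto simp: F_def Bd_def)
  qed
  have "emeasure ?M (Bd d) \<le> emeasure ?M (\<Union>l\<in>I. Bd d \<inter> F l)"
    by (rule emeasure_mono[OF cover]) (use I(1) in \<open>auto intro!: sets.finite_UN\<close>)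
  also have "\<dots> \<le> (\<Sum>l\<in>I. emeasure ?M (Bd d \<inter> F l))"
    by (rule emeasure_subadditive_finite) (use I in auto)
  also have "\<dots> = of_nat (card I) * emeasure ?M (Bd d \<inter> F s)"
    by (simp add: swap)
  also have "\<dots> \<le> of_nat d * emeasure ?M (Bd d \<inter> F s)"
    by (rule mult_right_mono) (use I(4) in auto)
  also have "emeasure ?M (Bd d \<inter> F s) \<le> emeasure ?M ((Bd d \<inter> G \<union> NG) \<union> H)"
  proof (rule emeasure_mono)
    show "Bd d \<inter> F s \<subseteq> (Bd d \<inter> G \<union> NG) \<union> H"
    proof
      fix x assume x: "x \<in> Bd d \<inter> F s"
      have sp: "x \<in> space ?M" using x by (auto simp: Bd_def)
      show "x \<in> (Bd d \<inter> G \<union> NG) \<union> H"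
      proof (rule ccontr)
        assume n: "x \<notin> (Bd d \<inter> G \<union> NG) \<union> H"
        have lt: "\<bar>u l x\<bar> < \<bar>u s x\<bar>" if l: "l \<in> {3..d}" for l
        proof -
          have "u s x - u l x \<noteq> 0" "u s x + u l x \<noteq> 0"
            using n l sp unfolding H_def u_def by (auto simp: ip_diff_left ip_add_left)
          moreover have "\<bar>u l x\<bar> \<le> \<bar>u s x\<bar>" using x l by (auto simp: F_def I_def)
          ultimately show ?thesis by linarith
        qed
        have negu: "u l (restrict (\<lambda>c. - x c) {..<d}) = - u l x" for l
          by (simp add: u_def ip_uminus_right)
        show False
        proof (cases "u s x \<ge> 0")
          case True
          then have "x \<in> G" using lt sp by (auto simp: G_alt)
          then show False using n x by auto
        next
          case False
          then have "restrict (\<lambda>c. - x c) {..<d} \<in> G" using lt by (auto simp: G_alt negu space_Rd)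
          then show False using n x by (auto simp: NG_def)
        qed
      qed
    qed
  qed auto
  also have "emeasure ?M ((Bd d \<inter> G \<union> NG) \<union> H) \<le> emeasure ?M (Bd d \<inter> G) + emeasure ?M NG + emeasure ?M H"
    by (intro order_trans[OF emeasure_subadditive] add_mono emeasure_subadditive) auto
  also have "emeasure ?M NG = emeasure ?M (Bd d \<inter> G)"
    unfolding NG_def by (rule emeasure_Bd_uminus) measurable
  finally have "emeasure ?M (Bd d) \<le> of_nat d * (emeasure ?M (Bd d \<inter> G) + emeasure ?M (Bd d \<inter> G))"
    using H0 by (simp add: mult_left_mono)
  also have "\<dots> = ennreal (2 * real d) * emeasure ?M (Bd d \<inter> G)"
  proof -
    have "of_nat d * (e + e) = (2 * of_nat d) * e" for e :: ennreal
      by (metis mult.assoc mult.commute mult_2)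
    moreover have "ennreal (2 * real d) = 2 * of_nat d"
      by (simp add: ennreal_mult ennreal_of_nat_eq_real_of_nat)
    ultimately show ?thesis by simp
  qed
  also have "Bd d \<inter> G = Bd d \<inter> {x. dominant d pat s x}" by (auto simp: G_def Bd_def)
  finally show ?thesis .
qed

lemma prob_space_ball: "prob_space (uniform_measure (Rd d) (Bd d))"
  by (rule prob_space_uniform_measure) (use emeasure_Bd_pos[of d] emeasure_Bd_finite[of d] in auto)

lemma measurable_normalize:
  "(\<lambda>x. restrict (\<lambda>c. r * x c / vnorm d x) {..<d}) \<in> measurable (Rd d) (Rd d)"
  by (rule measurable_into_Rd) measurable

lemma sphere_unif_eq: "sphere_unif d r = distr (uniform_measure (Rd d) (Bd d)) (Rd d)
           (\<lambda>x. restrict (\<lambda>c. r * x c / vnorm d x) {..<d})"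
  by (simp add: sphere_unif_def Bd_def)

lemma sets_sphere_unif [simp, measurable_cong]: "sets (sphere_unif d r) = sets (Rd d)"
  by (simp add: sphere_unif_eq)

lemma space_sphere_unif [simp]: "space (sphere_unif d r) = space (Rd d)"
  by (simp add: sphere_unif_eq)

lemma prob_space_sphere_unif: "prob_space (sphere_unif d r)"
  unfolding sphere_unif_eq
  by (rule prob_space.prob_space_distr[OF prob_space_ball])
     (use measurable_normalize in \<open>simp add: measurable_def\<close>)

lemma ip_normalize: "ip d (restrict (\<lambda>c. r * x c / vnorm d x) {..<d}) w = (r / vnorm d x) * ip d x w"
proof -
  have "(\<lambda>c. r * x c / vnorm d x) = (\<lambda>c. (r / vnorm d x) * x c)" by auto
  from arg_cong[OF this, of "\<lambda>f. ip d f w"] show ?thesis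
    unfolding ip_restrict_left ip_scale_left .
qed

text \<open>An inequality, so that the origin needs no separate treatment: division by zero sends it
  to the zero vector, and the bound holds at every point of the ball.\<close>

lemma AE_sphere_unif_vnorm:
  assumes "r > 0"
  shows "AE w in sphere_unif d r. vnorm d w \<le> r"
proof -
  have "vnorm d (restrict (\<lambda>c. r * x c / vnorm d x) {..<d}) \<le> r" for x
  proof -
    let ?z = "restrict (\<lambda>c. r * x c / vnorm d x) {..<d}"
    have "ip d ?z ?z = (r / vnorm d x) * ((r / vnorm d x) * ip d x x)"
      by (subst ip_normalize, subst ip_commute, subst ip_normalize) (rule refl)
    also have "\<dots> = (r / vnorm d x)\<^sup>2 * (vnorm d x)\<^sup>2" by (simp only: vnorm_power2) (simp add: power2_eq_square)
    also have "\<dots> \<le> r\<^sup>2" by (simp add: power_divide)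
    finally show ?thesis using assms by (simp add: vnorm_def real_le_lsqrt)
  qed
  then show ?thesis unfolding sphere_unif_eq
    by (subst AE_distr_iff) (use measurable_normalize[of r d] in \<open>auto simp: measurable_def\<close>)
qed

text \<open>Dominance survives positive scaling, so the estimate passes from the ball to the sphere.
  A dominant vector cannot have norm 0, since Cauchy-Schwarz would make its positive leading inner
  product vanish.\<close>

lemma measure_sphere_unif_dominant:
  assumes on: "orthonormal_system d pat" and d: "d \<ge> 3" and s: "s \<in> {1, 2}" and r: "r > 0"
  shows "measure (sphere_unif d r) {w \<in> space (Rd d). dominant d pat s w} \<ge> 1 / (2 * real d)"
proof -
  let ?g = "\<lambda>x. restrict (\<lambda>c. r * x c / vnorm d x) {..<d}" and ?U = "uniform_measure (Rd d) (Bd d)"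
  let ?D = "{w \<in> space (Rd d). dominant d pat s w}"
  interpret U: prob_space ?U by (rule prob_space_ball)
  have gm: "?g \<in> measurable ?U (Rd d)" using measurable_normalize[of r d] by (simp add: measurable_def)
  have Dm: "?D \<in> sets (Rd d)" by measurable
  have sub: "?D \<subseteq> ?g -` ?D \<inter> space ?U"
  proof
    fix x assume x: "x \<in> ?D"
    have "\<bar>ip d x (pat 3)\<bar> < ip d x (pat s)" using x d unfolding dominant_def by simp
    then have "ip d x (pat s) > 0" by linarith
    then have "vnorm d x \<noteq> 0" using abs_ip_le[of d x "pat s"] by auto
    then have p: "r / vnorm d x > 0" using r vnorm_nonneg[of d x] by (simp add: less_le)
    have "dominant d pat s (?g x)" unfolding dominant_def
    proof
      fix l assume "l \<in> {3..d}"
      then have "\<bar>ip d x (pat l)\<bar> < ip d x (pat s)" using x unfolding dominant_def by auto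
      then have "(r / vnorm d x) * \<bar>ip d x (pat l)\<bar> < (r / vnorm d x) * ip d x (pat s)"
        using p by (rule mult_strict_left_mono)
      then show "\<bar>ip d (?g x) (pat l)\<bar> < ip d (?g x) (pat s)"
        unfolding ip_normalize abs_mult using p by (simp only: abs_of_pos)
    qed
    then show "x \<in> ?g -` ?D \<inter> space ?U" using x by (auto simp: space_Rd)
  qed
  have "emeasure ?U ?D = emeasure (Rd d) (Bd d \<inter> ?D) / emeasure (Rd d) (Bd d)"
    by (rule emeasure_uniform_measure) measurable
  moreover have "Bd d \<inter> ?D = Bd d \<inter> {x. dominant d pat s x}" by (auto simp: Bd_def)
  ultimately have eq: "emeasure ?U ?D * ennreal (2 * real d) =
     ennreal (2 * real d) * emeasure (Rd d) (Bd d \<inter> {x. dominant d pat s x}) / emeasure (Rd d) (Bd d)"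
    by (simp add: divide_ennreal_def mult_ac)
  have "1 = emeasure (Rd d) (Bd d) / emeasure (Rd d) (Bd d)"
    using emeasure_Bd_pos[of d] emeasure_Bd_finite[of d] by (simp add: ennreal_divide_self)
  also have "\<dots> \<le> emeasure ?U ?D * ennreal (2 * real d)"
    unfolding eq by (intro divide_right_mono_ennreal emeasure_Bd_dominant[OF on d s])
  also have "\<dots> = ennreal (measure ?U ?D * (2 * real d))"
    by (simp add: U.emeasure_eq_measure ennreal_mult)
  finally have "1 \<le> measure ?U ?D * (2 * real d)" by (simp only: ennreal_ge_1)
  then have "1 / (2 * real d) \<le> measure ?U ?D" using d by (simp add: field_simps)
  also have "\<dots> \<le> measure ?U (?g -` ?D \<inter> space ?U)"
    by (rule U.finite_measure_mono[OF sub]) (use measurable_sets[OF gm Dm] in simp)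
  also have "\<dots> = measure (sphere_unif d r) ?D"
    unfolding sphere_unif_eq by (rule measure_distr[OF gm Dm, symmetric])
  finally show ?thesis .
qed


section \<open>Good neurons at initialization\<close>

definition good_neurons :: "nat \<Rightarrow> nat \<Rightarrow> (nat \<Rightarrow> vec) \<Rightarrow> nat \<Rightarrow> real \<Rightarrow> (nat \<Rightarrow> vec) \<Rightarrow> (nat \<Rightarrow> real) \<Rightarrow> nat set" where
  "good_neurons d k pat s \<sigma> W a = {i. i < k \<and> a i = \<sigma> \<and> dominant d pat s (W i)}"

abbreviation coin :: "real measure" where
  "coin \<equiv> measure_pmf (pmf_of_set {1, -1})"

abbreviation initM :: "nat \<Rightarrow> nat \<Rightarrow> real \<Rightarrow> ((nat \<Rightarrow> vec) \<times> (nat \<Rightarrow> real)) measure" where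
  "initM d k r \<equiv> initW d k r \<Otimes>\<^sub>M inita k"

lemma prob_space_initW: "prob_space (initW d k r)"
  unfolding initW_def by (rule prob_space_PiM) (rule prob_space_sphere_unif)

lemma prob_space_inita: "prob_space (inita k)"
  unfolding inita_def by (rule prob_space_PiM) (rule prob_space_measure_pmf)

lemma prob_space_initM: "prob_space (initM d k r)"
proof -
  interpret A: prob_space "initW d k r" by (rule prob_space_initW)
  interpret B: prob_space "inita k" by (rule prob_space_inita)
  interpret pair_prob_space "initW d k r" "inita k" ..
  show ?thesis by (rule prob_space_axioms)
qed

lemma measurable_initW_component:
  "i < k \<Longrightarrow> (\<lambda>W. W i) \<in> measurable (initW d k r) (Rd d)"
  using measurable_component_singleton[of i "{..<k}" "\<lambda>_. sphere_unif d r"]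
  by (simp add: initW_def measurable_cong_sets[OF refl sets_sphere_unif])

lemma measurable_inita_component:
  "i < k \<Longrightarrow> (\<lambda>a. a i) \<in> measurable (inita k) (count_space UNIV)"
  using measurable_component_singleton[of i "{..<k}" "\<lambda>_. coin"]
  by (simp add: inita_def measurable_cong_sets[OF refl sets_measure_pmf_count_space])

lemma space_initW: "W \<in> space (initW d k r) \<Longrightarrow> i < k \<Longrightarrow> W i \<in> space (Rd d)"
  by (auto simp: initW_def space_PiM PiE_def)

lemma good_neuron_set:
  assumes "i < k"
  shows "{\<omega> \<in> space (initM d k r). snd \<omega> i = \<sigma> \<and> dominant d pat s (fst \<omega> i)} \<in> sets (initM d k r)"
proof -
  have m1: "(\<lambda>\<omega>. fst \<omega> i) \<in> measurable (initM d k r) (Rd d)"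
    by (rule measurable_compose[OF measurable_fst measurable_initW_component[OF assms]])
  have m2: "(\<lambda>\<omega>. snd \<omega> i) \<in> measurable (initM d k r) (count_space UNIV)"
    by (rule measurable_compose[OF measurable_snd measurable_inita_component[OF assms]])
  have "{\<omega> \<in> space (initM d k r). snd \<omega> i = \<sigma> \<and> dominant d pat s (fst \<omega> i)} =
     ((\<lambda>\<omega>. fst \<omega> i) -` {w \<in> space (Rd d). dominant d pat s w} \<inter> space (initM d k r)) \<inter>
     ((\<lambda>\<omega>. snd \<omega> i) -` {\<sigma>} \<inter> space (initM d k r))"
    using space_initW[OF _ assms] by (auto simp: space_pair_measure)
  also have "\<dots> \<in> sets (initM d k r)"
    by (intro sets.Int measurable_sets[OF m1] measurable_sets[OF m2] measurable_dominant) auto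
  finally show ?thesis .
qed

lemma card_good_neurons:
  "real (card (good_neurons d k pat s \<sigma> W a)) = (\<Sum>i<k. if a i = \<sigma> \<and> dominant d pat s (W i) then 1 else 0)"
proof -
  have "good_neurons d k pat s \<sigma> W a = {..<k} \<inter> {i. a i = \<sigma> \<and> dominant d pat s (W i)}"
    by (auto simp: good_neurons_def)
  then show ?thesis by (simp add: sum.If_cases)
qed

lemma measurable_card_good_neurons [measurable]:
  "(\<lambda>\<omega>. real (card (good_neurons d k pat s \<sigma> (fst \<omega>) (snd \<omega>)))) \<in> borel_measurable (initM d k r)"
  unfolding card_good_neurons
  by (intro borel_measurable_sum measurable_If borel_measurable_const good_neuron_set) auto

lemma exp_minus_one_le: "exp (- 1 :: real) \<le> 2/5"
proof -
  have "(5/2 :: real) \<le> exp 1" using exp_lower_Taylor_quadratic[of "1::real"] by simp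
  then show ?thesis by (simp add: exp_minus field_simps)
qed

text \<open>Fubini with the signs outside: for fixed signs the rows are independent, and afterwards
  the signs are. The factor \<open>2 ^ k\<close> comes from the fair coins.\<close>

lemma nn_integral_initM_prod:
  assumes g [measurable]: "\<And>b. (\<lambda>w. g b w) \<in> borel_measurable (Rd d)"
    and joint: "(\<lambda>\<omega>. \<Prod>i<k. g (snd \<omega> i) (fst \<omega> i)) \<in> borel_measurable (initM d k r)"
  shows "(\<integral>\<^sup>+\<omega>. (\<Prod>i<k. g (snd \<omega> i) (fst \<omega> i)) \<partial>initM d k r)
       = ((\<integral>\<^sup>+w. g 1 w \<partial>sphere_unif d r) + (\<integral>\<^sup>+w. g (-1) w \<partial>sphere_unif d r)) ^ k / 2 ^ k"
proof -
  interpret A: prob_space "initW d k r" by (rule prob_space_initW)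
  interpret B: prob_space "inita k" by (rule prob_space_inita)
  interpret AB: pair_sigma_finite "initW d k r" "inita k" ..
  interpret S: prob_space "sphere_unif d r" by (rule prob_space_sphere_unif)
  interpret PS: product_sigma_finite "\<lambda>_::nat. sphere_unif d r" by standard
  interpret PC: product_sigma_finite "\<lambda>_::nat. coin"
    by standard
  have gS: "g b \<in> borel_measurable (sphere_unif d r)" for b
    using g by (simp add: measurable_cong_sets[OF sets_sphere_unif refl])
  define h where "h b = (\<integral>\<^sup>+w. g b w \<partial>sphere_unif d r)" for b
  have "(\<integral>\<^sup>+\<omega>. (\<Prod>i<k. g (snd \<omega> i) (fst \<omega> i)) \<partial>initM d k r)
     = (\<integral>\<^sup>+a. (\<integral>\<^sup>+W. (\<Prod>i<k. g (a i) (W i)) \<partial>initW d k r) \<partial>inita k)"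
    using AB.nn_integral_snd[OF joint] by simp
  also have "\<dots> = (\<integral>\<^sup>+a. (\<Prod>i<k. h (a i)) \<partial>inita k)"
    unfolding initW_def h_def
    by (intro nn_integral_cong PS.product_nn_integral_prod) (auto simp: gS)
  also have "\<dots> = (\<Prod>i<k. \<integral>\<^sup>+b. h b \<partial>coin)"
    unfolding inita_def by (intro PC.product_nn_integral_prod) auto
  also have "(\<integral>\<^sup>+b. h b \<partial>coin) = (h 1 + h (-1)) / 2"
    by (simp add: nn_integral_pmf_of_set)
  finally show ?thesis by (simp add: h_def divide_ennreal_def power_mult_distrib ennreal_inverse_power)
qed

text \<open>Chernoff's method with the moment of \<open>exp (- count)\<close>. A neuron is good with
  probability \<open>q / 2\<close>, where \<open>q \<ge> 1 / (2 * d)\<close>, so the mean count is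
  at least \<open>k / (4 * d)\<close>, eight times the threshold.\<close>

lemma init_good_neurons:
  assumes on: "orthonormal_system d pat" and d: "d \<ge> 3" and s: "s \<in> {1, 2}" and r: "r > 0"
    and \<sigma>: "\<sigma> \<in> {1, -1}" and k: "real k > 8 * real d ^ 3"
  shows "measure (initM d k r) {\<omega> \<in> space (initM d k r).
            real (card (good_neurons d k pat s \<sigma> (fst \<omega>) (snd \<omega>))) < real k / (32 * real d)} \<le> exp (- real d)"
proof -
  interpret M: prob_space "initM d k r" by (rule prob_space_initM)
  interpret S: prob_space "sphere_unif d r" by (rule prob_space_sphere_unif)
  define K where "K = real k / (32 * real d)"
  define D where "D = {w \<in> space (Rd d). dominant d pat s w}"
  have D [measurable]: "D \<in> sets (Rd d)" unfolding D_def by measurable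
  define q where "q = measure (sphere_unif d r) D"
  have q: "q \<ge> 1 / (2 * real d)" "q \<le> 1"
    unfolding q_def D_def using measure_sphere_unif_dominant[OF on d s r] by auto
  define g :: "real \<Rightarrow> vec \<Rightarrow> ennreal" where "g b w = ennreal (exp (- (if b = \<sigma> \<and> w \<in> D then 1 else 0)))" for b w
  let ?G = "\<lambda>\<omega>. real (card (good_neurons d k pat s \<sigma> (fst \<omega>) (snd \<omega>)))"
  have prod_g: "(\<Prod>i<k. g (snd \<omega> i) (fst \<omega> i)) = ennreal (exp (- ?G \<omega>))" if "\<omega> \<in> space (initM d k r)" for \<omega>
  proof -
    have "fst \<omega> i \<in> D \<longleftrightarrow> dominant d pat s (fst \<omega> i)" if "i < k" for i
      using space_initW[OF _ that] \<open>\<omega> \<in> _\<close> by (auto simp: D_def space_pair_measure)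
    then have "(\<Prod>i<k. g (snd \<omega> i) (fst \<omega> i))
        = ennreal (\<Prod>i<k. exp (- (if snd \<omega> i = \<sigma> \<and> dominant d pat s (fst \<omega> i) then 1 else 0)))"
      unfolding g_def by (subst prod_ennreal) (auto intro!: prod.cong)
    also have "\<dots> = ennreal (exp (- ?G \<omega>))"
      unfolding card_good_neurons by (simp add: exp_sum sum_negf[symmetric] del: sum_negf)
    finally show ?thesis .
  qed
  have joint: "(\<lambda>\<omega>. \<Prod>i<k. g (snd \<omega> i) (fst \<omega> i)) \<in> borel_measurable (initM d k r)"
    by (subst measurable_cong[OF prod_g]) measurable
  have I1: "(\<integral>\<^sup>+w. g \<sigma> w \<partial>sphere_unif d r) = ennreal (1 - q * (1 - exp (-1)))"
  proof -
    have "(\<integral>\<^sup>+w. g \<sigma> w \<partial>sphere_unif d r) = (\<integral>\<^sup>+w. ennreal (1 - (1 - exp (-1)) * indicator D w) \<partial>sphere_unif d r)"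
      by (intro nn_integral_cong) (auto simp: g_def indicator_def)
    also have "\<dots> = ennreal (\<integral>w. 1 - (1 - exp (-1)) * indicator D w \<partial>sphere_unif d r)"
    proof (rule nn_integral_eq_integral)
      show "integrable (sphere_unif d r) (\<lambda>w. 1 - (1 - exp (-1)) * indicator D w :: real)"
        by (rule S.integrable_const_bound[where B=1], rule AE_I2, simp add: indicator_def) (intro borel_measurable_diff borel_measurable_times borel_measurable_const borel_measurable_indicator, simp)
    qed (auto simp: indicator_def)
    also have "(\<integral>w. 1 - (1 - exp (-1)) * indicator D w \<partial>sphere_unif d r) = 1 - q * (1 - exp (-1))"
    proof (subst Bochner_Integration.integral_diff)
      show "integrable (sphere_unif d r) (\<lambda>w. (1 - exp (-1)) * indicator D w :: real)"
        by (rule S.integrable_const_bound[where B=1], rule AE_I2, simp add: indicator_def) (intro borel_measurable_diff borel_measurable_times borel_measurable_const borel_measurable_indicator, simp)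
      show "(\<integral>w. 1 \<partial>sphere_unif d r) - (\<integral>w. (1 - exp (-1)) * indicator D w \<partial>sphere_unif d r) = 1 - q * (1 - exp (-1))"
        using S.prob_space by (simp add: q_def)
    qed simp
    finally show ?thesis .
  qed
  have I2: "(\<integral>\<^sup>+w. g (-\<sigma>) w \<partial>sphere_unif d r) = 1"
  proof -
    have "g (-\<sigma>) w = 1" for w using \<sigma> by (auto simp: g_def)
    then show ?thesis using S.emeasure_space_1 by simp
  qed
  have q1: "0 \<le> q * (1 - exp (-1))" "q * (1 - exp (- 1)) \<le> 1"
  proof -
    show "0 \<le> q * (1 - exp (-1))" using q(1) d by (intro mult_nonneg_nonneg) (auto intro: order_trans[rotated])
    show "q * (1 - exp (- 1)) \<le> 1" using q(2) by (intro mult_le_one) auto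
  qed
  have "(\<integral>\<^sup>+\<omega>. ennreal (exp (- ?G \<omega>)) \<partial>initM d k r) = (\<integral>\<^sup>+\<omega>. (\<Prod>i<k. g (snd \<omega> i) (fst \<omega> i)) \<partial>initM d k r)"
    by (rule nn_integral_cong) (simp add: prod_g)
  also have "\<dots> = ((\<integral>\<^sup>+w. g 1 w \<partial>sphere_unif d r) + (\<integral>\<^sup>+w. g (-1) w \<partial>sphere_unif d r)) ^ k / 2 ^ k"
    by (rule nn_integral_initM_prod[OF _ joint]) (simp add: g_def)
  also have "(\<integral>\<^sup>+w. g 1 w \<partial>sphere_unif d r) + (\<integral>\<^sup>+w. g (-1) w \<partial>sphere_unif d r) = ennreal (2 - q * (1 - exp (-1)))"
  proof -
    have "(\<integral>\<^sup>+w. g 1 w \<partial>sphere_unif d r) + (\<integral>\<^sup>+w. g (-1) w \<partial>sphere_unif d r)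
      = (\<integral>\<^sup>+w. g \<sigma> w \<partial>sphere_unif d r) + (\<integral>\<^sup>+w. g (-\<sigma>) w \<partial>sphere_unif d r)"
      using \<sigma> by (auto simp: add.commute)
    also have "\<dots> = ennreal (1 - q * (1 - exp (-1)) + 1)"
      unfolding I1 I2 using q1 by (subst ennreal_plus) auto
    finally show ?thesis by simp
  qed
  also have "ennreal (2 - q * (1 - exp (-1))) ^ k / 2 ^ k = ennreal ((1 - q * (1 - exp (-1)) / 2) ^ k)"
  proof -
    have "ennreal (2 - q * (1 - exp (-1))) ^ k / 2 ^ k = ennreal ((2 - q * (1 - exp (-1))) ^ k / 2 ^ k)"
      using q1 by (simp add: ennreal_power divide_ennreal flip: ennreal_numeral)
    then show ?thesis by (simp add: power_divide[symmetric] diff_divide_distrib)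
  qed
  finally have int: "(\<integral>\<^sup>+\<omega>. ennreal (exp (- ?G \<omega>)) \<partial>initM d k r) = ennreal ((1 - q * (1 - exp (-1)) / 2) ^ k)" .
  let ?B = "{\<omega> \<in> space (initM d k r). ?G \<omega> < K}"
  have "emeasure (initM d k r) ?B = (\<integral>\<^sup>+\<omega>. indicator ?B \<omega> \<partial>initM d k r)"
    by (rule nn_integral_indicator[symmetric]) measurable
  also have "\<dots> \<le> (\<integral>\<^sup>+\<omega>. ennreal (exp K) * ennreal (exp (- ?G \<omega>)) \<partial>initM d k r)"
    by (intro nn_integral_mono) (auto simp: indicator_def ennreal_mult[symmetric] exp_add[symmetric] mult_exp_exp)
  also have "\<dots> = ennreal (exp K) * ennreal ((1 - q * (1 - exp (-1)) / 2) ^ k)"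
    by (subst nn_integral_cmult) (auto simp: int)
  also have "\<dots> = ennreal (exp K * (1 - q * (1 - exp (-1)) / 2) ^ k)"
    by (rule ennreal_mult[symmetric]) (use q1 in auto)
  finally have "measure (initM d k r) ?B \<le> exp K * (1 - q * (1 - exp (-1)) / 2) ^ k"
    using q1 by (simp add: M.emeasure_eq_measure)
  also have "\<dots> \<le> exp K * exp (- (q * (1 - exp (-1)) / 2)) ^ k"
    using q1 exp_ge_add_one_self[of "- (q * (1 - exp (-1)) / 2)"] by (intro mult_left_mono power_mono) auto
  also have "\<dots> = exp (K - real k * (q * (1 - exp (-1)) / 2))"
    by (simp add: exp_of_nat_mult[symmetric] exp_add[symmetric] mult_exp_exp)
  \<comment> \<open>As \<open>1 - exp (-1) \<ge> 3/5\<close>, the exponent is at most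
    \<open>(1/32 - 3/20) * k/d = - (19/160) * k/d\<close>. The width condition
    \<open>k > 8 * d ^ 3\<close> with \<open>d \<ge> 3\<close> yields
    \<open>k/d \<ge> 24 * d\<close>, more than enough.\<close>
  also have "\<dots> \<le> exp (- real d)"
  proof -
    have q': "1 / (2 * real d) * (3/5) \<le> q * (1 - exp (-1))"
      using q(1) exp_minus_one_le d by (intro mult_mono) (auto intro: order_trans[rotated])
    have "real k * (1 / (2 * real d) * (3/5) / 2) \<le> real k * (q * (1 - exp (-1)) / 2)"
      by (intro mult_left_mono divide_right_mono q') auto
    moreover have "real k * (1 / (2 * real d) * (3/5) / 2) = (real k / real d) * (3/20)" by simp
    moreover have "K = (real k / real d) / 32" by (simp add: K_def)
    moreover have "K - real k * (q * (1 - exp (-1)) / 2) \<le> - (real k / real d) * (19/160)"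
    proof -
      have "x \<le> y \<Longrightarrow> x = z * (3/20) \<Longrightarrow> w = z / 32 \<Longrightarrow> w - y \<le> - z * (19/160)" for x y z w :: real
        by linarith
      from this[OF calculation] show ?thesis .
    qed
    moreover have "real k / real d \<ge> 8 * (real d)\<^sup>2"
      using k d by (simp add: field_simps power2_eq_square power3_eq_cube)
    moreover have "(real d)\<^sup>2 \<ge> 3 * real d" using d by (simp add: power2_eq_square)
    ultimately show ?thesis by simp
  qed
  finally show ?thesis by (simp add: K_def)
qed

text \<open>Norm bounds and sign values hold only almost everywhere; including them in the event
  lets the analysis of the algorithm be purely deterministic.\<close>

definition init_good :: "nat \<Rightarrow> nat \<Rightarrow> real \<Rightarrow> (nat \<Rightarrow> vec) \<Rightarrow> ((nat \<Rightarrow> vec) \<times> (nat \<Rightarrow> real)) set" where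
  "init_good d k r pat = {\<omega> \<in> space (initM d k r).
      (\<forall>i<k. vnorm d (fst \<omega> i) \<le> r) \<and> (\<forall>i<k. snd \<omega> i \<in> {1, -1}) \<and>
      real (card (good_neurons d k pat 1 1 (fst \<omega>) (snd \<omega>))) \<ge> real k / (32 * real d) \<and>
      real (card (good_neurons d k pat 2 (-1) (fst \<omega>) (snd \<omega>))) \<ge> real k / (32 * real d)}"

lemma init_good_sets_and_AE:
  assumes r: "r > 0"
  shows "{\<omega> \<in> space (initM d k r). (\<forall>i<k. vnorm d (fst \<omega> i) \<le> r) \<and> (\<forall>i<k. snd \<omega> i \<in> {1, -1})} \<in> sets (initM d k r)"
    and "AE \<omega> in initM d k r. (\<forall>i<k. vnorm d (fst \<omega> i) \<le> r) \<and> (\<forall>i<k. snd \<omega> i \<in> {1, -1})"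
proof -
  interpret A: prob_space "initW d k r" by (rule prob_space_initW)
  interpret B: prob_space "inita k" by (rule prob_space_inita)
  interpret AB: pair_prob_space "initW d k r" "inita k" ..
  have m1: "(\<lambda>\<omega>. fst \<omega> i) \<in> measurable (initM d k r) (Rd d)" if "i < k" for i
    by (rule measurable_compose[OF measurable_fst measurable_initW_component[OF that]])
  have m2: "(\<lambda>\<omega>. snd \<omega> i) \<in> measurable (initM d k r) (count_space UNIV)" if "i < k" for i
    by (rule measurable_compose[OF measurable_snd measurable_inita_component[OF that]])
  have s1: "{\<omega> \<in> space (initM d k r). \<forall>i\<in>{..<k}. vnorm d (fst \<omega> i) \<le> r} \<in> sets (initM d k r)"
    by (intro sets.sets_Collect_finite_All borel_measurable_le measurable_compose[OF m1 measurable_vnorm_Rd] borel_measurable_const) auto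
  have s2: "{\<omega> \<in> space (initM d k r). \<forall>i\<in>{..<k}. snd \<omega> i \<in> {1, -1}} \<in> sets (initM d k r)"
  proof (intro sets.sets_Collect_finite_All)
    fix i assume "i \<in> {..<k}"
    then have "(\<lambda>\<omega>. snd \<omega> i) -` {1, -1} \<inter> space (initM d k r) \<in> sets (initM d k r)"
      by (intro measurable_sets[OF m2]) auto
    moreover have "(\<lambda>\<omega>. snd \<omega> i) -` {1, -1} \<inter> space (initM d k r) = {\<omega> \<in> space (initM d k r). snd \<omega> i \<in> {1, - 1}}"
      by auto
    ultimately show "{\<omega> \<in> space (initM d k r). snd \<omega> i \<in> {1, - 1}} \<in> sets (initM d k r)" by simp
  qed simp
  have "{\<omega> \<in> space (initM d k r). (\<forall>i<k. vnorm d (fst \<omega> i) \<le> r) \<and> (\<forall>i<k. snd \<omega> i \<in> {1, -1})} =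
    {\<omega> \<in> space (initM d k r). \<forall>i\<in>{..<k}. vnorm d (fst \<omega> i) \<le> r} \<inter> {\<omega> \<in> space (initM d k r). \<forall>i\<in>{..<k}. snd \<omega> i \<in> {1, -1}}"
    by auto
  then show sets: "{\<omega> \<in> space (initM d k r). (\<forall>i<k. vnorm d (fst \<omega> i) \<le> r) \<and> (\<forall>i<k. snd \<omega> i \<in> {1, -1})} \<in> sets (initM d k r)"
    using s1 s2 by auto
  have a1: "AE W in initW d k r. \<forall>i\<in>{..<k}. vnorm d (W i) \<le> r"
    unfolding initW_def
  proof (rule AE_finite_allI)
    fix i assume i: "i \<in> {..<k}"
    show "AE W in PiM {..<k} (\<lambda>_. sphere_unif d r). vnorm d (W i) \<le> r"
      by (rule AE_PiM_component[OF _ i]) (auto intro: prob_space_sphere_unif AE_sphere_unif_vnorm[OF r])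
  qed simp
  have a2: "AE a in inita k. \<forall>i\<in>{..<k}. a i \<in> {1, -1}"
    unfolding inita_def
  proof (rule AE_finite_allI)
    fix i assume i: "i \<in> {..<k}"
    show "AE a in PiM {..<k} (\<lambda>_. coin). a i \<in> {1, -1}"
      by (rule AE_PiM_component[OF _ i]) (auto intro: prob_space_measure_pmf simp: AE_measure_pmf_iff)
  qed simp
  have "AE W in initW d k r. AE a in inita k. (\<forall>i<k. vnorm d (W i) \<le> r) \<and> (\<forall>i<k. a i \<in> {1, -1})"
    using a1
  proof eventually_elim
    case (elim W)
    show ?case using a2 by eventually_elim (use elim in auto)
  qed
  then show "AE \<omega> in initM d k r. (\<forall>i<k. vnorm d (fst \<omega> i) \<le> r) \<and> (\<forall>i<k. snd \<omega> i \<in> {1, -1})"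
    by (intro AB.AE_pair_measure[OF sets]) simp
qed

lemma init_good_sets:
  assumes r: "r > 0"
  shows "init_good d k r pat \<in> sets (initM d k r)"
proof -
  let ?G1 = "\<lambda>\<omega>. real (card (good_neurons d k pat 1 1 (fst \<omega>) (snd \<omega>)))"
  let ?G2 = "\<lambda>\<omega>. real (card (good_neurons d k pat 2 (-1) (fst \<omega>) (snd \<omega>)))"
  have "init_good d k r pat =
     {\<omega> \<in> space (initM d k r). (\<forall>i<k. vnorm d (fst \<omega> i) \<le> r) \<and> (\<forall>i<k. snd \<omega> i \<in> {1, -1})} \<inter>
     {\<omega> \<in> space (initM d k r). real k / (32 * real d) \<le> ?G1 \<omega>} \<inter>
     {\<omega> \<in> space (initM d k r). real k / (32 * real d) \<le> ?G2 \<omega>}"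
    by (auto simp: init_good_def)
  also have "\<dots> \<in> sets (initM d k r)"
    by (intro sets.Int init_good_sets_and_AE[OF r]) measurable
  finally show ?thesis .
qed

lemma measure_init_good:
  assumes on: "orthonormal_system d pat" and d: "d \<ge> 3" and r: "r > 0" and k: "real k > 8 * real d ^ 3"
  shows "measure (initM d k r) (init_good d k r pat) \<ge> 1 - 2 * exp (- real d)"
proof -
  interpret M: prob_space "initM d k r" by (rule prob_space_initM)
  let ?G1 = "\<lambda>\<omega>. real (card (good_neurons d k pat 1 1 (fst \<omega>) (snd \<omega>)))"
  let ?G2 = "\<lambda>\<omega>. real (card (good_neurons d k pat 2 (-1) (fst \<omega>) (snd \<omega>)))"
  let ?B1 = "{\<omega> \<in> space (initM d k r). ?G1 \<omega> < real k / (32 * real d)}"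
  let ?B2 = "{\<omega> \<in> space (initM d k r). ?G2 \<omega> < real k / (32 * real d)}"
  have gs: "init_good d k r pat \<in> sets (initM d k r)" by (rule init_good_sets[OF r])
  have Bs: "?B1 \<in> M.events" "?B2 \<in> M.events"
    by (intro borel_measurable_less measurable_card_good_neurons borel_measurable_const)+
  have "1 = M.prob (space (initM d k r))" by (simp add: M.prob_space)
  also have "\<dots> \<le> M.prob (init_good d k r pat \<union> (?B1 \<union> ?B2))"
  proof (rule M.finite_measure_mono_AE)
    show "AE \<omega> in initM d k r. \<omega> \<in> space (initM d k r) \<longrightarrow> \<omega> \<in> init_good d k r pat \<union> (?B1 \<union> ?B2)"
    proof (rule AE_mp[OF init_good_sets_and_AE(2)[OF r]], rule AE_I2, intro impI)
      fix \<omega> assume "\<omega> \<in> space (initM d k r)"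
        "(\<forall>i<k. vnorm d (fst \<omega> i) \<le> r) \<and> (\<forall>i<k. snd \<omega> i \<in> {1, -1})"
      then show "\<omega> \<in> init_good d k r pat \<union> (?B1 \<union> ?B2)"
        by (cases "\<omega> \<in> ?B1"; cases "\<omega> \<in> ?B2"; simp add: init_good_def not_less)
    qed
    show "init_good d k r pat \<union> (?B1 \<union> ?B2) \<in> M.events"
      by (intro sets.Un gs Bs)
  qed
  also have "\<dots> \<le> M.prob (init_good d k r pat) + (M.prob ?B1 + M.prob ?B2)"
    by (intro order_trans[OF measure_Un_le] add_left_mono measure_Un_le sets.Un gs Bs)
  also have "\<dots> \<le> M.prob (init_good d k r pat) + (exp (- real d) + exp (- real d))"
    by (intro add_left_mono add_mono init_good_neurons[OF on d _ r _ k]) auto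
  finally show ?thesis by simp
qed


section \<open>Gradient descent for the logistic loss\<close>

text \<open>Hoeffding's lemma for a Bernoulli variable. Negative h reduces to positive h by
  exchanging success and failure. It yields both the smoothness of the logistic loss and the
  concentration of biased signs.\<close>

lemma bernoulli_mgf_bound:
  fixes p h :: real
  assumes p: "0 \<le> p" "p \<le> 1"
  shows "1 + p * (exp h - 1) \<le> exp (h * p + h\<^sup>2 / 8)"
proof -
  have pos: "1 + q * (exp x - 1) \<le> exp (x * q + x\<^sup>2 / 8)" if "0 \<le> q" "0 \<le> x" for q x :: real
  proof -
    have "1 + q * (exp x - 1) > 0" using that by (intro add_pos_nonneg mult_nonneg_nonneg) auto
    moreover have "ln (1 + q * (exp x - 1)) \<le> x * q + x\<^sup>2 / 8"
      using Hoeffdings_lemma_aux[OF that(2,1)] by simp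
    ultimately show ?thesis by (metis exp_ln exp_le_cancel_iff)
  qed
  show ?thesis
  proof (cases "h \<ge> 0")
    case True
    then show ?thesis using pos p by simp
  next
    case False
    have "1 + p * (exp h - 1) = exp h * (1 + (1 - p) * (exp (-h) - 1))"
      by (simp add: exp_minus field_simps)
    also have "\<dots> \<le> exp h * exp (- h * (1 - p) + (-h)\<^sup>2 / 8)"
      using False p by (intro mult_left_mono pos) auto
    also have "\<dots> = exp (h * p + h\<^sup>2 / 8)"
      unfolding exp_add[symmetric] by (simp add: algebra_simps)
    finally show ?thesis .
  qed
qed

lemma one_plus_exp_pos [simp]: "0 < 1 + exp (z::real)" and one_plus_exp_neq_0 [simp]: "1 + exp (z::real) \<noteq> 0"
  using exp_gt_zero[of z] by linarith+

lemma logloss_pos: "logloss z > 0"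
  unfolding logloss_def by (rule ln_gt_zero) simp

lemma logloss'_neg: "logloss' z < 0"
  using exp_gt_zero[of z] by (simp add: logloss'_def add_pos_pos)

lemma logloss'_gt_m1: "logloss' z > -1"
  by (simp add: logloss'_def divide_less_eq)

text \<open>1/4-smoothness of the loss without second derivatives: with
  \<open>p = - logloss' z\<close>, the difference \<open>logloss (z + h) - logloss z\<close> is the
  logarithm of the moment generating function of a Bernoulli(p) variable at
  \<open>-h\<close>.\<close>

lemma logloss_add_le: "logloss (z + h) \<le> logloss z + logloss' z * h + h\<^sup>2 / 8"
proof -
  define p where "p = 1 / (1 + exp z)"
  have p: "0 \<le> p" "p \<le> 1" using exp_gt_zero[of z] by (auto simp: p_def add_pos_pos)
  have pz: "exp (-z) = p * (1 + exp (-z))"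
    by (simp add: p_def exp_minus divide_simps)
  have "1 + exp (- (z + h)) = 1 + exp (-z) * exp (-h)" by (simp add: exp_add[symmetric] mult_exp_exp)
  also have "\<dots> = (1 + exp (-z)) * (1 + p * (exp (-h) - 1))"
  proof -
    have "(1 + exp (-z)) * (1 + p * (exp (-h) - 1)) = 1 + exp (-z) + p * (1 + exp (-z)) * (exp (-h) - 1)"
      by (simp add: algebra_simps)
    also have "\<dots> = 1 + exp (-z) * exp (-h)"
      unfolding pz[symmetric] by (simp add: algebra_simps)
    finally show ?thesis by simp
  qed
  finally have eq: "1 + exp (- (z + h)) = (1 + exp (-z)) * (1 + p * (exp (-h) - 1))" .
  have pos: "1 + p * (exp (-h) - 1) > 0"
  proof -
    have "0 < 1 + exp (- (z + h))" "0 < 1 + exp (-z)" by (simp_all add: add_pos_pos)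
    then show ?thesis unfolding eq by (simp add: zero_less_mult_iff)
  qed
  have "logloss (z + h) = logloss z + ln (1 + p * (exp (-h) - 1))"
    unfolding logloss_def eq by (rule ln_mult_pos) (use pos in \<open>simp_all add: add_pos_pos\<close>)
  also have "ln (1 + p * (exp (-h) - 1)) \<le> -h * p + h\<^sup>2 / 8"
  proof -
    have "ln (1 + p * (exp (-h) - 1)) \<le> ln (exp (-h * p + (-h)\<^sup>2 / 8))"
      using bernoulli_mgf_bound[OF p, of "-h"] pos by (subst ln_le_cancel_iff) auto
    then show ?thesis by simp
  qed
  finally show ?thesis by (simp add: logloss'_def p_def)
qed

text \<open>For nonnegative margins loss and derivative are both of order \<open>exp (- z)\<close>.
  This bound and the next one convert between the three quantities late in training.\<close>

lemma logloss_le_2_logloss': "z \<ge> 0 \<Longrightarrow> logloss z \<le> - 2 * logloss' z"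
proof -
  assume z: "z \<ge> 0"
  have "logloss z \<le> exp (-z)" unfolding logloss_def by (rule ln_add_one_self_le_self) simp
  also have "\<dots> = 1 / exp z" by (simp add: exp_minus inverse_eq_divide)
  also have "\<dots> \<le> 2 / (1 + exp z)" using z by (simp add: divide_simps add_pos_pos)
  finally show ?thesis by (simp add: logloss'_def)
qed

lemma exp_minus_le_2_logloss: "z \<ge> 0 \<Longrightarrow> exp (-z) \<le> 2 * logloss z"
proof -
  assume z: "z \<ge> 0"
  have "exp (-z) / (1 + exp (-z)) \<le> logloss z"
  proof -
    have "ln (inverse (1 + exp (-z))) \<le> inverse (1 + exp (-z)) - 1"
      by (rule ln_le_minus_one) simp
    then have "1 - inverse (1 + exp (-z)) \<le> ln (1 + exp (-z))"
      by (simp add: ln_inverse)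
    moreover have "1 - inverse (1 + exp (-z)) = exp (-z) / (1 + exp (-z))"
      by (simp add: divide_simps)
    ultimately show ?thesis by (simp add: logloss_def)
  qed
  moreover have "exp (-z) / 2 \<le> exp (-z) / (1 + exp (-z))"
    using z by (intro divide_left_mono) (auto simp: add_pos_pos)
  ultimately show ?thesis by linarith
qed

section \<open>Gradient descent on linearly separable data: convergence and margin\<close>

locale logistic_gd =
  fixes k m :: nat and z :: "nat \<Rightarrow> vec" and \<eta> R \<gamma> :: real and u :: vec and a :: "nat \<Rightarrow> vec"
  assumes m: "m > 0" and \<eta>: "\<eta> > 0" and R: "R > 0"
    and zR: "\<And>j. j < m \<Longrightarrow> vnorm k (z j) \<le> R" and step: "\<eta> * R\<^sup>2 \<le> 1"
    and u: "vnorm k u \<le> 1" and \<gamma>: "\<gamma> > 0" and margin: "\<And>j. j < m \<Longrightarrow> \<gamma> \<le> ip k u (z j)"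
    and a_Suc: "\<And>t. a (Suc t) = (\<lambda>i. a t i - \<eta> * ((\<Sum>j<m. logloss' (ip k (a t) (z j)) * z j i) / real m))"
begin

definition g :: "nat \<Rightarrow> vec" where
  "g t = (\<lambda>i. (\<Sum>j<m. logloss' (ip k (a t) (z j)) * z j i) / real m)"

definition L :: "nat \<Rightarrow> real" where
  "L t = (\<Sum>j<m. logloss (ip k (a t) (z j))) / real m"

definition G :: "nat \<Rightarrow> real" where
  "G t = (\<Sum>j<m. - logloss' (ip k (a t) (z j))) / real m"

lemma ip_g: "ip k (g t) v = (\<Sum>j<m. logloss' (ip k (a t) (z j)) * ip k (z j) v) / real m"
proof -
  have "ip k (g t) v = (\<Sum>i<k. \<Sum>j<m. logloss' (ip k (a t) (z j)) * z j i * v i / real m)"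
    unfolding ip_def[of k "g t" v] by (simp add: g_def sum_distrib_right sum_divide_distrib)
  also have "\<dots> = (\<Sum>j<m. \<Sum>i<k. logloss' (ip k (a t) (z j)) * z j i * v i / real m)"
    by (rule sum.swap)
  also have "\<dots> = (\<Sum>j<m. logloss' (ip k (a t) (z j)) * ip k (z j) v / real m)"
    by (intro sum.cong refl) (simp add: ip_def[of k "z _" v] sum_distrib_left sum_divide_distrib mult.assoc)
  finally show ?thesis by (simp add: sum_divide_distrib)
qed

lemma a_Suc': "a (Suc t) = (\<lambda>i. a t i - \<eta> * g t i)"
  using a_Suc by (simp add: g_def)

lemma ip_a_Suc: "ip k (a (Suc t)) v = ip k (a t) v - \<eta> * ip k (g t) v"
  unfolding a_Suc' by (simp add: ip_diff_left ip_scale_left)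

lemma L_pos: "L t > 0"
  unfolding L_def using m by (intro divide_pos_pos sum_pos) (auto simp: logloss_pos)

lemma G_nonneg: "G t \<ge> 0"
  unfolding G_def using logloss'_neg by (intro divide_nonneg_nonneg sum_nonneg) (auto intro: less_imp_le)

text \<open>The second-order term of \<open>logloss_add_le\<close> costs at most
  \<open>\<eta> * (\<eta> * R\<^sup>2) / 8\<close> times the squared gradient norm, against a
  first-order gain of \<eta> times it; \<open>step\<close> leaves at least half of the gain.\<close>

lemma descent: "L (Suc t) \<le> L t - \<eta> / 2 * (vnorm k (g t))\<^sup>2"
proof -
  let ?c = "\<lambda>j. ip k (a t) (z j)" and ?w = "\<lambda>j. ip k (g t) (z j)"
  have w: "(?w j)\<^sup>2 \<le> (vnorm k (g t))\<^sup>2 * R\<^sup>2" if "j < m" for j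
  proof -
    have "\<bar>?w j\<bar> \<le> vnorm k (g t) * R"
      by (rule order_trans[OF abs_ip_le]) (intro mult_left_mono zR that, simp)
    then have "\<bar>?w j\<bar>\<^sup>2 \<le> (vnorm k (g t) * R)\<^sup>2" by (intro power_mono) auto
    then show ?thesis by (simp add: power_mult_distrib)
  qed
  have "(\<Sum>j<m. logloss (ip k (a (Suc t)) (z j)))
     \<le> (\<Sum>j<m. logloss (?c j) - \<eta> * (logloss' (?c j) * ?w j) + \<eta> * (\<eta> * R\<^sup>2) * (vnorm k (g t))\<^sup>2 / 8)"
  proof (rule sum_mono)
    fix j assume j: "j \<in> {..<m}"
    have "logloss (ip k (a (Suc t)) (z j)) \<le> logloss (?c j) + logloss' (?c j) * (- \<eta> * ?w j) + (- \<eta> * ?w j)\<^sup>2 / 8"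
      using logloss_add_le[of "?c j" "- \<eta> * ?w j"] by (simp add: ip_a_Suc)
    moreover have "(- \<eta> * ?w j)\<^sup>2 \<le> \<eta> * (\<eta> * R\<^sup>2) * (vnorm k (g t))\<^sup>2"
      using mult_left_mono[OF w, of j "\<eta>\<^sup>2"] j by (simp add: power_mult_distrib power2_eq_square mult_ac)
    ultimately show "logloss (ip k (a (Suc t)) (z j))
      \<le> logloss (?c j) - \<eta> * (logloss' (?c j) * ?w j) + \<eta> * (\<eta> * R\<^sup>2) * (vnorm k (g t))\<^sup>2 / 8"
      by (simp add: algebra_simps)
  qed
  also have "\<dots> = (\<Sum>j<m. logloss (?c j)) - \<eta> * (\<Sum>j<m. logloss' (?c j) * ?w j) + real m * (\<eta> * (\<eta> * R\<^sup>2) * (vnorm k (g t))\<^sup>2 / 8)"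
    by (simp add: sum.distrib sum_subtractf sum_distrib_left)
  also have "(\<Sum>j<m. logloss' (?c j) * ?w j) = real m * (vnorm k (g t))\<^sup>2"
    unfolding vnorm_power2 ip_g[of t "g t"] using m by (simp add: ip_commute[of k "g t"])
  finally have "L (Suc t) \<le> L t - \<eta> * (vnorm k (g t))\<^sup>2 + \<eta> * (\<eta> * R\<^sup>2) * (vnorm k (g t))\<^sup>2 / 8"
    unfolding L_def using m by (simp add: divide_simps) (simp add: algebra_simps)
  also have "\<eta> * (\<eta> * R\<^sup>2) * (vnorm k (g t))\<^sup>2 / 8 \<le> \<eta> / 2 * (vnorm k (g t))\<^sup>2"
  proof -
    have "\<eta> * (\<eta> * R\<^sup>2) * (vnorm k (g t))\<^sup>2 \<le> \<eta> * 1 * (vnorm k (g t))\<^sup>2"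
      using step \<eta> by (intro mult_right_mono mult_left_mono) auto
    moreover have "0 \<le> \<eta> * (vnorm k (g t))\<^sup>2" using \<eta> by simp
    ultimately show ?thesis by simp
  qed
  finally show ?thesis by simp
qed

text \<open>Testing the gradient against the separator u: all samples push in the same direction, so
  their contributions cannot cancel. This lower bound on the gradient does the work that strong
  convexity would do.\<close>

lemma G_le_norm: "\<gamma> * G t \<le> vnorm k (g t)"
proof -
  have "\<gamma> * G t = (\<Sum>j<m. - logloss' (ip k (a t) (z j)) * \<gamma>) / real m"
    unfolding G_def sum_distrib_right[symmetric] by simp
  also have "\<dots> \<le> (\<Sum>j<m. - logloss' (ip k (a t) (z j)) * ip k (z j) u) / real m"
    using logloss'_neg margin by (intro divide_right_mono sum_mono mult_left_mono) (auto simp: ip_commute less_imp_le)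
  also have "\<dots> = - ip k (g t) u" by (simp add: ip_g sum_negf)
  also have "\<dots> \<le> vnorm k (g t) * vnorm k u" using abs_ip_le[of k "g t" u] by linarith
  also have "\<dots> \<le> vnorm k (g t)" using mult_left_mono[OF u, of "vnorm k (g t)"] by simp
  finally show ?thesis .
qed

text \<open>L decreases and is bounded below, so its decrements tend to 0, and they dominate a
  multiple of \<open>(G t)\<^sup>2\<close>.\<close>

lemma G_tendsto_0: "G \<longlonglongrightarrow> 0"
proof -
  have dec: "L (Suc t) \<le> L t" for t
    by (rule order_trans[OF descent]) (use \<eta> in simp)
  have "convergent L"
    using decseq_convergent[of L 0] dec L_pos
    by (metis convergent_def decseq_Suc_iff less_imp_le)
  then obtain l where l: "L \<longlonglongrightarrow> l" by (auto simp: convergent_def)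
  have "(\<lambda>t. 2 / (\<eta> * \<gamma>\<^sup>2) * (L t - L (Suc t))) \<longlonglongrightarrow> 2 / (\<eta> * \<gamma>\<^sup>2) * (l - l)"
    by (intro tendsto_intros l LIMSEQ_Suc[OF l])
  then have lim: "(\<lambda>t. 2 / (\<eta> * \<gamma>\<^sup>2) * (L t - L (Suc t))) \<longlonglongrightarrow> 0" by simp
  have "(\<lambda>t. (G t)\<^sup>2) \<longlonglongrightarrow> 0"
  proof (rule tendsto_sandwich[OF _ _ tendsto_const lim])
    show "\<forall>\<^sub>F t in sequentially. (G t)\<^sup>2 \<le> 2 / (\<eta> * \<gamma>\<^sup>2) * (L t - L (Suc t))"
    proof (rule always_eventually, rule allI)
      fix t
      have "(\<gamma> * G t)\<^sup>2 \<le> (vnorm k (g t))\<^sup>2" using G_le_norm[of t] G_nonneg[of t] \<gamma> by (intro power_mono) auto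
      then have "\<eta> / 2 * (\<gamma> * G t)\<^sup>2 \<le> \<eta> / 2 * (vnorm k (g t))\<^sup>2" using \<eta> by (intro mult_left_mono) auto
      also have "\<dots> \<le> L t - L (Suc t)" using descent[of t] by simp
      finally show "(G t)\<^sup>2 \<le> 2 / (\<eta> * \<gamma>\<^sup>2) * (L t - L (Suc t))"
        using \<eta> \<gamma> by (simp add: field_simps)
    qed
  qed simp
  then have "(\<lambda>t. sqrt ((G t)\<^sup>2)) \<longlonglongrightarrow> sqrt 0" by (rule tendsto_real_sqrt)
  then show ?thesis using G_nonneg by simp
qed

text \<open>The loss is a continuous function of its own derivative,
  \<open>logloss w = - ln (1 + logloss' w)\<close>; all summands of G have the same sign, so each of
  them tends to 0 with G.\<close>

lemma margin_loss_tendsto_0: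
  assumes j: "j < m"
  shows "(\<lambda>t. logloss (ip k (a t) (z j))) \<longlonglongrightarrow> 0"
proof -
  have eq: "logloss w = - ln (1 + logloss' w)" for w
  proof -
    have "1 + logloss' w = inverse (1 + exp (-w))"
      using one_plus_exp_neq_0[of w] by (simp add: logloss'_def exp_minus divide_simps add.commute)
    then show ?thesis by (simp add: logloss_def ln_inverse add_pos_pos)
  qed
  have lim: "(\<lambda>t. real m * G t) \<longlonglongrightarrow> real m * 0" by (intro tendsto_intros G_tendsto_0)
  have "(\<lambda>t. - logloss' (ip k (a t) (z j))) \<longlonglongrightarrow> 0"
  proof (rule tendsto_sandwich[OF _ _ tendsto_const])
    show "(\<lambda>t. real m * G t) \<longlonglongrightarrow> 0" using lim by simp
    show "\<forall>\<^sub>F t in sequentially. - logloss' (ip k (a t) (z j)) \<le> real m * G t"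
    proof (rule always_eventually, rule allI)
      fix t
      have "- logloss' (ip k (a t) (z j)) \<le> (\<Sum>j<m. - logloss' (ip k (a t) (z j)))"
        by (rule member_le_sum) (use j logloss'_neg in \<open>auto intro: less_imp_le\<close>)
      then show "- logloss' (ip k (a t) (z j)) \<le> real m * G t" using m by (simp add: G_def)
    qed
  qed (use logloss'_neg in \<open>auto intro!: always_eventually less_imp_le\<close>)
  then have "(\<lambda>t. - ln (1 - - logloss' (ip k (a t) (z j)))) \<longlonglongrightarrow> - ln (1 - 0)"
    by (intro tendsto_intros) auto
  then show ?thesis by (simp add: eq)
qed

lemma L_tendsto_0: "L \<longlonglongrightarrow> 0"
proof -
  have "(\<lambda>t. (\<Sum>j<m. logloss (ip k (a t) (z j))) / real m) \<longlonglongrightarrow> (\<Sum>j<m. 0) / real m"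
    by (intro tendsto_intros margin_loss_tendsto_0) (use m in auto)
  then show ?thesis by (simp add: L_def[abs_def])
qed

lemma margins_at_top:
  assumes j: "j < m"
  shows "filterlim (\<lambda>t. ip k (a t) (z j)) at_top sequentially"
proof (rule filterlim_at_top_gt[where c=0, THEN iffD2], intro allI impI)
  fix B :: real assume "B > 0"
  have "\<forall>\<^sub>F t in sequentially. logloss (ip k (a t) (z j)) < logloss B"
    by (rule order_tendstoD(2)[OF margin_loss_tendsto_0[OF j] logloss_pos])
  then show "\<forall>\<^sub>F t in sequentially. B \<le> ip k (a t) (z j)"
  proof eventually_elim
    case (elim t)
    show ?case
    proof (rule ccontr)
      assume "\<not> ?thesis"
      then have "exp (- B) \<le> exp (- ip k (a t) (z j))" by simp
      then have "logloss B \<le> logloss (ip k (a t) (z j))"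
        unfolding logloss_def by (subst ln_le_cancel_iff) (auto simp: add_pos_pos)
      then show False using elim by simp
    qed
  qed
qed

text \<open>Once all margins are nonnegative, \<open>ln L\<close> decreases by at least \<open>\<gamma>/4\<close> times the step length, so
  the margins, which are at least \<open>- ln L\<close> up to a constant, grow linearly in \<open>\<parallel>a\<parallel>\<close>.\<close>
lemma eventually_margin:
  "\<forall>\<^sub>F t in sequentially. vnorm k (a t) > 0 \<and> (\<forall>j<m. ip k (a t) (z j) \<ge> \<gamma> / 8 * vnorm k (a t))"
proof -
  have "\<forall>\<^sub>F t in sequentially. \<forall>j\<in>{..<m}. 0 \<le> ip k (a t) (z j)"
    using margins_at_top by (intro eventually_ball_finite) (auto simp: filterlim_at_top)
  then obtain t0 where t0: "\<And>t j. t \<ge> t0 \<Longrightarrow> j < m \<Longrightarrow> 0 \<le> ip k (a t) (z j)"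
    by (auto simp: eventually_sequentially)
  \<comment> \<open>By \<open>L \<le> 2 * G\<close> and \<open>G_le_norm\<close>, the decrease
    \<open>\<eta> / 2 * |g|^2\<close> is at least \<open>\<gamma> / 4 * (\<eta> * |g|)\<close> times
    L, and \<open>\<eta> * |g|\<close> bounds the growth of the norm of a. Dividing by L turns this
    into a statement about \<open>ln L\<close>.\<close>
  have decr: "ln (L (Suc t)) \<le> ln (L t) - \<gamma> / 4 * (vnorm k (a (Suc t)) - vnorm k (a t))" if t: "t \<ge> t0" for t
  proof -
    have LG: "L t \<le> 2 * G t"
    proof -
      have "(\<Sum>j<m. logloss (ip k (a t) (z j))) \<le> (\<Sum>j<m. 2 * - logloss' (ip k (a t) (z j)))"
        using logloss_le_2_logloss'[OF t0[OF t]] by (intro sum_mono) simp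
      then show ?thesis using m unfolding L_def G_def sum_distrib_left[symmetric] by (simp add: divide_right_mono)
    qed
    have tri: "vnorm k (a (Suc t)) \<le> vnorm k (a t) + \<eta> * vnorm k (g t)"
    proof -
      have "vnorm k (\<lambda>i. - \<eta> * g t i) = sqrt (\<eta>\<^sup>2 * ip k (g t) (g t))"
        unfolding vnorm_def ip_scale_left ip_scale_right by (simp add: power2_eq_square)
      also have "\<dots> = \<eta> * vnorm k (g t)"
        using \<eta> by (simp add: real_sqrt_mult vnorm_def)
      finally show ?thesis using vnorm_add[of k "a t" "\<lambda>i. - \<eta> * g t i"] by (simp add: a_Suc')
    qed
    have "\<gamma> / 4 * (\<eta> * vnorm k (g t)) * L t \<le> \<gamma> / 4 * (\<eta> * vnorm k (g t)) * (2 * G t)"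
      using LG \<gamma> \<eta> by (intro mult_left_mono) auto
    also have "\<dots> = \<eta> / 2 * vnorm k (g t) * (\<gamma> * G t)" by simp
    also have "\<dots> \<le> \<eta> / 2 * vnorm k (g t) * vnorm k (g t)"
      using G_le_norm[of t] \<eta> by (intro mult_left_mono) auto
    also have "\<dots> \<le> L t - L (Suc t)" using descent[of t] by (simp add: power2_eq_square)
    finally have "L (Suc t) / L t \<le> 1 - \<gamma> / 4 * (\<eta> * vnorm k (g t))"
      using L_pos[of t] by (simp add: field_simps)
    moreover have "ln (L (Suc t) / L t) \<le> L (Suc t) / L t - 1"
      using L_pos by (intro ln_le_minus_one) simp
    ultimately have "ln (L (Suc t)) - ln (L t) \<le> - (\<gamma> / 4 * (\<eta> * vnorm k (g t)))"
      using L_pos[of t] L_pos[of "Suc t"] by (simp add: ln_div)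
    moreover have "\<gamma> / 4 * (vnorm k (a (Suc t)) - vnorm k (a t)) \<le> \<gamma> / 4 * (\<eta> * vnorm k (g t))"
      using tri \<gamma> by (intro mult_left_mono) auto
    ultimately show ?thesis by linarith
  qed
  define c where "c = ln (L t0) + \<gamma> / 4 * vnorm k (a t0)"
  have lnL: "ln (L t) \<le> c - \<gamma> / 4 * vnorm k (a t)" if "t \<ge> t0" for t
    using that
  proof (induction t rule: dec_induct)
    case base
    show ?case by (simp add: c_def)
  next
    case (step t)
    show ?case using decr[OF step.hyps(1)] step.IH by (simp add: algebra_simps)
  qed
  have low: "\<gamma> / 4 * vnorm k (a t) - (c + ln (2 * real m)) \<le> ip k (a t) (z j)" if t: "t \<ge> t0" and j: "j < m" for t j
  proof -
    let ?w = "ip k (a t) (z j)"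
    have "logloss ?w \<le> (\<Sum>j<m. logloss (ip k (a t) (z j)))"
      by (rule member_le_sum) (use j logloss_pos in \<open>auto intro: less_imp_le\<close>)
    then have "exp (- ?w) \<le> (2 * real m) * L t"
      using exp_minus_le_2_logloss[OF t0[OF t j]] m by (simp add: L_def)
    then have "- ?w \<le> ln ((2 * real m) * L t)"
      using m L_pos[of t] by (subst ln_ge_iff) auto
    also have "\<dots> = ln (2 * real m) + ln (L t)" using m L_pos[of t] by (intro ln_mult_pos) auto
    finally show ?thesis using lnL[OF t] by linarith
  qed
  define c' where "c' = c + ln (2 * real m)"
  \<comment> \<open>By Cauchy-Schwarz a large margin on one sample forces the norm of a above
    \<open>max 1 (8 * c' / \<gamma>)\<close>. Half of the slope \<open>\<gamma> / 4\<close> then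
    absorbs the constant c', which leaves \<open>\<gamma> / 8\<close>; the 1 gives
    positivity.\<close>
  have "\<forall>\<^sub>F t in sequentially. max 1 (8 * c' / \<gamma>) * R \<le> ip k (a t) (z 0)"
    using margins_at_top[OF m] by (simp add: filterlim_at_top)
  moreover have "\<forall>\<^sub>F t in sequentially. t \<ge> t0" by (rule eventually_ge_at_top)
  ultimately show ?thesis
  proof eventually_elim
    case (elim t)
    have "ip k (a t) (z 0) \<le> vnorm k (a t) * R"
      using abs_ip_le[of k "a t" "z 0"] mult_left_mono[OF zR[OF m], of "vnorm k (a t)"] by simp
    then have "max 1 (8 * c' / \<gamma>) * R \<le> vnorm k (a t) * R" using elim(1) by linarith
    then have n: "1 \<le> vnorm k (a t)" "8 * c' / \<gamma> \<le> vnorm k (a t)" using R by auto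
    then have "c' \<le> \<gamma> / 8 * vnorm k (a t)" using \<gamma> by (simp add: field_simps)
    then have "\<gamma> / 8 * vnorm k (a t) \<le> ip k (a t) (z j)" if "j < m" for j
      using low[OF elim(2) that] by (simp add: c'_def)
    then show ?case using n(1) by auto
  qed
qed

end


section \<open>Training the first layer\<close>

definition label_index :: "real \<Rightarrow> nat" where
  "label_index y = (if y = 1 then 1 else 2)"

text \<open>A deterministic condition satisfied on the whole support of \<open>Dist\<close>, so the
  same feature bounds apply to training inputs and to fresh ones.\<close>

definition valid_sample :: "nat \<Rightarrow> (nat \<Rightarrow> vec) \<Rightarrow> inp \<times> real \<Rightarrow> bool" where
  "valid_sample d pat s \<longleftrightarrow> snd s \<in> {1, -1} \<and> pat (label_index (snd s)) \<in> set (fst s) \<and>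
     set (fst s) \<subseteq> insert (pat (label_index (snd s))) (pat ` {3..d})"

text \<open>The maximum over a nonempty finite list of patches is attained, which justifies
  \<open>LEAST\<close>. The training dynamics uses the selected patch only through this
  dichotomy.\<close>

lemma pvec_cases:
  assumes "x \<noteq> []"
  shows "(pvec d w x = (\<lambda>_. 0) \<and> (\<forall>v\<in>set x. ip d w v \<le> 0)) \<or>
         (pvec d w x \<in> set x \<and> ip d w (pvec d w x) > 0 \<and> (\<forall>v\<in>set x. ip d w v \<le> ip d w (pvec d w x)))"
proof -
  let ?P = "\<lambda>j. j < length x \<and> (\<forall>j'<length x. ip d w (x ! j') \<le> ip d w (x ! j))"
  define js where "js = (LEAST j. ?P j)"
  have fin: "finite ((\<lambda>j. ip d w (x ! j)) ` {..<length x})" "(\<lambda>j. ip d w (x ! j)) ` {..<length x} \<noteq> {}"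
    using assms by auto
  obtain j where "j < length x" "Max ((\<lambda>j. ip d w (x ! j)) ` {..<length x}) = ip d w (x ! j)"
    using Max_in[OF fin] by auto
  then have "?P j" using Max_ge[OF fin(1)] by auto
  then have js: "?P js" unfolding js_def by (rule LeastI)
  then have all: "\<forall>v\<in>set x. ip d w v \<le> ip d w (x ! js)" by (auto simp: in_set_conv_nth)
  have pv: "pvec d w x = (if ip d w (x ! js) > 0 then x ! js else (\<lambda>_. 0))"
    by (simp add: pvec_def js_def Let_def)
  show ?thesis
  proof (cases "ip d w (x ! js) > 0")
    case True
    then show ?thesis using all js by (simp add: pv)
  next
    case False
    then have "\<forall>v\<in>set x. ip d w v \<le> 0" using all by (meson le_less_trans not_less order_trans)
    then show ?thesis using False by (simp add: pv)
  qed
qed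

lemma maxact_ge: "v \<in> set x \<Longrightarrow> ip d w v \<le> maxact d w x"
proof -
  assume "v \<in> set x"
  then have "relu (ip d w v) \<le> maxact d w x" unfolding maxact_def by (intro Max_ge) auto
  then show ?thesis by (simp add: relu_def)
qed

lemma maxact_nonneg: "x \<noteq> [] \<Longrightarrow> 0 \<le> maxact d w x"
proof -
  assume "x \<noteq> []"
  then obtain v where "v \<in> set x" by (cases x) auto
  then have "relu (ip d w v) \<le> maxact d w x" unfolding maxact_def by (intro Max_ge) auto
  then show ?thesis by (simp add: relu_def)
qed

lemma maxact_le: "x \<noteq> [] \<Longrightarrow> 0 \<le> B \<Longrightarrow> (\<And>v. v \<in> set x \<Longrightarrow> ip d w v \<le> B) \<Longrightarrow> maxact d w x \<le> B"
  unfolding maxact_def by (subst Max_le_iff) (auto simp: relu_def)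

lemma ip_sum_list: "ip d (\<lambda>c. (\<Sum>s\<leftarrow>S. f s * p s c) / N) v = (\<Sum>s\<leftarrow>S. f s * ip d (p s) v) / N"
proof -
  have "ip d (\<lambda>c. \<Sum>s\<leftarrow>S. f s * p s c) v = (\<Sum>s\<leftarrow>S. f s * ip d (p s) v)"
  proof (induction S)
    case (Cons s S)
    then show ?case by (simp add: ip_add_left ip_scale_left)
  qed (simp add: ip_def)
  moreover have "ip d (\<lambda>c. (\<Sum>s\<leftarrow>S. f s * p s c) / N) v = (1 / N) * ip d (\<lambda>c. \<Sum>s\<leftarrow>S. f s * p s c) v"
    using ip_scale_left[of d "1 / N" "\<lambda>c. \<Sum>s\<leftarrow>S. f s * p s c" v] by simp
  ultimately show ?thesis by simp
qed

lemma sum_list_le_count: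
  assumes "\<And>s. s \<in> set S \<Longrightarrow> (if P s then c else 0) \<le> f s"
  shows "c * real (length (filter P S)) \<le> (\<Sum>s\<leftarrow>S. f s :: real)"
  using assms
proof (induction S)
  case (Cons s S)
  have "c * real (length (filter P S)) \<le> (\<Sum>s\<leftarrow>S. f s)" using Cons by simp
  moreover have "(if P s then c else 0) \<le> f s" using Cons.prems by simp
  ultimately show ?case by (simp add: algebra_simps split: if_splits)
qed simp

lemma sum_list_le_length:
  assumes "\<And>s. s \<in> set S \<Longrightarrow> f s \<le> c"
  shows "(\<Sum>s\<leftarrow>S. f s :: real) \<le> c * real (length S)"
  using assms
proof (induction S)
  case (Cons s S)
  then have "(\<Sum>s\<leftarrow>S. f s) \<le> c * real (length S)" "f s \<le> c" by auto
  then show ?case by (simp add: algebra_simps)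
qed simp

locale first_layer =
  fixes d k :: nat and pat :: "nat \<Rightarrow> vec" and \<eta> r :: real and T :: nat
    and S :: "(inp \<times> real) list" and a :: "nat \<Rightarrow> real" and W0 :: "nat \<Rightarrow> vec"
  assumes on: "orthonormal_system d pat" and d: "d \<ge> 3" and \<eta>: "\<eta> > 0" "\<eta> \<le> 1 / (4 * real k * (real T + 1))"
    and r: "r > 0" "r \<le> \<eta> / 200" and k: "k > 0"
    and S: "S \<noteq> []" "\<And>s. s \<in> set S \<Longrightarrow> valid_sample d pat s"
    and balanced: "\<And>\<sigma>. \<sigma> \<in> {1, -1} \<Longrightarrow> real (length S) / 10 \<le> real (length (filter (\<lambda>s. snd s = \<sigma>) S))"
    and W0: "\<And>i. i < k \<Longrightarrow> vnorm d (W0 i) \<le> r" and a: "\<And>i. i < k \<Longrightarrow> a i \<in> {1, -1}"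
begin

definition W :: "nat \<Rightarrow> nat \<Rightarrow> vec" where
  "W t = W_iter d k \<eta> a S t W0"

definition u :: "nat \<Rightarrow> nat \<Rightarrow> nat \<Rightarrow> real" where
  "u t i l = ip d (W t i) (pat l)"

text \<open>The contribution of one sample to the increase of \<open>u t i l\<close> per unit of
  step size. With the minus sign taken in, the first factor is positive, so
  \<open>snd s * a i\<close> alone decides the direction.\<close>

definition drift :: "nat \<Rightarrow> nat \<Rightarrow> inp \<times> real \<Rightarrow> nat \<Rightarrow> real" where
  "drift t i s l = - logloss' (snd s * net d k (W t) a (fst s)) * (snd s * a i) * ip d (pvec d (W t i) (fst s)) (pat l)"

lemma W_0: "W 0 = W0"
  by (simp add: W_def W_iter_def)

lemma u_Suc: "u (Suc t) i l = u t i l + \<eta> * ((\<Sum>s\<leftarrow>S. drift t i s l) / real (length S))"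
proof -
  have "W (Suc t) i = (\<lambda>c. W t i c - \<eta> * gradW d k (W t) a S i c)"
    by (simp add: W_def W_iter_def)
  then have "u (Suc t) i l = u t i l - \<eta> * ip d (gradW d k (W t) a S i) (pat l)"
    by (simp add: u_def ip_diff_left ip_scale_left)
  also have "ip d (gradW d k (W t) a S i) (pat l) =
     (\<Sum>s\<leftarrow>S. (logloss' (snd s * net d k (W t) a (fst s)) * snd s * a i) * ip d (pvec d (W t i) (fst s)) (pat l)) / real (length S)"
    unfolding gradW_def case_prod_beta by (rule ip_sum_list)
  also have "\<dots> = - (\<Sum>s\<leftarrow>S. drift t i s l) / real (length S)"
  proof -
    have "(\<Sum>s\<leftarrow>S'. (logloss' (snd s * net d k (W t) a (fst s)) * snd s * a i) * ip d (pvec d (W t i) (fst s)) (pat l))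
      = - (\<Sum>s\<leftarrow>S'. drift t i s l)" for S'
      by (induction S') (simp_all add: drift_def)
    then show ?thesis by simp
  qed
  finally show ?thesis by simp
qed

lemma pat_ip: "i \<in> {1..d} \<Longrightarrow> j \<in> {1..d} \<Longrightarrow> ip d (pat i) (pat j) = (if i = j then 1 else 0)"
  using on by (auto simp: orthonormal_system_def)

lemma label_index_range: "label_index y \<in> {1..d}"
  using d by (simp add: label_index_def)

lemma valid_patch:
  assumes "valid_sample d pat s" "v \<in> set (fst s)"
  obtains l where "l \<in> {1..d}" "v = pat l" "l = label_index (snd s) \<or> l \<in> {3..d}"
proof -
  have "v = pat (label_index (snd s)) \<or> v \<in> pat ` {3..d}"
    using assms unfolding valid_sample_def by blast
  then show ?thesis
  proof
    assume "v = pat (label_index (snd s))"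
    then show ?thesis using that[OF label_index_range] by blast
  next
    assume "v \<in> pat ` {3..d}"
    then obtain l where l: "l \<in> {3..d}" "v = pat l" by blast
    then have "l \<in> {1..d}" by auto
    then show ?thesis using that l by blast
  qed
qed

lemma valid_nonempty: "valid_sample d pat s \<Longrightarrow> fst s \<noteq> []"
  by (auto simp: valid_sample_def)

text \<open>By orthonormality the selected patch is visible in one pattern coordinate only, where
  its coefficient is 1.\<close>

lemma pvec_coeff:
  assumes s: "valid_sample d pat s" and l: "l \<in> {1..d}"
  shows "ip d (pvec d w (fst s)) (pat l) \<in> {0, 1}"
  using pvec_cases[OF valid_nonempty[OF s], of d w]
proof
  assume "pvec d w (fst s) = (\<lambda>_. 0) \<and> (\<forall>v\<in>set (fst s). ip d w v \<le> 0)"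
  then show ?thesis by (simp add: ip_def)
next
  assume "pvec d w (fst s) \<in> set (fst s) \<and> ip d w (pvec d w (fst s)) > 0 \<and> (\<forall>v\<in>set (fst s). ip d w v \<le> ip d w (pvec d w (fst s)))"
  then obtain l' where "l' \<in> {1..d}" "pvec d w (fst s) = pat l'" using valid_patch[OF s] by metis
  then show ?thesis using pat_ip l by simp
qed

lemma abs_drift_le:
  assumes s: "valid_sample d pat s" and l: "l \<in> {1..d}" and i: "i < k"
  shows "\<bar>drift t i s l\<bar> \<le> 1"
proof -
  have "\<bar>snd s * a i\<bar> = 1" using s a[OF i] by (auto simp: valid_sample_def)
  moreover have "\<bar>logloss' z\<bar> \<le> 1" for z using logloss'_neg[of z] logloss'_gt_m1[of z] by linarith
  moreover have "\<bar>ip d (pvec d (W t i) (fst s)) (pat l)\<bar> \<le> 1" using pvec_coeff[OF s l, of "W t i"] by auto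
  ultimately show ?thesis unfolding drift_def abs_mult abs_minus_cancel by (simp add: mult_le_one)
qed

lemma abs_u_le:
  assumes i: "i < k" and l: "l \<in> {1..d}"
  shows "\<bar>u t i l\<bar> \<le> r + \<eta> * real t"
proof (induction t)
  case 0
  have "\<bar>u 0 i l\<bar> \<le> vnorm d (W0 i) * vnorm d (pat l)" unfolding u_def W_0 by (rule abs_ip_le)
  also have "vnorm d (pat l) = 1" using pat_ip[OF l l] by (simp add: vnorm_def)
  finally show ?case using W0[OF i] by simp
next
  case (Suc t)
  have n: "real (length S) > 0" using S by simp
  have "(\<Sum>s\<leftarrow>S. drift t i s l) \<le> 1 * real (length S)"
    by (rule sum_list_le_length) (use abs_drift_le[OF S(2) l i, of _ t] in \<open>simp add: abs_le_iff\<close>)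
  moreover have "(\<Sum>s\<leftarrow>S. - drift t i s l) \<le> 1 * real (length S)"
    by (rule sum_list_le_length) (use abs_drift_le[OF S(2) l i, of _ t] in \<open>simp add: abs_le_iff\<close>)
  ultimately have "\<bar>(\<Sum>s\<leftarrow>S. drift t i s l) / real (length S)\<bar> \<le> 1"
    using n by (simp add: uminus_sum_list_map[symmetric, unfolded o_def] abs_le_iff divide_simps)
  then have "\<bar>\<eta> * ((\<Sum>s\<leftarrow>S. drift t i s l) / real (length S))\<bar> \<le> \<eta> * 1"
    unfolding abs_mult using \<eta>(1) by (intro mult_mono) auto
  with Suc have "\<bar>u (Suc t) i l\<bar> \<le> (r + \<eta> * real t) + \<eta> * 1"
    unfolding u_Suc by (intro order_trans[OF abs_triangle_ineq] add_mono)
  then show ?case by (simp add: algebra_simps)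
qed

lemma maxact_bound:
  assumes s: "valid_sample d pat s" and i: "i < k"
  shows "maxact d (W t i) (fst s) \<le> r + \<eta> * real t"
proof (rule maxact_le[OF valid_nonempty[OF s]])
  show "0 \<le> r + \<eta> * real t" using r \<eta> by simp
  fix v assume "v \<in> set (fst s)"
  then obtain l where "l \<in> {1..d}" "v = pat l" using valid_patch[OF s] by metis
  then show "ip d (W t i) v \<le> r + \<eta> * real t"
    using abs_u_le[OF i, of l t] by (simp add: u_def abs_le_iff)
qed

lemma k_eta: "real k * (\<eta> * (real T + 1)) \<le> 1 / 4"
proof -
  have "0 < 4 * real k * (real T + 1)" using k by (intro mult_pos_pos) auto
  then have "\<eta> * (4 * real k * (real T + 1)) \<le> 1" using \<eta>(2) by (simp add: pos_le_divide_eq)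
  then show ?thesis by (simp add: mult_ac)
qed

text \<open>Activations are at most \<open>r + \<eta> * t\<close>, so the step-size condition keeps
  the output of all k neurons within 1/4. Then \<open>exp (1/4) \<le> 3/2\<close> bounds the
  derivative by \<open>1 / (1 + 3/2) = 2/5\<close>, and the neurons decouple.\<close>

lemma loss_deriv_lower:
  assumes s: "valid_sample d pat s" and t: "t \<le> T"
  shows "- logloss' (snd s * net d k (W t) a (fst s)) \<ge> 2 / 5"
proof -
  have "\<bar>net d k (W t) a (fst s)\<bar> \<le> (\<Sum>i<k. \<bar>a i * maxact d (W t i) (fst s)\<bar>)"
    unfolding net_def by (rule sum_abs)
  also have "\<dots> \<le> (\<Sum>i<k. r + \<eta> * real t)"
  proof (rule sum_mono)
    fix i assume "i \<in> {..<k}"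
    then have "i < k" by simp
    then have "\<bar>a i * maxact d (W t i) (fst s)\<bar> = maxact d (W t i) (fst s)"
      using a[of i] maxact_nonneg[OF valid_nonempty[OF s]] by (auto simp: abs_mult)
    then show "\<bar>a i * maxact d (W t i) (fst s)\<bar> \<le> r + \<eta> * real t"
      using maxact_bound[OF s \<open>i < k\<close>] by simp
  qed
  also have "\<dots> = real k * (r + \<eta> * real t)" by simp
  also have "\<dots> \<le> real k * (\<eta> * (real T + 1))"
  proof (rule mult_left_mono)
    have "\<eta> * real t \<le> \<eta> * real T" using t \<eta> by simp
    moreover have "r \<le> \<eta>" using r \<eta> by simp
    ultimately show "r + \<eta> * real t \<le> \<eta> * (real T + 1)" by (simp add: algebra_simps)
  qed simp
  also have "\<dots> \<le> 1 / 4" by (rule k_eta)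
  finally have "\<bar>snd s * net d k (W t) a (fst s)\<bar> \<le> 1 / 4" using s by (auto simp: valid_sample_def)
  then have "exp (snd s * net d k (W t) a (fst s)) \<le> exp (1 / 4)" by simp
  also have "\<dots> \<le> 3 / 2"
    using exp_bound[of "1/4 :: real"] by (simp add: power2_eq_square)
  finally show ?thesis by (simp add: logloss'_def le_divide_eq)
qed

text \<open>The invariant reproduces itself. While coordinate p leads all noise coordinates, every
  sample of label \<sigma> selects \<open>pat p\<close>: it raises coordinate p and moves no other.
  Samples of the opposite label do not contain \<open>pat p\<close>, and their sign product with
  \<open>a i\<close> is -1, so they can only lower the other coordinates.\<close>

lemma good_neuron_invariant:
  assumes i: "i < k" and \<sigma>: "a i = \<sigma>" and dom: "dominant d pat (label_index \<sigma>) (W0 i)" and t: "t \<le> T"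
  shows "u t i (label_index \<sigma>) \<ge> u 0 i (label_index \<sigma>) + \<eta> / 25 * real t \<and>
         (\<forall>l\<in>{1..d} - {label_index \<sigma>}. u t i l \<le> u 0 i l)"
  using t
proof (induction t)
  case (Suc t)
  then have t: "t \<le> T" and IH: "u 0 i (label_index \<sigma>) + \<eta> / 25 * real t \<le> u t i (label_index \<sigma>)"
     "\<And>l. l \<in> {1..d} - {label_index \<sigma>} \<Longrightarrow> u t i l \<le> u 0 i l" by auto
  define p where "p = label_index \<sigma>"
  have p: "p \<in> {1..d}" "p \<le> 2" unfolding p_def using label_index_range by (auto simp: label_index_def)
  have \<sigma>': "\<sigma> \<in> {1, -1}" using a[OF i] \<sigma> by simp
  have u0: "\<bar>u 0 i l\<bar> < u 0 i p" if "l \<in> {3..d}" for l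
    using dom that by (auto simp: dominant_def u_def W_0 p_def)
  have ut: "u t i l < u t i p" if "l \<in> {3..d}" for l
  proof -
    have "u t i l \<le> u 0 i l" using that p IH(2) by (auto simp: p_def)
    also have "\<dots> < u 0 i p" using u0[OF that] by simp
    also have "\<dots> \<le> u 0 i p + \<eta> / 25 * real t" using \<eta> by simp
    also have "\<dots> \<le> u t i p" using IH(1) by (simp add: p_def)
    finally show ?thesis .
  qed
  have up: "u t i p > 0"
  proof -
    have "u 0 i p > 0" using u0[of 3] d by simp
    also have "u 0 i p \<le> u 0 i p + \<eta> / 25 * real t" using \<eta> by simp
    also have "\<dots> \<le> u t i p" using IH(1) by (simp add: p_def)
    finally show ?thesis .
  qed
  let ?q = "\<lambda>s. pvec d (W t i) (fst s)" and ?c = "\<lambda>s. - logloss' (snd s * net d k (W t) a (fst s))"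
  have pos: "?q s = pat p" if s: "s \<in> set S" "snd s = \<sigma>" for s
  proof -
    note vs = S(2)[OF s(1)]
    have mem: "pat p \<in> set (fst s)" using vs s(2) by (simp add: valid_sample_def p_def)
    from pvec_cases[OF valid_nonempty[OF vs], of d "W t i"]
    have q: "?q s \<in> set (fst s)" "\<And>v. v \<in> set (fst s) \<Longrightarrow> ip d (W t i) v \<le> ip d (W t i) (?q s)"
      using mem up by (auto simp: u_def not_le[symmetric])
    from valid_patch[OF vs q(1)] obtain l where l: "?q s = pat l" "l = label_index (snd s) \<or> l \<in> {3..d}" by metis
    show ?thesis
    proof (cases "l \<in> {3..d}")
      case True
      then show ?thesis using ut[OF True] q(2)[OF mem] l(1) by (simp add: u_def)
    qed (use l s(2) in \<open>auto simp: p_def\<close>)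
  qed
  have neg: "ip d (?q s) (pat p) = 0" if s: "s \<in> set S" "snd s \<noteq> \<sigma>" for s
  proof -
    note vs = S(2)[OF s(1)]
    have sy: "label_index (snd s) \<noteq> p"
      using vs s(2) \<sigma>' by (auto simp: valid_sample_def p_def label_index_def)
    from pvec_cases[OF valid_nonempty[OF vs], of d "W t i"] show ?thesis
    proof
      assume "?q s = (\<lambda>_. 0) \<and> (\<forall>v\<in>set (fst s). ip d (W t i) v \<le> 0)"
      then show ?thesis by (simp add: ip_def)
    next
      assume "?q s \<in> set (fst s) \<and> 0 < ip d (W t i) (?q s) \<and> (\<forall>v\<in>set (fst s). ip d (W t i) v \<le> ip d (W t i) (?q s))"
      then obtain l where l: "l \<in> {1..d}" "?q s = pat l" "l = label_index (snd s) \<or> l \<in> {3..d}" using valid_patch[OF vs] by metis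
      then have "l \<noteq> p" using sy p by auto
      then show ?thesis using l(2) pat_ip[OF l(1) p(1)] by simp
    qed
  qed
  have n: "real (length S) > 0" using S by simp
  \<comment> \<open>The rate 1/25 is the derivative bound 2/5 times the guaranteed label fraction
    1/10.\<close>
  have up_step: "\<eta> / 25 \<le> \<eta> * ((\<Sum>s\<leftarrow>S. drift t i s p) / real (length S))"
  proof -
    have "(2 / 5) * real (length (filter (\<lambda>s. snd s = \<sigma>) S)) \<le> (\<Sum>s\<leftarrow>S. drift t i s p)"
    proof (rule sum_list_le_count)
      fix s assume s: "s \<in> set S"
      show "(if snd s = \<sigma> then 2 / 5 else 0) \<le> drift t i s p"
      proof (cases "snd s = \<sigma>")
        case True
        have "drift t i s p = ?c s" unfolding drift_def pos[OF s True] using True \<sigma> \<sigma>' pat_ip[OF p(1) p(1)] by auto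
        then show ?thesis using True loss_deriv_lower[OF S(2)[OF s] t] by simp
      qed (simp add: drift_def neg[OF s])
    qed
    then have "real (length S) / 25 \<le> (\<Sum>s\<leftarrow>S. drift t i s p)" using balanced[OF \<sigma>'] by simp
    then have "1 / 25 \<le> (\<Sum>s\<leftarrow>S. drift t i s p) / real (length S)" using n by (simp add: field_simps)
    then have "\<eta> * (1 / 25) \<le> \<eta> * ((\<Sum>s\<leftarrow>S. drift t i s p) / real (length S))"
      using \<eta> by (intro mult_left_mono) auto
    then show ?thesis by simp
  qed
  have down_step: "\<eta> * ((\<Sum>s\<leftarrow>S. drift t i s l) / real (length S)) \<le> 0" if l: "l \<in> {1..d} - {p}" for l
  proof -
    have "(\<Sum>s\<leftarrow>S. drift t i s l) \<le> 0 * real (length S)"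
    proof (rule sum_list_le_length)
      fix s assume s: "s \<in> set S"
      note vs = S(2)[OF s]
      show "drift t i s l \<le> 0"
      proof (cases "snd s = \<sigma>")
        case True
        then show ?thesis using pat_ip[OF p(1), of l] l by (simp add: drift_def pos[OF s])
      next
        case False
        then have "snd s * a i = -1" using vs \<sigma> \<sigma>' by (auto simp: valid_sample_def)
        moreover have "0 \<le> ip d (?q s) (pat l)" using pvec_coeff[OF vs, of l "W t i"] l by auto
        ultimately show ?thesis using logloss'_neg[of "snd s * net d k (W t) a (fst s)"]
          by (simp add: drift_def mult_nonpos_nonneg)
      qed
    qed
    then show ?thesis using n \<eta> by (simp add: mult_le_0_iff divide_le_0_iff)
  qed
  have "u 0 i p + \<eta> / 25 * real (Suc t) \<le> u (Suc t) i p"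
  proof -
    have "\<eta> / 25 * real (Suc t) = \<eta> / 25 * real t + \<eta> / 25" by (simp add: algebra_simps)
    then show ?thesis unfolding u_Suc using up_step IH(1)[folded p_def] by linarith
  qed
  moreover have "u (Suc t) i l \<le> u 0 i l" if "l \<in> {1..d} - {p}" for l
    unfolding u_Suc using down_step[OF that] IH(2)[of l] that by (simp add: p_def)
  ultimately show ?case by (simp add: p_def)
qed simp

text \<open>On its own label the neuron sees the coordinate that grew. On the other label it sees
  only coordinates that started at most r and never increased.\<close>

lemma good_neuron_feature:
  assumes i: "i < k" and \<sigma>: "a i = \<sigma>" and dom: "dominant d pat (label_index \<sigma>) (W0 i)"
    and s: "valid_sample d pat s"
  shows "snd s = \<sigma> \<Longrightarrow> maxact d (W T i) (fst s) \<ge> \<eta> / 25 * real T"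
    and "snd s \<noteq> \<sigma> \<Longrightarrow> maxact d (W T i) (fst s) \<le> r"
proof -
  note inv = good_neuron_invariant[OF i \<sigma> dom le_refl]
  {
    assume "snd s = \<sigma>"
    then have "pat (label_index \<sigma>) \<in> set (fst s)" using s by (auto simp: valid_sample_def)
    then have "u T i (label_index \<sigma>) \<le> maxact d (W T i) (fst s)" unfolding u_def by (rule maxact_ge)
    moreover have "0 \<le> u 0 i (label_index \<sigma>)"
      using dom d by (auto simp: dominant_def u_def W_0 intro: order_trans[OF abs_ge_zero less_imp_le])
    ultimately show "maxact d (W T i) (fst s) \<ge> \<eta> / 25 * real T" using inv by linarith
  next
    assume ne: "snd s \<noteq> \<sigma>"
    have \<sigma>': "\<sigma> \<in> {1, -1}" using a[OF i] \<sigma> by simp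
    show "maxact d (W T i) (fst s) \<le> r"
    proof (rule maxact_le[OF valid_nonempty[OF s]])
      fix v assume "v \<in> set (fst s)"
      then obtain l where l: "l \<in> {1..d}" "v = pat l" "l = label_index (snd s) \<or> l \<in> {3..d}" using valid_patch[OF s] by metis
      then have "l \<noteq> label_index \<sigma>" using ne s \<sigma>' by (auto simp: valid_sample_def label_index_def)
      then have "u T i l \<le> u 0 i l" using inv l(1) by auto
      also have "\<dots> \<le> r" using abs_u_le[OF i l(1), of 0] by simp
      finally show "ip d (W T i) v \<le> r" by (simp add: u_def l(2))
    qed (use r in simp)
  }
qed

end


section \<open>Training the second layer\<close>

lemma net_eq_ip: "net d k V b x = ip k b (\<lambda>i. maxact d (V i) x)"
  by (simp add: net_def ip_def)

lemma sum_list_nth: "(\<Sum>s\<leftarrow>S. f s) = (\<Sum>j<length S. f (S ! j))"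
  by (subst sum_list_sum_nth) (simp add: atLeast0LessThan)

locale two_phase = first_layer +
  fixes S' :: "(inp \<times> real) list" and \<eta>' :: real
  assumes S': "S' \<noteq> []" "\<And>s. s \<in> set S' \<Longrightarrow> valid_sample d pat s"
    and \<eta>': "0 < \<eta>'" "\<eta>' < 8 * real k" and T: "T > 0"
    and P: "real (card (good_neurons d k pat 1 1 W0 a)) \<ge> real k / (32 * real d)"
    and N: "real (card (good_neurons d k pat 2 (-1) W0 a)) \<ge> real k / (32 * real d)"
begin

definition V :: "nat \<Rightarrow> vec" where "V = W T"

definition b :: "nat \<Rightarrow> nat \<Rightarrow> real" where "b t = a_iter d k \<eta>' V S' t a"

definition \<phi> :: "inp \<Rightarrow> vec" where "\<phi> x = (\<lambda>i. maxact d (V i) x)"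

text \<open>Each feature is at most \<open>r + \<eta> * T\<close>, and
  \<open>r \<le> \<eta> * T / 200\<close> because \<open>T \<ge> 1\<close>; hence the factor
  201/200, and \<open>sqrt k\<close> for k such features.\<close>

definition radius :: real where "radius = 201 / 200 * (\<eta> * real T) * sqrt (real k)"

lemma r_le: "r \<le> \<eta> * real T / 200"
proof -
  have "\<eta> * 1 \<le> \<eta> * real T" using T \<eta> by (intro mult_left_mono) auto
  then show ?thesis using r by linarith
qed

lemma radius_pos: "radius > 0"
  unfolding radius_def using \<eta> T k by simp

lemma feature_norm:
  assumes s: "valid_sample d pat s"
  shows "vnorm k (\<phi> (fst s)) \<le> radius"
proof -
  have nn: "0 \<le> \<eta> * real T" using \<eta> by simp
  have "ip k (\<phi> (fst s)) (\<phi> (fst s)) \<le> (\<Sum>i<k. (201 / 200 * (\<eta> * real T)) * (201 / 200 * (\<eta> * real T)))"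
    unfolding ip_def
  proof (rule sum_mono)
    fix i assume "i \<in> {..<k}"
    then have "\<phi> (fst s) i \<le> 201 / 200 * (\<eta> * real T)"
      using maxact_bound[OF s, of i T] r_le by (simp add: \<phi>_def V_def)
    moreover have "0 \<le> \<phi> (fst s) i" by (simp add: \<phi>_def maxact_nonneg[OF valid_nonempty[OF s]])
    ultimately show "\<phi> (fst s) i * \<phi> (fst s) i \<le> (201 / 200 * (\<eta> * real T)) * (201 / 200 * (\<eta> * real T))"
      using nn by (intro mult_mono) auto
  qed
  also have "\<dots> = radius\<^sup>2" by (simp add: radius_def power_mult_distrib power2_eq_square)
  finally show ?thesis unfolding vnorm_def using radius_pos by (intro real_le_lsqrt) auto
qed

text \<open>Chosen so that \<open>\<kappa>\<^sup>2 * 64 * d / k = 1\<close>: each of the two good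
  sets has at least \<open>k / (32 * d)\<close> members, which makes the norm of
  \<open>ustar\<close> at most 1.\<close>

definition \<kappa> :: real where "\<kappa> = sqrt (real k) / (8 * sqrt (real d))"

definition PS :: "nat set" where "PS = good_neurons d k pat 1 1 W0 a"
definition NS :: "nat set" where "NS = good_neurons d k pat 2 (-1) W0 a"

definition ustar :: vec where
  "ustar i = \<kappa> * ((if i \<in> PS then 1 / real (card PS) else 0) - (if i \<in> NS then 1 / real (card NS) else 0))"

lemma PS_NS: "PS \<subseteq> {..<k}" "NS \<subseteq> {..<k}" "finite PS" "finite NS" "PS \<inter> NS = {}"
  unfolding PS_def NS_def good_neurons_def by auto

lemma card_PS_NS: "real (card PS) \<ge> real k / (32 * real d)" "real (card NS) \<ge> real k / (32 * real d)"
   "real (card PS) > 0" "real (card NS) > 0"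
proof -
  show c: "real (card PS) \<ge> real k / (32 * real d)" "real (card NS) \<ge> real k / (32 * real d)"
    using P N by (simp_all add: PS_def NS_def)
  have "real k / (32 * real d) > 0" using k d by simp
  then show "real (card PS) > 0" "real (card NS) > 0" using c by linarith+
qed

lemma ip_ustar: "ip k ustar f = \<kappa> * ((\<Sum>i\<in>PS. f i) / real (card PS) - (\<Sum>i\<in>NS. f i) / real (card NS))"
proof -
  have *: "(\<Sum>i<k. (if i \<in> A then c else 0) * f i) = c * (\<Sum>i\<in>A. f i)" if "A \<subseteq> {..<k}" for A and c :: real
  proof -
    have "(\<Sum>i<k. (if i \<in> A then c else 0) * f i) = (\<Sum>i<k. if i \<in> A then c * f i else 0)"
      by (rule sum.cong) auto
    also have "\<dots> = (\<Sum>i\<in>{..<k} \<inter> A. c * f i)" by (rule sum.inter_restrict[symmetric]) simp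
    finally show ?thesis using that by (simp add: sum_distrib_left Int_absorb1)
  qed
  have "ip k ustar f = \<kappa> * ((\<Sum>i<k. (if i \<in> PS then 1 / real (card PS) else 0) * f i)
      - (\<Sum>i<k. (if i \<in> NS then 1 / real (card NS) else 0) * f i))"
    unfolding ip_def ustar_def sum_subtractf[symmetric] sum_distrib_left
    by (rule sum.cong) (simp_all add: algebra_simps)
  then show ?thesis by (simp only: *[OF PS_NS(1)] *[OF PS_NS(2)]) simp
qed

lemma \<kappa>_pos: "\<kappa> > 0"
  unfolding \<kappa>_def using k d by simp

lemma ustar_norm: "vnorm k ustar \<le> 1"
proof -
  have "(\<Sum>i\<in>PS. ustar i) = (\<Sum>i\<in>PS. \<kappa> / real (card PS))"
    using PS_NS(5) by (intro sum.cong) (auto simp: ustar_def)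
  then have 1: "(\<Sum>i\<in>PS. ustar i) = \<kappa>" using card_PS_NS by simp
  have "(\<Sum>i\<in>NS. ustar i) = (\<Sum>i\<in>NS. - \<kappa> / real (card NS))"
    using PS_NS(5) by (intro sum.cong) (auto simp: ustar_def)
  then have 2: "(\<Sum>i\<in>NS. ustar i) = - \<kappa>" using card_PS_NS by simp
  have inv: "1 / real (card PS) \<le> 32 * real d / real k" "1 / real (card NS) \<le> 32 * real d / real k"
    using card_PS_NS k d by (simp_all add: field_simps)
  have "\<kappa> * (\<kappa> / real (card PS) - - \<kappa> / real (card NS)) \<le> \<kappa>\<^sup>2 * (64 * real d / real k)"
  proof -
    have "1 / real (card PS) + 1 / real (card NS) \<le> 64 * real d / real k"
      using add_mono[OF inv] by simp
    then have "\<kappa>\<^sup>2 * (1 / real (card PS) + 1 / real (card NS)) \<le> \<kappa>\<^sup>2 * (64 * real d / real k)"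
      by (intro mult_left_mono) auto
    moreover have "\<kappa> * (\<kappa> / real (card PS) - - \<kappa> / real (card NS)) = \<kappa>\<^sup>2 * (1 / real (card PS) + 1 / real (card NS))"
      by (simp add: algebra_simps power2_eq_square)
    ultimately show ?thesis by simp
  qed
  also have "\<dots> = 1" using k d by (simp add: \<kappa>_def power_divide power_mult_distrib)
  finally have "ip k ustar ustar \<le> 1" unfolding ip_ustar 1 2 .
  then show ?thesis by (simp add: vnorm_def)
qed

text \<open>The average over the good neurons of the correct sign is at least
  \<open>\<eta> * T / 25\<close>, the average over the others at most
  \<open>r \<le> \<eta> * T / 200\<close>; the margin is the difference,
  \<open>1/25 - 1/200 = 7/200\<close>.\<close>

lemma ustar_margin:
  assumes s: "valid_sample d pat s"
  shows "\<kappa> * (7 / 200 * (\<eta> * real T)) \<le> ip k ustar (\<lambda>i. snd s * \<phi> (fst s) i)"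
proof -
  have pos: "i < k" "a i = 1" "dominant d pat (label_index 1) (W0 i)" if "i \<in> PS" for i
    using that by (auto simp: PS_def good_neurons_def label_index_def)
  have neg: "i < k" "a i = -1" "dominant d pat (label_index (-1)) (W0 i)" if "i \<in> NS" for i
    using that by (auto simp: NS_def good_neurons_def label_index_def)
  have avg_ge: "c \<le> (\<Sum>i\<in>A. f i) / real (card A)" if "\<And>i. i \<in> A \<Longrightarrow> c \<le> f i" "real (card A) > 0" for A :: "nat set" and f c
    using sum_mono[of A "\<lambda>_. c" f] that by (simp add: pos_le_divide_eq mult.commute)
  have avg_le: "(\<Sum>i\<in>A. f i) / real (card A) \<le> c" if "\<And>i. i \<in> A \<Longrightarrow> f i \<le> c" "real (card A) > 0" for A :: "nat set" and f c
    using sum_mono[of A f "\<lambda>_. c"] that by (simp add: pos_divide_le_eq mult.commute)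
  have y: "snd s = 1 \<or> snd s = -1" using s by (auto simp: valid_sample_def)
  have "7 / 200 * (\<eta> * real T) \<le> (\<Sum>i\<in>PS. snd s * \<phi> (fst s) i) / real (card PS) - (\<Sum>i\<in>NS. snd s * \<phi> (fst s) i) / real (card NS)"
    using y
  proof
    assume y: "snd s = 1"
    have "\<eta> * real T / 25 \<le> (\<Sum>i\<in>PS. snd s * \<phi> (fst s) i) / real (card PS)"
      by (rule avg_ge[OF _ card_PS_NS(3)]) (use good_neuron_feature(1)[OF pos s] y in \<open>simp add: \<phi>_def V_def\<close>)
    moreover have "(\<Sum>i\<in>NS. snd s * \<phi> (fst s) i) / real (card NS) \<le> r"
      by (rule avg_le[OF _ card_PS_NS(4)]) (use good_neuron_feature(2)[OF neg s] y in \<open>simp add: \<phi>_def V_def\<close>)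
    ultimately show ?thesis using r_le by linarith
  next
    assume y: "snd s = -1"
    have "- r \<le> (\<Sum>i\<in>PS. snd s * \<phi> (fst s) i) / real (card PS)"
      by (rule avg_ge[OF _ card_PS_NS(3)]) (use good_neuron_feature(2)[OF pos s] y in \<open>simp add: \<phi>_def V_def\<close>)
    moreover have "(\<Sum>i\<in>NS. snd s * \<phi> (fst s) i) / real (card NS) \<le> - (\<eta> * real T / 25)"
      by (rule avg_le[OF _ card_PS_NS(4)]) (use good_neuron_feature(1)[OF neg s] y in \<open>simp add: \<phi>_def V_def\<close>)
    ultimately show ?thesis using r_le by linarith
  qed
  then show ?thesis unfolding ip_ustar using \<kappa>_pos by (intro mult_left_mono) auto
qed

definition zs :: "nat \<Rightarrow> vec" where
  "zs j = (\<lambda>i. snd (S' ! j) * \<phi> (fst (S' ! j)) i)"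

lemma ip_zs: "ip k w (zs j) = snd (S' ! j) * net d k V w (fst (S' ! j))"
  unfolding zs_def ip_scale_right net_eq_ip \<phi>_def ..

lemma logistic_gd_second_layer: "logistic_gd k (length S') zs \<eta>' radius (\<kappa> * (7 / 200 * (\<eta> * real T))) ustar b"
proof
  show "0 < length S'" using S' by simp
  show "0 < \<eta>'" by (rule \<eta>')
  show "0 < radius" by (rule radius_pos)
  show "0 < \<kappa> * (7 / 200 * (\<eta> * real T))" using \<kappa>_pos \<eta> T by simp
  show "vnorm k ustar \<le> 1" by (rule ustar_norm)
  fix j assume j: "j < length S'"
  then have v: "valid_sample d pat (S' ! j)" using S' by simp
  show "\<kappa> * (7 / 200 * (\<eta> * real T)) \<le> ip k ustar (zs j)"
    unfolding zs_def by (rule ustar_margin[OF v])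
  have "ip k (zs j) (zs j) = ip k (\<phi> (fst (S' ! j))) (\<phi> (fst (S' ! j)))"
    unfolding zs_def ip_scale_left ip_scale_right using v by (auto simp: valid_sample_def)
  then show "vnorm k (zs j) \<le> radius" using feature_norm[OF v] by (simp add: vnorm_def)
next
  \<comment> \<open>The condition \<open>\<eta>' < 8 * k\<close> meets the stability requirement
    because the first phase keeps features small: \<open>k * \<eta> * T \<le> 1/4\<close>, so
    \<open>8 * k * radius\<^sup>2\<close> is about 1/2.\<close>
  have "real k * (\<eta> * real T) \<le> 1 / 4"
    by (rule order_trans[OF _ k_eta]) (use \<eta> in \<open>intro mult_left_mono, auto\<close>)
  then have "(real k * (\<eta> * real T))\<^sup>2 \<le> (1 / 4)\<^sup>2" using \<eta> by (intro power_mono) auto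
  moreover have "\<eta>' * radius\<^sup>2 \<le> 8 * real k * radius\<^sup>2" using \<eta>' by (intro mult_right_mono) auto
  moreover have "8 * real k * radius\<^sup>2 = 40401 / 5000 * (real k * (\<eta> * real T))\<^sup>2"
    by (simp add: radius_def power_mult_distrib power2_eq_square)
  ultimately have "\<eta>' * radius\<^sup>2 \<le> 40401 / 5000 * (1 / 4)\<^sup>2" by linarith
  then show "\<eta>' * radius\<^sup>2 \<le> 1" by (simp add: power2_eq_square)
next
  fix t
  have "b (Suc t) = (\<lambda>i. b t i - \<eta>' * grada d k V (b t) S' i)"
    by (simp add: b_def a_iter_def)
  also have "\<dots> = (\<lambda>i. b t i - \<eta>' * ((\<Sum>j<length S'. logloss' (ip k (b t) (zs j)) * zs j i) / real (length S')))"
    unfolding grada_def case_prod_beta sum_list_nth ip_zs by (simp add: zs_def \<phi>_def mult.assoc)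
  finally show "b (Suc t) = (\<lambda>i. b t i - \<eta>' * ((\<Sum>j<length S'. logloss' (ip k (b t) (zs j)) * zs j i) / real (length S')))" .
qed

lemma emp_loss_tendsto_0: "(\<lambda>t. emp_loss d k V (b t) S') \<longlonglongrightarrow> 0"
proof -
  interpret gd: logistic_gd k "length S'" zs \<eta>' radius "\<kappa> * (7 / 200 * (\<eta> * real T))" ustar b
    by (rule logistic_gd_second_layer)
  have "emp_loss d k V (b t) S' = gd.L t" for t
    unfolding emp_loss_def case_prod_beta sum_list_nth gd.L_def ip_zs ..
  then show ?thesis using gd.L_tendsto_0 by simp
qed

text \<open>The margin is measured relative to the feature norm, as the generalization bound needs
  it. The constant 2000 is a rounding: \<open>201/400000 \<le> 7/12800\<close>, the right side
  coming from \<open>\<kappa> * 7/200\<close> divided by 8.\<close>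

lemma eventually_sample_margin:
  "\<forall>\<^sub>F t in sequentially. vnorm k (b t) > 0 \<and>
     (\<forall>s\<in>set S'. snd s * net d k V (b t) (fst s) \<ge> radius * vnorm k (b t) / (2000 * sqrt (real d)))"
proof -
  interpret gd: logistic_gd k "length S'" zs \<eta>' radius "\<kappa> * (7 / 200 * (\<eta> * real T))" ustar b
    by (rule logistic_gd_second_layer)
  have le: "radius / (2000 * sqrt (real d)) \<le> \<kappa> * (7 / 200 * (\<eta> * real T)) / 8"
  proof -
    have "radius / (2000 * sqrt (real d)) = 201 / 400000 * ((\<eta> * real T) * sqrt (real k) / sqrt (real d))"
      by (simp add: radius_def)
    also have "\<dots> \<le> 7 / 12800 * ((\<eta> * real T) * sqrt (real k) / sqrt (real d))"
      using \<eta> by (intro mult_right_mono) auto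
    also have "\<dots> = \<kappa> * (7 / 200 * (\<eta> * real T)) / 8" by (simp add: \<kappa>_def)
    finally show ?thesis .
  qed
  show ?thesis using gd.eventually_margin
  proof eventually_elim
    case (elim t)
    have "snd s * net d k V (b t) (fst s) \<ge> radius * vnorm k (b t) / (2000 * sqrt (real d))" if s: "s \<in> set S'" for s
    proof -
      obtain j where j: "j < length S'" "s = S' ! j" using s by (auto simp: in_set_conv_nth)
      have "radius * vnorm k (b t) / (2000 * sqrt (real d)) = radius / (2000 * sqrt (real d)) * vnorm k (b t)" by simp
      also have "\<dots> \<le> \<kappa> * (7 / 200 * (\<eta> * real T)) / 8 * vnorm k (b t)" by (intro mult_right_mono le) simp
      also have "\<dots> \<le> ip k (b t) (zs j)" using elim j by auto
      finally show ?thesis by (simp add: ip_zs j(2))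
    qed
    then show ?case using elim by auto
  qed
qed

end


section \<open>A PAC-Bayes bound with sign vectors\<close>

definition signs :: "'i set \<Rightarrow> ('i \<Rightarrow> real) set" where
  "signs I = I \<rightarrow>\<^sub>E {1, -1}"

text \<open>The probability of s when the signs are independent with means \<open>\<beta> i\<close>;
  the uniform distribution is the case of zero mean. Since \<open>signs I\<close> is finite,
  expectations are written as plain sums.\<close>

definition biased :: "'i set \<Rightarrow> ('i \<Rightarrow> real) \<Rightarrow> ('i \<Rightarrow> real) \<Rightarrow> real" where
  "biased I \<beta> s = (\<Prod>i\<in>I. (1 + s i * \<beta> i) / 2)"

definition linsum :: "'i set \<Rightarrow> ('i \<Rightarrow> real) \<Rightarrow> ('i \<Rightarrow> real) \<Rightarrow> real" where
  "linsum I s \<phi> = (\<Sum>i\<in>I. s i * \<phi> i)"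

lemma finite_signs: "finite I \<Longrightarrow> finite (signs I)"
  by (simp add: signs_def finite_PiE)

lemma signs_mem: "s \<in> signs I \<Longrightarrow> i \<in> I \<Longrightarrow> s i = 1 \<or> s i = -1"
  by (auto simp: signs_def PiE_iff)

context
  fixes I :: "'i set" and \<beta> :: "'i \<Rightarrow> real"
  assumes fin: "finite I" and \<beta>: "\<And>i. i \<in> I \<Longrightarrow> \<bar>\<beta> i\<bar> \<le> 1"
begin

lemma biased_nonneg:
  assumes s: "s \<in> signs I"
  shows "biased I \<beta> s \<ge> 0"
  unfolding biased_def
proof (intro prod_nonneg)
  fix i assume "i \<in> I"
  then show "0 \<le> (1 + s i * \<beta> i) / 2" using \<beta>[of i] signs_mem[OF s, of i] by auto
qed

lemma sum_biased_prod:
  "(\<Sum>s\<in>signs I. biased I \<beta> s * (\<Prod>i\<in>I. f i (s i))) = (\<Prod>i\<in>I. (1 + \<beta> i) / 2 * f i 1 + (1 - \<beta> i) / 2 * f i (-1))"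
proof -
  have "(\<Prod>i\<in>I. (1 + \<beta> i) / 2 * f i 1 + (1 - \<beta> i) / 2 * f i (-1)) = (\<Prod>i\<in>I. \<Sum>v\<in>{1, -1}. (1 + v * \<beta> i) / 2 * f i v)"
    by (intro prod.cong) auto
  also have "\<dots> = (\<Sum>s\<in>signs I. \<Prod>i\<in>I. (1 + s i * \<beta> i) / 2 * f i (s i))"
    unfolding signs_def by (rule prod_sum_PiE) (use fin in auto)
  finally show ?thesis unfolding biased_def prod.distrib[symmetric] by (rule sym)
qed

lemma sum_biased: "(\<Sum>s\<in>signs I. biased I \<beta> s) = 1"
  using sum_biased_prod[of "\<lambda>_ _. 1"] by (simp add: add_divide_distrib[symmetric])

lemma biased_mean:
  assumes j: "j \<in> I"
  shows "(\<Sum>s\<in>signs I. biased I \<beta> s * s j) = \<beta> j"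
proof -
  have "(\<Sum>s\<in>signs I. biased I \<beta> s * s j) = (\<Sum>s\<in>signs I. biased I \<beta> s * (\<Prod>i\<in>I. if i = j then s i else 1))"
    using j fin by (simp add: prod.delta)
  also have "\<dots> = (\<Prod>i\<in>I. (1 + \<beta> i) / 2 * (if i = j then 1 else 1) + (1 - \<beta> i) / 2 * (if i = j then -1 else 1))"
    by (rule sum_biased_prod[of "\<lambda>i v. if i = j then v else 1"])
  also have "\<dots> = (\<Prod>i\<in>I. if i = j then \<beta> i else 1)"
    by (intro prod.cong) (auto simp: field_simps)
  finally show ?thesis using j fin by (simp add: prod.delta)
qed

lemma sum_biased_linsum: "(\<Sum>s\<in>signs I. biased I \<beta> s * linsum I s \<phi>) = linsum I \<beta> \<phi>"
proof -
  have "(\<Sum>s\<in>signs I. biased I \<beta> s * linsum I s \<phi>) = (\<Sum>s\<in>signs I. \<Sum>i\<in>I. biased I \<beta> s * s i * \<phi> i)"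
    by (simp add: linsum_def sum_distrib_left mult.assoc)
  also have "\<dots> = (\<Sum>i\<in>I. \<Sum>s\<in>signs I. biased I \<beta> s * s i * \<phi> i)" by (rule sum.swap)
  also have "\<dots> = (\<Sum>i\<in>I. \<beta> i * \<phi> i)"
    by (intro sum.cong refl) (simp add: sum_distrib_right[symmetric] biased_mean)
  finally show ?thesis by (simp add: linsum_def)
qed

text \<open>A sign is an affine image of a Bernoulli variable, with jump 2. Hoeffding's lemma with
  step \<open>2 * h\<close> therefore gives the exponent \<open>h\<^sup>2 / 2\<close>.\<close>

lemma biased_mgf:
  "(\<Sum>s\<in>signs I. biased I \<beta> s * exp (t * linsum I s \<phi>)) \<le> exp (t * linsum I \<beta> \<phi> + t\<^sup>2 / 2 * (\<Sum>i\<in>I. (\<phi> i)\<^sup>2))"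
proof -
  have "(\<Sum>s\<in>signs I. biased I \<beta> s * exp (t * linsum I s \<phi>)) = (\<Sum>s\<in>signs I. biased I \<beta> s * (\<Prod>i\<in>I. exp (t * (s i * \<phi> i))))"
    by (simp add: linsum_def sum_distrib_left exp_sum[OF fin])
  also have "\<dots> = (\<Prod>i\<in>I. (1 + \<beta> i) / 2 * exp (t * (1 * \<phi> i)) + (1 - \<beta> i) / 2 * exp (t * (-1 * \<phi> i)))"
    by (rule sum_biased_prod[of "\<lambda>i v. exp (t * (v * \<phi> i))"])
  also have "\<dots> \<le> (\<Prod>i\<in>I. exp (t * (\<beta> i * \<phi> i) + t\<^sup>2 / 2 * (\<phi> i)\<^sup>2))"
  proof (rule prod_mono, intro conjI)
    fix i assume i: "i \<in> I"
    define h where "h = t * \<phi> i"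
    define p where "p = (1 + \<beta> i) / 2"
    have p: "0 \<le> p" "p \<le> 1" using \<beta>[OF i] by (auto simp: p_def)
    have "(1 + \<beta> i) / 2 * exp (t * (1 * \<phi> i)) + (1 - \<beta> i) / 2 * exp (t * (-1 * \<phi> i)) = p * exp h + (1 - p) * exp (-h)"
      by (simp add: p_def h_def field_simps)
    also have "\<dots> = exp (-h) * (1 + p * (exp (2 * h) - 1))"
      by (simp add: algebra_simps mult_exp_exp flip: exp_add)
    also have "\<dots> \<le> exp (-h) * exp (2 * h * p + (2 * h)\<^sup>2 / 8)"
      by (intro mult_left_mono bernoulli_mgf_bound p) simp
    also have "\<dots> = exp (t * (\<beta> i * \<phi> i) + t\<^sup>2 / 2 * (\<phi> i)\<^sup>2)"
      unfolding exp_add[symmetric] by (simp add: p_def h_def field_simps power2_eq_square)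
    finally show "(1 + \<beta> i) / 2 * exp (t * (1 * \<phi> i)) + (1 - \<beta> i) / 2 * exp (t * (-1 * \<phi> i))
       \<le> exp (t * (\<beta> i * \<phi> i) + t\<^sup>2 / 2 * (\<phi> i)\<^sup>2)" .
    show "0 \<le> (1 + \<beta> i) / 2 * exp (t * (1 * \<phi> i)) + (1 - \<beta> i) / 2 * exp (t * (-1 * \<phi> i))"
      using \<beta>[OF i] by (intro add_nonneg_nonneg mult_nonneg_nonneg) auto
  qed
  also have "\<dots> = exp (t * linsum I \<beta> \<phi> + t\<^sup>2 / 2 * (\<Sum>i\<in>I. (\<phi> i)\<^sup>2))"
    by (simp add: linsum_def exp_sum[OF fin, symmetric] sum.distrib sum_distrib_left)
  finally show ?thesis .
qed

lemma biased_tail_le: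
  assumes B: "(\<Sum>i\<in>I. (\<phi> i)\<^sup>2) \<le> B" "B > 0" and \<theta>: "\<theta> \<ge> 0" and gap: "linsum I \<beta> \<phi> \<ge> c + \<theta>"
  shows "(\<Sum>s\<in>signs I. biased I \<beta> s * of_bool (linsum I s \<phi> \<le> c)) \<le> exp (- \<theta>\<^sup>2 / (2 * B))"
proof -
  \<comment> \<open>The minimizer of the Chernoff exponent
    \<open>- t * \<theta> + t\<^sup>2 * B / 2\<close>.\<close>
  define t where "t = \<theta> / B"
  have t: "t \<ge> 0" using \<theta> B by (simp add: t_def)
  have "(\<Sum>s\<in>signs I. biased I \<beta> s * of_bool (linsum I s \<phi> \<le> c))
     \<le> (\<Sum>s\<in>signs I. exp (t * c) * (biased I \<beta> s * exp (- t * linsum I s \<phi>)))"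
  proof (rule sum_mono)
    fix s assume s: "s \<in> signs I"
    have "of_bool (linsum I s \<phi> \<le> c) \<le> exp (t * c + - t * linsum I s \<phi>)"
      using mult_left_mono[of "linsum I s \<phi>" c t] t by simp
    also have "\<dots> = exp (t * c) * exp (- t * linsum I s \<phi>)" by (rule exp_add)
    finally have "biased I \<beta> s * of_bool (linsum I s \<phi> \<le> c) \<le> biased I \<beta> s * (exp (t * c) * exp (- t * linsum I s \<phi>))"
      by (rule mult_left_mono) (rule biased_nonneg[OF s])
    then show "biased I \<beta> s * of_bool (linsum I s \<phi> \<le> c) \<le> exp (t * c) * (biased I \<beta> s * exp (- t * linsum I s \<phi>))"
      by (simp add: mult_ac)
  qed
  also have "\<dots> = exp (t * c) * (\<Sum>s\<in>signs I. biased I \<beta> s * exp (- t * linsum I s \<phi>))"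
    by (simp add: sum_distrib_left)
  also have "\<dots> \<le> exp (t * c) * exp (- t * linsum I \<beta> \<phi> + (-t)\<^sup>2 / 2 * (\<Sum>i\<in>I. (\<phi> i)\<^sup>2))"
    by (intro mult_left_mono biased_mgf) simp
  also have "\<dots> = exp (t * c + (- t * linsum I \<beta> \<phi> + t\<^sup>2 / 2 * (\<Sum>i\<in>I. (\<phi> i)\<^sup>2)))" by (simp add: exp_add)
  also have "\<dots> \<le> exp (- \<theta>\<^sup>2 / (2 * B))"
  proof -
    have "t * (c + \<theta>) \<le> t * linsum I \<beta> \<phi>" by (intro mult_left_mono gap t)
    moreover have "t\<^sup>2 / 2 * (\<Sum>i\<in>I. (\<phi> i)\<^sup>2) \<le> t\<^sup>2 / 2 * B" by (intro mult_left_mono B) simp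
    moreover have "t * (c + \<theta>) = t * c + \<theta>\<^sup>2 / B" "t\<^sup>2 / 2 * B = \<theta>\<^sup>2 / B / 2"
      using B by (simp_all add: t_def power2_eq_square distrib_left)
    moreover have "w \<le> x \<Longrightarrow> y \<le> z \<Longrightarrow> w = v + u \<Longrightarrow> z = u / 2 \<Longrightarrow> v + (- x + y) \<le> - (u / 2)" for u v w x y z :: real
      by linarith
    ultimately have "t * c + (- (t * linsum I \<beta> \<phi>) + t\<^sup>2 / 2 * (\<Sum>i\<in>I. (\<phi> i)\<^sup>2)) \<le> - (\<theta>\<^sup>2 / B / 2)"
      by blast
    then show ?thesis by (simp add: mult.commute)
  qed
  finally show ?thesis .
qed

lemma biased_tail_ge:
  assumes B: "(\<Sum>i\<in>I. (\<phi> i)\<^sup>2) \<le> B" "B > 0" and \<theta>: "\<theta> \<ge> 0" and gap: "linsum I \<beta> \<phi> \<le> c - \<theta>"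
  shows "(\<Sum>s\<in>signs I. biased I \<beta> s * of_bool (linsum I s \<phi> \<le> c)) \<ge> 1 - exp (- \<theta>\<^sup>2 / (2 * B))"
proof -
  have neg: "linsum I s (\<lambda>i. - \<phi> i) = - linsum I s \<phi>" for s by (simp add: linsum_def sum_negf)
  have "(\<Sum>s\<in>signs I. biased I \<beta> s * of_bool (linsum I s (\<lambda>i. - \<phi> i) \<le> - c)) \<le> exp (- \<theta>\<^sup>2 / (2 * B))"
    by (rule biased_tail_le[OF _ B(2) \<theta>]) (use B gap in \<open>auto simp: neg\<close>)
  moreover have "(\<Sum>s\<in>signs I. biased I \<beta> s) \<le> (\<Sum>s\<in>signs I. biased I \<beta> s * of_bool (linsum I s \<phi> \<le> c) + biased I \<beta> s * of_bool (linsum I s (\<lambda>i. - \<phi> i) \<le> - c))"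
    by (intro sum_mono) (use biased_nonneg in \<open>auto simp: neg\<close>)
  ultimately show ?thesis by (simp add: sum.distrib sum_biased)
qed

text \<open>Gibbs' variational inequality, with the relative entropy of \<open>biased I \<beta>\<close> bounded by \<open>\<parallel>\<beta>\<parallel>\<^sup>2\<close>
  through \<open>1 + s \<beta> \<le> exp (s \<beta>)\<close>.\<close>
lemma biased_gibbs:
  assumes H: "H = (\<Sum>s\<in>signs I. exp (f s)) / 2 ^ card I"
  shows "(\<Sum>s\<in>signs I. biased I \<beta> s * f s) \<le> ln H + (\<Sum>i\<in>I. (\<beta> i)\<^sup>2)"
proof -
  have ne: "signs I \<noteq> {}" by (simp add: signs_def PiE_eq_empty_iff)
  have H0: "H > 0" unfolding H using ne finite_signs[OF fin] by (intro divide_pos_pos sum_pos) auto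
  \<comment> \<open>The inequality \<open>1 + x \<le> exp x\<close> weighted by the posterior. The
    density of the posterior with respect to the uniform prior is at most
    \<open>exp (linsum I s \<beta>)\<close>, so summing the right-hand side over s gives
    \<open>H / H - 1 = 0\<close>.\<close>
  have "biased I \<beta> s * (f s - linsum I s \<beta> - ln H) \<le> exp (f s) / 2 ^ card I / H - biased I \<beta> s" if s: "s \<in> signs I" for s
  proof -
    let ?x = "f s - linsum I s \<beta> - ln H"
    have "biased I \<beta> s * exp (- linsum I s \<beta>) \<le> 1 / 2 ^ card I"
    proof -
      have "(\<Prod>i\<in>I. 1 + s i * \<beta> i) \<le> (\<Prod>i\<in>I. exp (s i * \<beta> i))"
      proof (intro prod_mono conjI)
        fix i assume "i \<in> I"
        then show "0 \<le> 1 + s i * \<beta> i" using \<beta>[of i] signs_mem[OF s, of i] by auto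
        show "1 + s i * \<beta> i \<le> exp (s i * \<beta> i)" by (rule exp_ge_add_one_self)
      qed
      also have "\<dots> = exp (linsum I s \<beta>)" by (simp add: linsum_def exp_sum[OF fin])
      finally have "(\<Prod>i\<in>I. 1 + s i * \<beta> i) * exp (- linsum I s \<beta>) \<le> 1"
        by (simp add: exp_minus field_simps)
      then show ?thesis by (simp add: biased_def prod_dividef divide_simps)
    qed
    then have "biased I \<beta> s * exp (- linsum I s \<beta>) * (exp (f s) / H) \<le> 1 / 2 ^ card I * (exp (f s) / H)"
      using H0 by (intro mult_right_mono) auto
    moreover have "biased I \<beta> s * ?x \<le> biased I \<beta> s * (exp ?x - 1)"
      using exp_ge_add_one_self[of ?x] by (intro mult_left_mono biased_nonneg[OF s]) linarith
    moreover have "exp ?x = exp (- linsum I s \<beta>) * (exp (f s) / H)"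
      unfolding exp_diff exp_minus exp_ln[OF H0] by (simp add: field_simps)
    ultimately show ?thesis by (simp add: algebra_simps)
  qed
  then have "(\<Sum>s\<in>signs I. biased I \<beta> s * (f s - linsum I s \<beta> - ln H)) \<le> (\<Sum>s\<in>signs I. exp (f s) / 2 ^ card I / H - biased I \<beta> s)"
    by (rule sum_mono)
  also have "\<dots> = H / H - 1"
    by (simp add: sum_subtractf sum_biased sum_divide_distrib[symmetric] H)
  also have "\<dots> = 0" using H0 by simp
  finally have "(\<Sum>s\<in>signs I. biased I \<beta> s * f s) - (\<Sum>s\<in>signs I. biased I \<beta> s * linsum I s \<beta>) - ln H * (\<Sum>s\<in>signs I. biased I \<beta> s) \<le> 0"
    by (simp add: algebra_simps sum.distrib sum_subtractf sum_distrib_left)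
  then show ?thesis by (simp add: sum_biased sum_biased_linsum) (simp add: linsum_def power2_eq_square)
qed

end

section \<open>The exponential PAC-Bayes functional of the sample\<close>

definition sign_error :: "'a pmf \<Rightarrow> 'i set \<Rightarrow> ('a \<Rightarrow> 'i \<Rightarrow> real) \<Rightarrow> real \<Rightarrow> ('i \<Rightarrow> real) \<Rightarrow> real" where
  "sign_error D I \<psi> \<theta> s = measure_pmf.prob D {x. linsum I s (\<psi> x) \<le> \<theta>}"

definition sign_count :: "'i set \<Rightarrow> ('a \<Rightarrow> 'i \<Rightarrow> real) \<Rightarrow> real \<Rightarrow> 'a list \<Rightarrow> ('i \<Rightarrow> real) \<Rightarrow> real" where
  "sign_count I \<psi> \<theta> S s = (\<Sum>x\<leftarrow>S. of_bool (linsum I s (\<psi> x) \<le> \<theta>))"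

text \<open>The average over a uniformly random sign vector; half of the expected number of errors
  is offset by the observed number. The weight 1/2 is what makes its mean over samples at most
  1.\<close>

definition pac_functional :: "'a pmf \<Rightarrow> 'i set \<Rightarrow> ('a \<Rightarrow> 'i \<Rightarrow> real) \<Rightarrow> real \<Rightarrow> 'a list \<Rightarrow> real" where
  "pac_functional D I \<psi> \<theta> S =
     (\<Sum>s\<in>signs I. exp (real (length S) * sign_error D I \<psi> \<theta> s / 2 - sign_count I \<psi> \<theta> S s)) / 2 ^ card I"

text \<open>Signs drawn from the posterior have mean score \<open>linsum I \<beta>\<close>, and by
  Hoeffding they deviate by \<theta> in a given direction with probability at most \<tau>. A
  training score of \<open>2 * \<theta>\<close> thus stays above \<theta> up to \<tau>, and a test
  point of nonpositive score stays below \<theta> up to \<tau>. Gibbs' inequality compares both at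
  the common threshold \<theta>.\<close>

lemma pac_bayes_bound:
  assumes fin: "finite I" and \<beta>: "\<And>i. i \<in> I \<Longrightarrow> \<bar>\<beta> i\<bar> \<le> 1" and B: "B > 0" and \<theta>: "\<theta> \<ge> 0"
    and \<psi>: "\<And>x. x \<in> set_pmf D \<Longrightarrow> (\<Sum>i\<in>I. (\<psi> x i)\<^sup>2) \<le> B" and SD: "set S \<subseteq> set_pmf D"
    and margin: "\<And>x. x \<in> set S \<Longrightarrow> linsum I \<beta> (\<psi> x) \<ge> 2 * \<theta>"
    and H: "pac_functional D I \<psi> \<theta> S \<le> 1 / \<delta>" and \<delta>: "\<delta> > 0"
    and \<tau>: "\<tau> = exp (- \<theta>\<^sup>2 / (2 * B))"
  shows "real (length S) / 2 * (1 - \<tau>) * measure_pmf.prob D {x. linsum I \<beta> (\<psi> x) \<le> 0}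
     \<le> real (length S) * \<tau> + (\<Sum>i\<in>I. (\<beta> i)\<^sup>2) + ln (1 / \<delta>)"
proof -
  note fs = finite_signs[OF fin]
  let ?q = "biased I \<beta>"
  let ?f = "\<lambda>s. real (length S) * sign_error D I \<psi> \<theta> s / 2 - sign_count I \<psi> \<theta> S s"
  have \<tau>1: "\<tau> \<le> 1" unfolding \<tau> using B by simp
  have "ln (pac_functional D I \<psi> \<theta> S) \<le> ln (1 / \<delta>)"
  proof -
    have "pac_functional D I \<psi> \<theta> S > 0" unfolding pac_functional_def
      using fs by (intro divide_pos_pos sum_pos) (auto simp: signs_def PiE_eq_empty_iff)
    then show ?thesis using H \<delta> by (subst ln_le_cancel_iff) auto
  qed
  moreover have "(\<Sum>s\<in>signs I. ?q s * ?f s) \<le> ln (pac_functional D I \<psi> \<theta> S) + (\<Sum>i\<in>I. (\<beta> i)\<^sup>2)"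
    by (rule biased_gibbs[OF fin \<beta>]) (simp_all add: pac_functional_def)
  moreover have "(\<Sum>s\<in>signs I. ?q s * sign_count I \<psi> \<theta> S s) \<le> real (length S) * \<tau>"
    using SD margin
  proof (induction S)
    case (Cons x S)
    have "(\<Sum>s\<in>signs I. ?q s * of_bool (linsum I s (\<psi> x) \<le> \<theta>)) \<le> \<tau>"
      unfolding \<tau> by (rule biased_tail_le[OF fin \<beta> \<psi> B \<theta>]) (use Cons.prems in auto)
    moreover have "(\<Sum>s\<in>signs I. ?q s * sign_count I \<psi> \<theta> S s) \<le> real (length S) * \<tau>"
      using Cons by simp
    ultimately show ?case by (simp add: sign_count_def algebra_simps sum.distrib)
  qed (simp add: sign_count_def)
  moreover have "(1 - \<tau>) * measure_pmf.prob D {x. linsum I \<beta> (\<psi> x) \<le> 0} \<le> (\<Sum>s\<in>signs I. ?q s * sign_error D I \<psi> \<theta> s)"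
  proof -
    have int: "integrable (measure_pmf D) (\<lambda>x. c * of_bool (P x) :: real)" for c and P :: "_ \<Rightarrow> bool"
      by (rule measure_pmf.integrable_const_bound[where B="\<bar>c\<bar>"]) auto
    have E: "measure_pmf.expectation D (\<lambda>x. c * of_bool (P x)) = c * measure_pmf.prob D {x. P x}" for c and P :: "_ \<Rightarrow> bool"
    proof -
      have "measure_pmf.expectation D (\<lambda>x. of_bool (P x)) = measure_pmf.expectation D (indicator {x. P x} :: _ \<Rightarrow> real)"
        by (rule Bochner_Integration.integral_cong) (auto simp: indicator_def)
      also have "\<dots> = measure_pmf.prob D {x. P x}"
        by (rule trans[OF Bochner_Integration.integral_indicator]) simp
      finally show ?thesis by simp
    qed
    have "(1 - \<tau>) * measure_pmf.prob D {x. linsum I \<beta> (\<psi> x) \<le> 0}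
        = measure_pmf.expectation D (\<lambda>x. (1 - \<tau>) * of_bool (linsum I \<beta> (\<psi> x) \<le> 0))"
      by (rule E[symmetric])
    also have "\<dots> \<le> measure_pmf.expectation D (\<lambda>x. \<Sum>s\<in>signs I. ?q s * of_bool (linsum I s (\<psi> x) \<le> \<theta>))"
    proof (rule integral_mono_AE)
      show "integrable (measure_pmf D) (\<lambda>x. \<Sum>s\<in>signs I. ?q s * of_bool (linsum I s (\<psi> x) \<le> \<theta>))"
        by (intro Bochner_Integration.integrable_sum int)
      show "AE x in measure_pmf D. (1 - \<tau>) * of_bool (linsum I \<beta> (\<psi> x) \<le> 0) \<le> (\<Sum>s\<in>signs I. ?q s * of_bool (linsum I s (\<psi> x) \<le> \<theta>))"
        unfolding AE_measure_pmf_iff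
      proof
        fix x assume x: "x \<in> set_pmf D"
        show "(1 - \<tau>) * of_bool (linsum I \<beta> (\<psi> x) \<le> 0) \<le> (\<Sum>s\<in>signs I. ?q s * of_bool (linsum I s (\<psi> x) \<le> \<theta>))"
        proof (cases "linsum I \<beta> (\<psi> x) \<le> 0")
          case True
          then show ?thesis using biased_tail_ge[OF fin \<beta> \<psi>[OF x] B \<theta>, where c=\<theta>] by (simp add: \<tau>)
        next
          case False
          then show ?thesis using biased_nonneg[OF fin \<beta>] by (auto intro!: sum_nonneg)
        qed
      qed
    qed (rule int)
    also have "\<dots> = (\<Sum>s\<in>signs I. ?q s * sign_error D I \<psi> \<theta> s)"
      by (subst Bochner_Integration.integral_sum) (simp_all only: int E sign_error_def)
    finally show ?thesis .
  qed
  then have "real (length S) / 2 * ((1 - \<tau>) * measure_pmf.prob D {x. linsum I \<beta> (\<psi> x) \<le> 0})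
      \<le> real (length S) / 2 * (\<Sum>s\<in>signs I. ?q s * sign_error D I \<psi> \<theta> s)"
    by (rule mult_left_mono) simp
  moreover have "(\<Sum>s\<in>signs I. ?q s * ?f s) = real (length S) / 2 * (\<Sum>s\<in>signs I. ?q s * sign_error D I \<psi> \<theta> s)
     - (\<Sum>s\<in>signs I. ?q s * sign_count I \<psi> \<theta> S s)"
    unfolding sum_distrib_left sum_subtractf[symmetric] by (intro sum.cong refl) (simp add: algebra_simps)
  ultimately show ?thesis by (simp add: mult.assoc)
qed

section \<open>Exponential moments of i.i.d. samples\<close>

lemma nn_integral_iid_pmf_prod:
  "(\<integral>\<^sup>+S. (\<Prod>x\<leftarrow>S. f x) \<partial>iid_pmf m D) = (\<integral>\<^sup>+x. f x \<partial>D) ^ m"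
  by (induction m) (simp_all add: nn_integral_cmult nn_integral_multc)

lemma length_iid_pmf: "S \<in> set_pmf (iid_pmf m D) \<Longrightarrow> length S = m"
  by (induction m arbitrary: S) auto

lemma set_iid_pmf: "S \<in> set_pmf (iid_pmf m D) \<Longrightarrow> set S \<subseteq> set_pmf D"
  by (induction m arbitrary: S) (simp, fastforce)

lemma iid_pmf_append:
  "iid_pmf (m1 + m2) D = bind_pmf (iid_pmf m1 D) (\<lambda>S1. bind_pmf (iid_pmf m2 D) (\<lambda>S2. return_pmf (S1 @ S2)))"
proof (induction m1)
  case 0
  then show ?case by (simp add: bind_return_pmf bind_return_pmf')
qed (simp add: bind_assoc_pmf bind_return_pmf)

lemma prod_list_exp_indicator:
  "(\<Prod>x\<leftarrow>S. ennreal (exp (- of_bool (P x)))) = ennreal (exp (- (\<Sum>x\<leftarrow>S. of_bool (P x))))"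
  by (induction S) (simp_all add: ennreal_mult[symmetric] mult_exp_exp)

text \<open>Each factor is \<open>1 - (1 - exp (-1)) * p\<close>, and
  \<open>1 - exp (-1) \<ge> 1/2\<close>. Serves both the PAC-Bayes functional and the label
  counts.\<close>

lemma nn_integral_iid_pmf_count:
  fixes D :: "'a pmf" and P :: "'a \<Rightarrow> bool"
  defines "p \<equiv> measure_pmf.prob D {x. P x}"
  shows "(\<integral>\<^sup>+S. ennreal (exp (- (\<Sum>x\<leftarrow>S. of_bool (P x)))) \<partial>iid_pmf m D) \<le> ennreal (exp (- real m * p / 2))"
proof -
  have p: "0 \<le> p" "p \<le> 1" by (simp_all add: p_def)
  have e: "exp (-1 :: real) \<le> 1 / 2"
    using exp_ge_add_one_self[of "1::real"] by (simp add: exp_minus field_simps)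
  have "(\<integral>\<^sup>+x. ennreal (exp (- of_bool (P x))) \<partial>D) = ennreal (measure_pmf.expectation D (\<lambda>x. 1 - (1 - exp (-1)) * indicator {x. P x} x))"
  proof (subst nn_integral_eq_integral[symmetric])
    show "integrable (measure_pmf D) (\<lambda>x. 1 - (1 - exp (-1)) * indicator {x. P x} x :: real)"
      by (rule measure_pmf.integrable_const_bound[where B=1]) (auto simp: indicator_def)
    show "(\<integral>\<^sup>+x. ennreal (exp (- of_bool (P x))) \<partial>D) = (\<integral>\<^sup>+x. ennreal (1 - (1 - exp (-1)) * indicator {x. P x} x) \<partial>D)"
      by (intro nn_integral_cong) (simp add: indicator_def)
  qed (auto simp: indicator_def)
  also have "measure_pmf.expectation D (\<lambda>x. 1 - (1 - exp (-1)) * indicator {x. P x} x) = 1 - (1 - exp (-1)) * p"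
  proof -
    have "integrable (measure_pmf D) (indicator {x. P x} :: _ \<Rightarrow> real)"
      by (rule measure_pmf.integrable_const_bound[where B=1]) auto
    then show ?thesis by (subst Bochner_Integration.integral_diff) (simp_all add: p_def)
  qed
  also have "ennreal (1 - (1 - exp (-1)) * p) \<le> ennreal (exp (- p / 2))"
  proof (rule ennreal_leI)
    have "p * (1/2) \<le> p * (1 - exp (-1))" by (intro mult_left_mono p) (use e in simp)
    then have "1 - (1 - exp (-1)) * p \<le> 1 + (- p / 2)" by (simp add: mult.commute)
    also have "\<dots> \<le> exp (- p / 2)" by (rule exp_ge_add_one_self)
    finally show "1 - (1 - exp (-1)) * p \<le> exp (- p / 2)" .
  qed
  finally have "(\<integral>\<^sup>+x. ennreal (exp (- of_bool (P x))) \<partial>D) ^ m \<le> ennreal (exp (- p / 2)) ^ m"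
    by (rule power_mono) simp
  also have "\<dots> = ennreal (exp (- real m * p / 2))"
    by (simp add: ennreal_power exp_of_nat_mult[symmetric])
  finally show ?thesis
    unfolding prod_list_exp_indicator[symmetric] nn_integral_iid_pmf_prod .
qed

text \<open>For every single sign vector the exponential has mean at most 1; averaging over the
  prior preserves this. Markov's inequality then yields the confidence level \<delta>.\<close>

lemma nn_integral_pac_functional:
  assumes fin: "finite I"
  shows "(\<integral>\<^sup>+S. ennreal (pac_functional D I \<psi> \<theta> S) \<partial>iid_pmf m D) \<le> 1"
proof -
  note fs = finite_signs[OF fin]
  have card: "card (signs I) = 2 ^ card I"
    unfolding signs_def by (subst card_PiE[OF fin]) (simp add: numeral_2_eq_2)
  have "(\<integral>\<^sup>+S. ennreal (pac_functional D I \<psi> \<theta> S) \<partial>iid_pmf m D)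
     = (\<integral>\<^sup>+S. (\<Sum>s\<in>signs I. ennreal (exp (real m * sign_error D I \<psi> \<theta> s / 2) / 2 ^ card I) * ennreal (exp (- sign_count I \<psi> \<theta> S s))) \<partial>iid_pmf m D)"
  proof (rule nn_integral_cong_AE, unfold AE_measure_pmf_iff, rule)
    fix S assume "S \<in> set_pmf (iid_pmf m D)"
    then have "length S = m" by (rule length_iid_pmf)
    then have "pac_functional D I \<psi> \<theta> S = (\<Sum>s\<in>signs I. (exp (real m * sign_error D I \<psi> \<theta> s / 2) / 2 ^ card I) * exp (- sign_count I \<psi> \<theta> S s))"
      unfolding pac_functional_def sum_divide_distrib by (intro sum.cong refl) (simp only: exp_diff exp_minus \<open>length S = m\<close>, simp add: field_simps)
    then show "ennreal (pac_functional D I \<psi> \<theta> S) = (\<Sum>s\<in>signs I. ennreal (exp (real m * sign_error D I \<psi> \<theta> s / 2) / 2 ^ card I) * ennreal (exp (- sign_count I \<psi> \<theta> S s)))"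
      by (simp add: sum_ennreal ennreal_mult[symmetric])
  qed
  also have "\<dots> = (\<Sum>s\<in>signs I. ennreal (exp (real m * sign_error D I \<psi> \<theta> s / 2) / 2 ^ card I) * (\<integral>\<^sup>+S. ennreal (exp (- sign_count I \<psi> \<theta> S s)) \<partial>iid_pmf m D))"
    by (subst nn_integral_sum) (simp_all add: nn_integral_cmult)
  also have "\<dots> \<le> (\<Sum>s\<in>signs I. ennreal (exp (real m * sign_error D I \<psi> \<theta> s / 2) / 2 ^ card I) * ennreal (exp (- real m * sign_error D I \<psi> \<theta> s / 2)))"
    unfolding sign_count_def sign_error_def by (intro sum_mono mult_left_mono nn_integral_iid_pmf_count) simp
  also have "\<dots> = (\<Sum>s\<in>signs I. ennreal (1 / 2 ^ card I))"
    by (intro sum.cong refl) (simp add: ennreal_mult[symmetric] exp_minus)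
  also have "\<dots> = ennreal (\<Sum>s\<in>signs I. 1 / 2 ^ card I)" by (rule sum_ennreal) simp
  also have "\<dots> = 1" by (simp add: card)
  finally show ?thesis .
qed

lemma prob_pac_functional:
  assumes fin: "finite I" and \<delta>: "\<delta> > 0"
  shows "measure_pmf.prob (iid_pmf m D) {S. pac_functional D I \<psi> \<theta> S \<le> 1 / \<delta>} \<ge> 1 - \<delta>"
proof -
  let ?B = "{S. 1 / \<delta> < pac_functional D I \<psi> \<theta> S}"
  have "emeasure (iid_pmf m D) ?B = (\<integral>\<^sup>+S. indicator ?B S \<partial>iid_pmf m D)" by simp
  also have "\<dots> \<le> (\<integral>\<^sup>+S. ennreal \<delta> * ennreal (pac_functional D I \<psi> \<theta> S) \<partial>iid_pmf m D)"
  proof (intro nn_integral_mono)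
    fix S
    show "indicator ?B S \<le> ennreal \<delta> * ennreal (pac_functional D I \<psi> \<theta> S)"
    proof (cases "S \<in> ?B")
      case True
      then have b: "1 / \<delta> < pac_functional D I \<psi> \<theta> S" by simp
      then have "1 \<le> \<delta> * pac_functional D I \<psi> \<theta> S" using \<delta> by (simp add: field_simps)
      moreover have "0 \<le> pac_functional D I \<psi> \<theta> S" using b \<delta> by (smt (verit) divide_nonneg_pos)
      ultimately show ?thesis using True \<delta> by (simp add: ennreal_mult[symmetric])
    qed simp
  qed
  also have "\<dots> = ennreal \<delta> * (\<integral>\<^sup>+S. ennreal (pac_functional D I \<psi> \<theta> S) \<partial>iid_pmf m D)"
    by (rule nn_integral_cmult) simp
  also have "\<dots> \<le> ennreal \<delta> * 1" by (intro mult_left_mono nn_integral_pac_functional fin) simp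
  finally have "measure_pmf.prob (iid_pmf m D) ?B \<le> \<delta>"
    using \<delta> by (simp add: measure_pmf.emeasure_eq_measure)
  moreover have "measure_pmf.prob (iid_pmf m D) {S. pac_functional D I \<psi> \<theta> S \<le> 1 / \<delta>} = 1 - measure_pmf.prob (iid_pmf m D) ?B"
    by (subst measure_pmf.prob_compl[symmetric]) (auto intro: arg_cong[where f="measure_pmf.prob _"])
  ultimately show ?thesis by simp
qed


text \<open>Each coordinate of the feature vector is repeated, so that a sum of many signs, of small bias each,
  can have an arbitrary mean.\<close>
definition signed_feature :: "nat \<Rightarrow> (nat \<Rightarrow> vec) \<Rightarrow> inp \<times> real \<Rightarrow> nat \<times> nat \<Rightarrow> real" where
  "signed_feature d W s ij = snd s * maxact d (W (fst ij)) (fst s)"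

lemma linsum_signed_feature:
  "linsum ({..<k} \<times> {..<M}) (\<lambda>ij. c * b (fst ij)) (signed_feature d W s) = real M * c * (snd s * net d k W b (fst s))"
proof -
  have "linsum ({..<k} \<times> {..<M}) (\<lambda>ij. c * b (fst ij)) (signed_feature d W s)
      = (\<Sum>i<k. \<Sum>j<M. c * b i * (snd s * maxact d (W i) (fst s)))"
    unfolding linsum_def signed_feature_def sum.cartesian_product by (intro sum.cong refl) auto
  also have "\<dots> = real M * c * (snd s * net d k W b (fst s))"
    by (simp add: net_def sum_distrib_left mult_ac)
  finally show ?thesis .
qed

context two_phase
begin

text \<open>The error depends only on the direction of \<open>b t\<close>, so it is rescaled: \<nu>
  is the norm of the posterior mean, spread over M copies of each neuron, and
  \<open>\<nu>\<^sup>2 \<le> M\<close> keeps each bias within \<open>[-1, 1]\<close>. The hypothesis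
  H does not involve t and hence applies to all late iterates.\<close>

lemma eventually_test_error:
  assumes D: "\<And>s. s \<in> set_pmf D \<Longrightarrow> valid_sample d pat s" and SD: "set S' \<subseteq> set_pmf D" and \<delta>: "0 < \<delta>"
    and \<nu>: "\<nu> > 0" and M: "M > 0" "\<nu>\<^sup>2 \<le> real M"
    and H: "pac_functional D ({..<k} \<times> {..<M}) (signed_feature d V) (\<nu> * sqrt (real M) * radius / (4000 * sqrt (real d))) S' \<le> 1 / \<delta>"
    and \<tau>: "\<tau> = exp (- (\<nu>\<^sup>2 / (32000000 * real d)))"
  shows "\<forall>\<^sub>F t in sequentially. real (length S') / 2 * (1 - \<tau>) * measure_pmf.prob D {s. snd s * net d k V (b t) (fst s) \<le> 0}
      \<le> real (length S') * \<tau> + \<nu>\<^sup>2 + ln (1 / \<delta>)"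
  using eventually_sample_margin
proof eventually_elim
  case (elim t)
  let ?I = "{..<k} \<times> {..<M}"
  define \<theta> where "\<theta> = \<nu> * sqrt (real M) * radius / (4000 * sqrt (real d))"
  define B where "B = real M * radius\<^sup>2"
  define nb where "nb = vnorm k (b t)"
  define c where "c = \<nu> / (nb * sqrt (real M))"
  define \<beta> where "\<beta> ij = c * b t (fst ij)" for ij :: "nat \<times> nat"
  have nb: "nb > 0" using elim by (simp add: nb_def)
  have c: "c > 0" using \<nu> nb M by (simp add: c_def)
  have dpos: "real d > 0" using d by simp
  have lin: "linsum ?I \<beta> (signed_feature d V s) = real M * c * (snd s * net d k V (b t) (fst s))" for s
    unfolding \<beta>_def by (rule linsum_signed_feature)
  have Mc: "real M * c > 0" using M c by simp
  \<comment> \<open>Half of the sample margin constant gives 4000 in \<theta>; then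
    \<open>32000000 = 2 * 4000\<^sup>2\<close>, while M and \<open>radius\<close> cancel.\<close>
  have \<tau>': "\<tau> = exp (- \<theta>\<^sup>2 / (2 * B))"
  proof -
    have "\<theta>\<^sup>2 / (2 * B) = \<nu>\<^sup>2 / (32000000 * real d)"
      unfolding \<theta>_def B_def power_divide power_mult_distrib using M radius_pos dpos by (simp add: power_mult_distrib)
    then show ?thesis by (simp add: \<tau>)
  qed
  have "real (length S') / 2 * (1 - \<tau>) * measure_pmf.prob D {s. linsum ?I \<beta> (signed_feature d V s) \<le> 0}
     \<le> real (length S') * \<tau> + (\<Sum>ij\<in>?I. (\<beta> ij)\<^sup>2) + ln (1 / \<delta>)"
  proof (rule pac_bayes_bound[OF _ _ _ _ _ SD _ H[folded \<theta>_def] \<delta> \<tau>'])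
    show "finite ?I" by simp
    show "B > 0" using M radius_pos by (simp add: B_def)
    show "\<theta> \<ge> 0" using \<nu> radius_pos by (simp add: \<theta>_def)
    show "\<bar>\<beta> ij\<bar> \<le> 1" if "ij \<in> ?I" for ij
    proof -
      have "\<bar>b t (fst ij)\<bar> \<le> nb"
      proof -
        have "\<bar>b t (fst ij)\<bar> \<le> L2_set (\<lambda>i. \<bar>b t i\<bar>) {..<k}"
          by (rule member_le_L2_set) (use that in auto)
        then show ?thesis by (simp add: nb_def vnorm_eq_L2 L2_set_def)
      qed
      then have "\<bar>\<beta> ij\<bar> \<le> c * nb" unfolding \<beta>_def abs_mult using c by (intro mult_mono) auto
      also have "\<dots> = \<nu> / sqrt (real M)" using nb by (simp add: c_def)
      also have "\<dots> \<le> 1" using M \<nu> by (simp add: real_le_rsqrt)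
      finally show ?thesis .
    qed
    show "(\<Sum>ij\<in>?I. (signed_feature d V s ij)\<^sup>2) \<le> B" if s: "s \<in> set_pmf D" for s
    proof -
      have "(\<Sum>ij\<in>?I. (signed_feature d V s ij)\<^sup>2) = (\<Sum>i<k. \<Sum>j<M. (\<phi> (fst s) i)\<^sup>2)"
        unfolding sum.cartesian_product using D[OF s]
        by (intro sum.cong refl) (auto simp: signed_feature_def \<phi>_def valid_sample_def)
      also have "\<dots> = real M * (vnorm k (\<phi> (fst s)))\<^sup>2"
        unfolding vnorm_power2 ip_def by (simp add: sum_distrib_left power2_eq_square)
      also have "\<dots> \<le> B" unfolding B_def
        by (intro mult_left_mono power_mono feature_norm[OF D[OF s]]) auto
      finally show ?thesis .
    qed
    show "2 * \<theta> \<le> linsum ?I \<beta> (signed_feature d V s)" if s: "s \<in> set S'" for s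
    proof -
      have "radius * nb / (2000 * sqrt (real d)) \<le> snd s * net d k V (b t) (fst s)"
        using elim s by (simp add: nb_def)
      then have "real M * c * (radius * nb / (2000 * sqrt (real d))) \<le> linsum ?I \<beta> (signed_feature d V s)"
        unfolding lin using Mc by (intro mult_left_mono) auto
      moreover have "real M * c * (radius * nb / (2000 * sqrt (real d))) = 2 * \<theta>"
      proof -
        have "real M * c * nb = \<nu> * (real M / sqrt (real M))" using nb by (simp add: c_def)
        also have "real M / sqrt (real M) = sqrt (real M)" by (rule real_div_sqrt) simp
        finally have "(real M * c * nb) * (radius / (2000 * sqrt (real d))) = \<nu> * sqrt (real M) * (radius / (2000 * sqrt (real d)))" by simp
        then show ?thesis by (simp add: \<theta>_def mult_ac)
      qed
      ultimately show ?thesis by simp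
    qed
  qed
  moreover have "(\<Sum>ij\<in>?I. (\<beta> ij)\<^sup>2) = \<nu>\<^sup>2"
  proof -
    have "(\<Sum>ij\<in>?I. (\<beta> ij)\<^sup>2) = (\<Sum>i<k. \<Sum>j<M. c\<^sup>2 * (b t i)\<^sup>2)"
      unfolding sum.cartesian_product by (intro sum.cong refl) (auto simp: \<beta>_def power_mult_distrib)
    also have "\<dots> = real M * c\<^sup>2 * nb\<^sup>2"
      unfolding nb_def vnorm_power2 ip_def by (simp add: sum_distrib_left power2_eq_square mult_ac)
    also have "\<dots> = \<nu>\<^sup>2" using nb M by (simp add: c_def power_divide power_mult_distrib)
    finally show ?thesis .
  qed
  moreover have "{s. linsum ?I \<beta> (signed_feature d V s) \<le> 0} = {s. snd s * net d k V (b t) (fst s) \<le> 0}"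
  proof -
    have "real M * c * x \<le> 0 \<longleftrightarrow> x \<le> 0" for x
      using mult_le_cancel_left_pos[OF Mc, of x 0] by (simp only: mult_zero_right)
    then show ?thesis unfolding lin by simp
  qed
  ultimately show ?case by simp
qed

end


section \<open>The sample and the good event\<close>

lemma set_pmf_Dist:
  assumes "n \<ge> 1" "d \<ge> 3"
  shows "set_pmf (Dist n d pat) = (\<Union>y\<in>{1, -1}. \<Union>jp\<in>{..<n}. \<Union>f\<in>{..<n} \<rightarrow>\<^sub>E {3..d}.
    {(map (\<lambda>j. if j = jp then (if y = 1 then pat 1 else pat 2) else pat (f j)) [0..<n], y)})"
proof -
  have ne: "({..<n} \<rightarrow>\<^sub>E {3..d}) \<noteq> {}" "finite ({..<n} \<rightarrow>\<^sub>E {3..d})" "{..<n} \<noteq> {}"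
    using assms lessThan_iff[of 0 n] by (auto simp: PiE_eq_empty_iff simp del: lessThan_iff intro!: finite_PiE)
  have y: "set_pmf (pmf_of_set {1, -1 :: real}) = {1, -1}" by (rule set_pmf_of_set) auto
  show ?thesis
    unfolding Dist_def set_bind_pmf set_return_pmf y set_pmf_of_set[OF ne(1,2)] set_pmf_of_set[OF ne(3) finite_lessThan] ..
qed

lemma valid_sample_Dist:
  assumes "n \<ge> 1" "d \<ge> 3" and s: "s \<in> set_pmf (Dist n d pat)"
  shows "valid_sample d pat s"
proof -
  obtain y jp f where s: "s = (map (\<lambda>j. if j = jp then (if y = 1 then pat 1 else pat 2) else pat (f j)) [0..<n], y)"
    and y: "y \<in> {1, -1}" and jp: "jp < n" and f: "f \<in> {..<n} \<rightarrow>\<^sub>E {3..d}"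
    using s unfolding set_pmf_Dist[OF assms(1,2)] by blast
  have lab: "(if y = 1 then pat 1 else pat 2) = pat (label_index y)" by (simp add: label_index_def)
  have fj: "pat (f j) \<in> pat ` {3..d}" if "j < n" for j using PiE_mem[OF f, of j] that by blast
  define h where "h j = (if j = jp then pat (label_index y) else pat (f j))" for j
  have s': "s = (map h [0..<n], y)" unfolding s lab h_def ..
  have "pat (label_index y) = h jp" by (simp add: h_def)
  then have "pat (label_index y) \<in> h ` {0..<n}" using jp by (intro image_eqI[of _ h jp]) auto
  moreover have "h ` {0..<n} \<subseteq> insert (pat (label_index y)) (pat ` {3..d})"
    using fj unfolding h_def by (intro image_subsetI) simp
  ultimately show ?thesis unfolding valid_sample_def s' using y by simp
qed

lemma finite_set_pmf_Dist:
  assumes "n \<ge> 1" "d \<ge> 3"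
  shows "finite (set_pmf (Dist n d pat))"
  unfolding set_pmf_Dist[OF assms] by (intro finite_UN_I finite_PiE finite_lessThan) auto

lemma prob_Dist_label:
  assumes \<sigma>: "\<sigma> \<in> {1, -1}"
  shows "measure_pmf.prob (Dist n d pat) {s. snd s = \<sigma>} = 1 / 2"
proof -
  have "map_pmf snd (Dist n d pat) = pmf_of_set {1, -1}"
    unfolding Dist_def by (simp add: map_bind_pmf bind_pmf_const bind_return_pmf')
  moreover have "measure_pmf.prob (Dist n d pat) {s. snd s = \<sigma>} = measure_pmf.prob (map_pmf snd (Dist n d pat)) {\<sigma>}"
    by (simp add: vimage_def)
  ultimately show ?thesis using \<sigma> by (auto simp: measure_pmf_of_set)
qed

definition balanced :: "(inp \<times> real) list \<Rightarrow> bool" where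
  "balanced S \<longleftrightarrow> (\<forall>\<sigma>\<in>{1, -1}. real (length S) / 10 \<le> real (length (filter (\<lambda>s. snd s = \<sigma>) S)))"

text \<open>Chernoff with \<open>p = 1/2\<close>: the exponent is
  \<open>1/10 - 1/4 = - 3/20\<close>.\<close>

lemma prob_few_label:
  assumes \<sigma>: "\<sigma> \<in> {1, -1}"
  shows "measure_pmf.prob (iid_pmf m (Dist n d pat)) {S. real (length (filter (\<lambda>s. snd s = \<sigma>) S)) < real (length S) / 10}
     \<le> exp (- (3 / 20) * real m)"
proof -
  let ?D = "iid_pmf m (Dist n d pat)" and ?c = "\<lambda>S. (\<Sum>s\<leftarrow>S. of_bool (snd s = \<sigma>)) :: real"
  let ?B = "{S. real (length (filter (\<lambda>s. snd s = \<sigma>) S)) < real (length S) / 10}"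
  have c: "real (length (filter (\<lambda>s. snd s = \<sigma>) S)) = ?c S" for S :: "(inp \<times> real) list"
    by (induction S) auto
  have "emeasure ?D ?B = (\<integral>\<^sup>+S. indicator ?B S \<partial>?D)" by simp
  also have "\<dots> \<le> (\<integral>\<^sup>+S. ennreal (exp (real m / 10)) * ennreal (exp (- ?c S)) \<partial>?D)"
  proof (rule nn_integral_mono_AE, unfold AE_measure_pmf_iff, rule)
    fix S assume "S \<in> set_pmf ?D"
    then have "length S = m" by (rule length_iid_pmf)
    moreover have "1 \<le> exp (real m / 10) * exp (- ?c S)" if "?c S < real m / 10"
      using that by (simp add: mult_exp_exp)
    ultimately show "indicator ?B S \<le> ennreal (exp (real m / 10)) * ennreal (exp (- ?c S))"
      by (simp add: indicator_def c ennreal_mult[symmetric])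
  qed
  also have "\<dots> = ennreal (exp (real m / 10)) * (\<integral>\<^sup>+S. ennreal (exp (- ?c S)) \<partial>?D)"
    by (rule nn_integral_cmult) simp
  also have "\<dots> \<le> ennreal (exp (real m / 10)) * ennreal (exp (- real m * (1 / 2) / 2))"
    using nn_integral_iid_pmf_count[where P="\<lambda>s. snd s = \<sigma>" and m=m and D="Dist n d pat"] prob_Dist_label[OF \<sigma>, of n d pat]
    by (intro mult_left_mono) simp_all
  also have "\<dots> = ennreal (exp (- (3 / 20) * real m))"
    by (simp add: ennreal_mult[symmetric] mult_exp_exp)
  finally show ?thesis by (simp add: measure_pmf.emeasure_eq_measure)
qed

lemma prob_balanced:
  "measure_pmf.prob (iid_pmf m (Dist n d pat)) {S. balanced S} \<ge> 1 - 2 * exp (- (3 / 20) * real m)"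
proof -
  let ?D = "iid_pmf m (Dist n d pat)"
  let ?B = "\<lambda>\<sigma>. {S. real (length (filter (\<lambda>s. snd s = \<sigma>) S)) < real (length S) / 10} :: (inp \<times> real) list set"
  have "1 - measure_pmf.prob ?D {S. balanced S} = measure_pmf.prob ?D (- {S. balanced S})"
    by (subst measure_pmf.prob_compl[symmetric]) (auto intro: arg_cong[where f="measure_pmf.prob _"])
  also have "- {S. balanced S} = ?B 1 \<union> ?B (-1)"
    by (auto simp: balanced_def not_le)
  also have "measure_pmf.prob ?D \<dots> \<le> measure_pmf.prob ?D (?B 1) + measure_pmf.prob ?D (?B (-1))"
    by (rule measure_Un_le) auto
  also have "\<dots> \<le> exp (- (3 / 20) * real m) + exp (- (3 / 20) * real m)"
    by (intro add_mono prob_few_label) auto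
  finally show ?thesis by simp
qed

text \<open>Conditioning on the first half: a sample is the concatenation of two independent ones.
  The length \<open>(m + 1) div 2\<close> is the ceiling of \<open>m / 2\<close> used by
  \<open>S1\<close>.\<close>

lemma prob_split_sample:
  assumes Q: "\<And>A. A \<in> set_pmf (iid_pmf ((m + 1) div 2) D) \<Longrightarrow> P A \<Longrightarrow> measure_pmf.prob (iid_pmf (m div 2) D) {B. Q A B} \<ge> p"
    and p: "0 \<le> p"
  shows "measure_pmf.prob (iid_pmf m D) {S. P (S1 S) \<and> Q (S1 S) (S2 S)} \<ge> p * measure_pmf.prob (iid_pmf ((m + 1) div 2) D) {A. P A}"
proof -
  let ?m1 = "(m + 1) div 2" and ?m2 = "m div 2"
  have m: "m = ?m1 + ?m2" by linarith
  let ?E = "{S. P (S1 S) \<and> Q (S1 S) (S2 S)}"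
  have split: "S1 (A @ B) = A" "S2 (A @ B) = B" if "A \<in> set_pmf (iid_pmf ?m1 D)" "B \<in> set_pmf (iid_pmf ?m2 D)" for A B
  proof -
    have "length A = ?m1" "length B = ?m2" using that by (auto dest: length_iid_pmf)
    moreover from this have "(length (A @ B) + 1) div 2 = ?m1" using m by simp
    ultimately show "S1 (A @ B) = A" "S2 (A @ B) = B" by (simp_all add: S1_def S2_def)
  qed
  have "ennreal (p * measure_pmf.prob (iid_pmf ?m1 D) {A. P A}) = (\<integral>\<^sup>+A. ennreal p * indicator {A. P A} A \<partial>iid_pmf ?m1 D)"
    using p by (simp add: nn_integral_cmult measure_pmf.emeasure_eq_measure ennreal_mult)
  also have "\<dots> \<le> (\<integral>\<^sup>+A. (\<integral>\<^sup>+B. indicator ?E (A @ B) \<partial>iid_pmf ?m2 D) \<partial>iid_pmf ?m1 D)"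
  proof (rule nn_integral_mono_AE, unfold AE_measure_pmf_iff, rule)
    fix A assume A: "A \<in> set_pmf (iid_pmf ?m1 D)"
    show "ennreal p * indicator {A. P A} A \<le> (\<integral>\<^sup>+B. indicator ?E (A @ B) \<partial>iid_pmf ?m2 D)"
    proof (cases "P A")
      case True
      have "ennreal p \<le> emeasure (iid_pmf ?m2 D) {B. Q A B}"
        using Q[OF A True] by (simp add: measure_pmf.emeasure_eq_measure)
      also have "\<dots> = (\<integral>\<^sup>+B. indicator {B. Q A B} B \<partial>iid_pmf ?m2 D)" by simp
      also have "\<dots> = (\<integral>\<^sup>+B. indicator ?E (A @ B) \<partial>iid_pmf ?m2 D)"
        by (intro nn_integral_cong_AE, unfold AE_measure_pmf_iff) (simp add: indicator_def split[OF A] True)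
      finally show ?thesis using True by simp
    qed simp
  qed
  also have "\<dots> = (\<integral>\<^sup>+S. indicator ?E S \<partial>iid_pmf (?m1 + ?m2) D)"
    unfolding iid_pmf_append by simp
  also have "\<dots> = ennreal (measure_pmf.prob (iid_pmf m D) ?E)"
    unfolding m[symmetric] by (simp add: measure_pmf.emeasure_eq_measure)
  finally show ?thesis by simp
qed

section \<open>Measurability of the trained network in the initialization\<close>

lemma measurable_ip:
  assumes "\<And>c. c < d \<Longrightarrow> (\<lambda>\<omega>. w \<omega> c) \<in> borel_measurable M"
  shows "(\<lambda>\<omega>. ip d (w \<omega>) v) \<in> borel_measurable M"
  unfolding ip_def by (intro borel_measurable_sum borel_measurable_times assms) auto

lemma measurable_maxact:
  assumes "\<And>c. c < d \<Longrightarrow> (\<lambda>\<omega>. w \<omega> c) \<in> borel_measurable M"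
  shows "(\<lambda>\<omega>. maxact d (w \<omega>) x) \<in> borel_measurable M"
  unfolding maxact_def relu_def
  by (intro borel_measurable_Max borel_measurable_max measurable_ip assms) auto

text \<open>The selected index is a measurable function into a countable space, and for each fixed
  index the coordinate is measurable.\<close>

lemma measurable_pvec:
  assumes w: "\<And>c. c < d \<Longrightarrow> (\<lambda>\<omega>. w \<omega> c) \<in> borel_measurable M"
  shows "(\<lambda>\<omega>. pvec d (w \<omega>) x c) \<in> borel_measurable M"
proof -
  note [measurable] = measurable_ip[OF w]
  define J where "J \<omega> = (LEAST j. j < length x \<and> (\<forall>j'<length x. ip d (w \<omega>) (x ! j') \<le> ip d (w \<omega>) (x ! j)))" for \<omega>
  have J: "J \<in> measurable M (count_space UNIV)"
    unfolding J_def[abs_def] by measurable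
  have eq: "pvec d (w \<omega>) x c = (if ip d (w \<omega>) (x ! J \<omega>) > 0 then (x ! J \<omega>) c else 0)" for \<omega>
    unfolding pvec_def Let_def J_def[symmetric] by (rule if_distrib[of "\<lambda>f. f c"])
  have "(\<lambda>\<omega>. if ip d (w \<omega>) (x ! j) > 0 then (x ! j) c else 0) \<in> borel_measurable M" for j
    by measurable
  from measurable_compose_countable[OF this J] show ?thesis unfolding eq .
qed

lemma measurable_net:
  assumes "\<And>i c. i < k \<Longrightarrow> c < d \<Longrightarrow> (\<lambda>\<omega>. W \<omega> i c) \<in> borel_measurable M" and "\<And>i. i < k \<Longrightarrow> (\<lambda>\<omega>. a \<omega> i) \<in> borel_measurable M"
  shows "(\<lambda>\<omega>. net d k (W \<omega>) (a \<omega>) x) \<in> borel_measurable M"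
  unfolding net_def by (intro borel_measurable_sum borel_measurable_times measurable_maxact assms) auto

lemma measurable_gradW:
  assumes W: "\<And>i c. i < k \<Longrightarrow> c < d \<Longrightarrow> (\<lambda>\<omega>. W \<omega> i c) \<in> borel_measurable M" and a: "\<And>i. i < k \<Longrightarrow> (\<lambda>\<omega>. a \<omega> i) \<in> borel_measurable M"
    and i: "i < k"
  shows "(\<lambda>\<omega>. gradW d k (W \<omega>) (a \<omega>) S i c) \<in> borel_measurable M"
proof -
  have l': "logloss' \<in> borel_measurable borel"
    unfolding logloss'_def[abs_def] by measurable
  have "(\<lambda>\<omega>. \<Sum>s\<leftarrow>S. logloss' (snd s * net d k (W \<omega>) (a \<omega>) (fst s)) * snd s * a \<omega> i * pvec d (W \<omega> i) (fst s) c) \<in> borel_measurable M"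
  proof (induction S)
    case (Cons s S)
    have "(\<lambda>\<omega>. snd s * net d k (W \<omega>) (a \<omega>) (fst s)) \<in> borel_measurable M"
      by (intro borel_measurable_times borel_measurable_const measurable_net W a)
    then have "(\<lambda>\<omega>. logloss' (snd s * net d k (W \<omega>) (a \<omega>) (fst s))) \<in> borel_measurable M"
      by (rule measurable_compose[OF _ l'])
    then have "(\<lambda>\<omega>. logloss' (snd s * net d k (W \<omega>) (a \<omega>) (fst s)) * snd s * a \<omega> i * pvec d (W \<omega> i) (fst s) c) \<in> borel_measurable M"
      by (intro borel_measurable_times borel_measurable_const a i measurable_pvec W)
    then show ?case using Cons by (simp add: borel_measurable_add)
  qed simp
  then show ?thesis unfolding gradW_def case_prod_beta by (intro borel_measurable_divide borel_measurable_const)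
qed

lemma measurable_W_iter:
  assumes W: "\<And>i c. i < k \<Longrightarrow> c < d \<Longrightarrow> (\<lambda>\<omega>. W \<omega> i c) \<in> borel_measurable M" and a: "\<And>i. i < k \<Longrightarrow> (\<lambda>\<omega>. a \<omega> i) \<in> borel_measurable M"
    and "i < k" "c < d"
  shows "(\<lambda>\<omega>. W_iter d k \<eta> (a \<omega>) S t (W \<omega>) i c) \<in> borel_measurable M"
  using assms(3,4)
proof (induction t arbitrary: i c)
  case 0
  then show ?case using W by (simp add: W_iter_def)
next
  case (Suc t)
  have "W_iter d k \<eta> (a \<omega>) S (Suc t) (W \<omega>) i c = W_iter d k \<eta> (a \<omega>) S t (W \<omega>) i c - \<eta> * gradW d k (W_iter d k \<eta> (a \<omega>) S t (W \<omega>)) (a \<omega>) S i c" for \<omega>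
    by (simp add: W_iter_def)
  then show ?case
    using Suc.prems by (simp only:) (intro borel_measurable_diff borel_measurable_times borel_measurable_const measurable_gradW Suc.IH a)
qed

text \<open>Finite support turns the population error into a finite weighted sum of indicators of
  measurable conditions.\<close>

lemma measurable_pac_functional:
  assumes \<psi>: "\<And>x i. i \<in> I \<Longrightarrow> (\<lambda>\<omega>. \<psi> \<omega> x i) \<in> borel_measurable M"
    and fin: "finite (set_pmf D)" "finite I"
  shows "(\<lambda>\<omega>. pac_functional D I (\<psi> \<omega>) \<theta> S) \<in> borel_measurable M"
proof -
  have lin [measurable]: "(\<lambda>\<omega>. linsum I s (\<psi> \<omega> x)) \<in> borel_measurable M" for s x
    unfolding linsum_def by (intro borel_measurable_sum borel_measurable_times borel_measurable_const \<psi>)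
  have ob: "(\<lambda>\<omega>. of_bool (linsum I s (\<psi> \<omega> x) \<le> \<theta>) :: real) \<in> borel_measurable M" for s x
    unfolding of_bool_def by measurable
  have "sign_error D I (\<psi> \<omega>) \<theta> s = (\<Sum>x\<in>set_pmf D. pmf D x * of_bool (linsum I s (\<psi> \<omega> x) \<le> \<theta>))" for \<omega> s
  proof -
    have "sign_error D I (\<psi> \<omega>) \<theta> s = measure_pmf.prob D ({x. linsum I s (\<psi> \<omega> x) \<le> \<theta>} \<inter> set_pmf D)"
      unfolding sign_error_def by (simp add: measure_Int_set_pmf)
    also have "\<dots> = (\<Sum>x\<in>{x. linsum I s (\<psi> \<omega> x) \<le> \<theta>} \<inter> set_pmf D. pmf D x)"
      by (rule measure_measure_pmf_finite) (use fin in auto)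
    also have "\<dots> = (\<Sum>x\<in>set_pmf D. pmf D x * of_bool (linsum I s (\<psi> \<omega> x) \<le> \<theta>))"
      using fin by (intro sum.mono_neutral_cong_left) auto
    finally show ?thesis .
  qed
  then have err: "(\<lambda>\<omega>. sign_error D I (\<psi> \<omega>) \<theta> s) \<in> borel_measurable M" for s
    by (simp only:) (intro borel_measurable_sum borel_measurable_times borel_measurable_const ob)
  have cnt: "(\<lambda>\<omega>. sign_count I (\<psi> \<omega>) \<theta> S s) \<in> borel_measurable M" for s
    unfolding sign_count_def
  proof (induction S)
    case (Cons x S)
    then show ?case using ob[of s x] by (simp add: borel_measurable_add)
  qed simp
  have "(\<lambda>\<omega>. exp (real (length S) * sign_error D I (\<psi> \<omega>) \<theta> s / 2 - sign_count I (\<psi> \<omega>) \<theta> S s)) \<in> borel_measurable M" for s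
    by (rule measurable_compose[OF _ borel_measurable_exp])
       (intro borel_measurable_diff borel_measurable_divide borel_measurable_times borel_measurable_const err cnt)
  then show ?thesis unfolding pac_functional_def
    by (intro borel_measurable_divide borel_measurable_sum borel_measurable_const)
qed


text \<open>The choice of \<nu>2 makes \<open>\<tau> = sqrt (d / m)\<close>, so the rounding error
  already has the desired rate, and \<open>16 * d < m\<close> keeps \<tau> below 1/4.\<close>

lemma pac_rate:
  fixes m d m2 e w \<tau> \<nu>2 :: real
  assumes d: "d > 0" and m: "16 * d < m" and m2: "m / 3 \<le> m2" and w: "0 \<le> w" and e: "0 \<le> e" "e \<le> 1"
    and \<nu>2: "\<nu>2 = 16000000 * d * ln (m / d)" and \<tau>: "\<tau> = exp (- (\<nu>2 / (32000000 * d)))"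
    and bound: "m2 / 2 * (1 - \<tau>) * e \<le> m2 * \<tau> + \<nu>2 + w"
  shows "e \<le> 300000000 * (sqrt (d / m) + sqrt (w / m))"
proof -
  have mpos: "m > 0" "m2 > 0" using d m m2 by linarith+
  have \<tau>2: "\<tau>\<^sup>2 = d / m"
  proof -
    have "\<tau>\<^sup>2 = exp (- ln (m / d))"
      unfolding \<tau> \<nu>2 using d by (simp add: exp_double[symmetric])
    also have "\<dots> = d / m" using d mpos by (simp add: exp_minus)
    finally show ?thesis .
  qed
  have \<tau>0: "\<tau> > 0" by (simp add: \<tau>)
  have \<tau>sq: "\<tau> = sqrt (d / m)" using \<tau>2 \<tau>0 by (simp add: real_sqrt_unique)
  have \<tau>4: "\<tau> \<le> 1 / 4"
  proof (rule power2_le_imp_le)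
    show "\<tau>\<^sup>2 \<le> (1 / 4)\<^sup>2" unfolding \<tau>2 using m mpos by (simp add: power2_eq_square field_simps)
  qed simp
  \<comment> \<open>Since \<open>d = m * \<tau>\<^sup>2\<close>, the crude bound
    \<open>ln (1 / \<tau>) \<le> 1 / \<tau>\<close> turns the complexity term d ln(m/d) into a
    multiple of \<open>m * \<tau>\<close>.\<close>
  have \<nu>le: "\<nu>2 \<le> 32000000 * (m * \<tau>)"
  proof -
    have "m / d = (1 / \<tau>)\<^sup>2" using \<tau>2 d mpos \<tau>0 by (simp add: power_divide)
    then have "ln (m / d) = 2 * ln (1 / \<tau>)" using \<tau>0 by (simp add: ln_realpow)
    also have "\<dots> \<le> 2 * (1 / \<tau>)" using ln_le_minus_one[of "1 / \<tau>"] \<tau>0 by simp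
    finally have "\<nu>2 \<le> 16000000 * d * (2 * (1 / \<tau>))" unfolding \<nu>2 using d by (intro mult_left_mono) auto
    also have "d = m * \<tau>\<^sup>2" using \<tau>2 mpos by simp
    also have "16000000 * (m * \<tau>\<^sup>2) * (2 * (1 / \<tau>)) = 32000000 * (m * \<tau>)" using \<tau>0 by (simp add: power2_eq_square)
    finally show ?thesis .
  qed
  show ?thesis
  \<comment> \<open>If \<open>w > m\<close> the claimed bound exceeds 1; otherwise
    \<open>w / m\<close> is at most its square root.\<close>
  proof (cases "w / m \<le> 1")
    case False
    then have "1 \<le> sqrt (w / m)" by simp
    moreover have "0 \<le> sqrt (d / m)" using d mpos by simp
    ultimately have "0 + 1 \<le> sqrt (d / m) + sqrt (w / m)" by (intro add_mono)
    then have "e \<le> 1 * (sqrt (d / m) + sqrt (w / m))" using e(2) by (simp only: mult_1 add_0 order_trans[OF e(2)])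
    also have "\<dots> \<le> 300000000 * (sqrt (d / m) + sqrt (w / m))"
      using d mpos w by (intro mult_right_mono add_nonneg_nonneg) auto
    finally show ?thesis .
  next
    case True
    have ws: "w / m \<le> sqrt (w / m)"
    proof (rule real_le_rsqrt)
      have "0 \<le> w / m" using w mpos by simp
      then have "w / m * (w / m) \<le> w / m * 1" using True by (intro mult_left_mono) auto
      then show "(w / m)\<^sup>2 \<le> w / m" by (simp add: power2_eq_square)
    qed
    have "m2 / 2 * (3 / 4) * e \<le> m2 / 2 * (1 - \<tau>) * e"
      using \<tau>4 mpos e by (intro mult_right_mono mult_left_mono) auto
    also have "\<dots> \<le> m2 * \<tau> + 32000000 * (m * \<tau>) + w" using bound \<nu>le by linarith
    also have "\<dots> \<le> m2 * \<tau> + 32000000 * (3 * m2 * \<tau>) + 3 * m2 * (w / m)"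
    proof -
      have "m * \<tau> \<le> 3 * m2 * \<tau>" using m2 \<tau>0 by (intro mult_right_mono) auto
      moreover have "m * (w / m) \<le> 3 * m2 * (w / m)" using m2 w mpos by (intro mult_right_mono) auto
      moreover have "m * (w / m) = w" using mpos by simp
      ultimately show ?thesis by linarith
    qed
    finally have "m2 * (3 / 8 * e) \<le> m2 * (96000001 * \<tau> + 3 * (w / m))" by (simp add: algebra_simps)
    then have "3 / 8 * e \<le> 96000001 * \<tau> + 3 * (w / m)" using mpos by (simp only: mult_le_cancel_left_pos)
    \<comment> \<open>Origin of the final constant: \<open>96000001 = 3 * 32000000 + 1\<close>,
      where 3 comes from \<open>m \<le> 3 * m2\<close>; times 8/3 this is about 256 million, rounded
      up.\<close>
    then have "8 / 3 * (3 / 8 * e) \<le> 8 / 3 * (96000001 * \<tau> + 3 * sqrt (w / m))"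
      using ws by (intro mult_left_mono) auto
    then have "e \<le> 768000008 / 3 * \<tau> + 8 * sqrt (w / m)" by (simp add: algebra_simps)
    also have "\<dots> \<le> 300000000 * \<tau> + 300000000 * sqrt (w / m)"
      using \<tau>0 w mpos by (intro add_mono mult_right_mono) auto
    finally show ?thesis unfolding \<tau>sq by (simp only: distrib_left)
  qed
qed

text \<open>Only an inequality, because \<open>sgn1 0 = -1\<close>: an output 0 is correct for the
  label -1 but has nonpositive margin.\<close>

lemma test_err_le:
  assumes "n \<ge> 1" "d \<ge> 3"
  shows "test_err n d pat k W b \<le> measure_pmf.prob (Dist n d pat) {s. snd s * net d k W b (fst s) \<le> 0}"
  unfolding test_err_def
proof (rule measure_pmf.finite_measure_mono_AE)
  show "AE s in measure_pmf (Dist n d pat). s \<in> {(x, y). sgn1 (net d k W b x) \<noteq> y} \<longrightarrow> s \<in> {s. snd s * net d k W b (fst s) \<le> 0}"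
    unfolding AE_measure_pmf_iff
  proof (intro ballI impI)
    fix s assume s: "s \<in> set_pmf (Dist n d pat)" "s \<in> {(x, y). sgn1 (net d k W b x) \<noteq> y}"
    have "snd s = 1 \<or> snd s = -1" using valid_sample_Dist[OF assms s(1)] by (simp add: valid_sample_def)
    then show "s \<in> {s. snd s * net d k W b (fst s) \<le> 0}"
      using s(2) by (auto simp: sgn1_def split: if_splits)
  qed
qed simp

lemma good_event_exists:
  fixes n d k m T1 :: nat and pat :: "nat \<Rightarrow> vec" and \<eta>1 \<eta>2 r \<delta> :: real
  assumes n: "n \<ge> 1" and d: "d \<ge> 3" and on: "orthonormal_system d pat" and T1: "T1 > 0"
    and \<eta>1: "\<eta>1 > 0" "\<eta>1 \<le> 1 / (4 * real k * (real T1 + 1))"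
    and \<eta>2: "\<eta>2 > 0" "\<eta>2 < 8 * real k" and r: "r > 0" "r \<le> \<eta>1 / 200"
    and k: "real k > 8 * real d ^ 3" and \<delta>: "0 < \<delta>" "\<delta> < 1"
  shows "\<exists>E \<in> sets (Omega n d k pat m r).
        E \<subseteq> {(S, W0, a0).
               ((\<lambda>T2. emp_loss d k (LW_W d k \<eta>1 T1 S W0 a0) (LW_a d k \<eta>1 T1 \<eta>2 T2 S W0 a0) (S2 S))
                  \<longlonglongrightarrow> 0) \<and>
               limsup (\<lambda>T2. ereal (test_err n d pat k (LW_W d k \<eta>1 T1 S W0 a0)
                                                  (LW_a d k \<eta>1 T1 \<eta>2 T2 S W0 a0)))
                 \<le> ereal (300000000 * (sqrt (real d / real m) + sqrt (ln (1 / \<delta>) / real m)))} \<and>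
        measure (Omega n d k pat m r) E
          \<ge> (1 - \<delta>) * (1 - 4 * exp (- real d) - 4 * exp (- real m / 36))"
proof (cases "1 - 4 * exp (- real d) - 4 * exp (- real m / 36) \<le> 0")
  case True
  have "(1 - \<delta>) * (1 - 4 * exp (- real d) - 4 * exp (- real m / 36)) \<le> 0"
    using True \<delta> by (intro mult_nonneg_nonpos) auto
  then show ?thesis by (intro bexI[of _ "{}"]) auto
next
  case False
  have k0: "k > 0"
  proof -
    have "0 \<le> 8 * real d ^ 3" by simp
    then have "real k > 0" using k by linarith
    then show ?thesis by simp
  qed
  \<comment> \<open>A positive probability bound forces \<open>4 * exp (- m / 36) < 1\<close>, and
    \<open>exp (-1) \<ge> 1/4\<close>. Hence both halves are nonempty and the second has at least
    \<open>m / 3\<close> samples.\<close>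
  have m37: "m > 36"
  proof (rule ccontr)
    assume "\<not> m > 36"
    then have "exp (-1) \<le> exp (- real m / 36)" by simp
    moreover have "exp (-1 :: real) \<ge> 1 / 4" using exp_le by (simp add: exp_minus divide_simps)
    moreover have "0 < exp (- real d)" by simp
    ultimately show False using False by linarith
  qed
  define D where "D = Dist n d pat"
  \<comment> \<open>The posterior norm is tuned so that \<open>exp (- \<nu>\<^sup>2 / (32000000 d)) = sqrt (d / m)\<close>;
    for \<open>m \<le> 16 d\<close> the bound exceeds 1 and \<open>\<nu>\<close> is irrelevant.\<close>
  define \<nu>2 where "\<nu>2 = (if 16 * d < m then 16000000 * real d * ln (real m / real d) else 1)"
  define \<nu> where "\<nu> = sqrt \<nu>2"
  define M where "M = nat \<lceil>\<nu>2\<rceil> + 1"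
  \<comment> \<open>The \<open>radius\<close> of the second phase written out: it involves only the
    parameters, so the threshold is fixed before sample and initialization are drawn.\<close>
  define \<theta> where "\<theta> = \<nu> * sqrt (real M) * (201 / 200 * (\<eta>1 * real T1) * sqrt (real k)) / (4000 * sqrt (real d))"
  let ?I = "{..<k} \<times> {..<M}"
  define H where "H A B \<omega> = pac_functional D ?I (signed_feature d (W_iter d k \<eta>1 (snd \<omega>) A T1 (fst \<omega>))) \<theta> B"
    for A B :: "(inp \<times> real) list" and \<omega>
  define ES where "ES S = {\<omega> \<in> init_good d k r pat. H (S1 S) (S2 S) \<omega> \<le> 1 / \<delta>}" for S
  define P where "P = iid_pmf m D"
  \<comment> \<open>A countable union of rectangles over the samples in the support, hence
    measurable once each section \<open>ES S\<close> is.\<close>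
  define E where "E = (\<Union>S\<in>set_pmf P \<inter> {S. balanced (S1 S)}. {S} \<times> ES S)"
  have \<nu>2_pos: "\<nu>2 > 0" using d by (simp add: \<nu>2_def)
  have \<nu>: "\<nu> > 0" "\<nu>\<^sup>2 = \<nu>2" using \<nu>2_pos by (simp_all add: \<nu>_def)
  have M: "M > 0" "\<nu>\<^sup>2 \<le> real M" unfolding \<nu>(2) by (simp_all add: M_def, linarith)
  have Dv: "valid_sample d pat s" if "s \<in> set_pmf D" for s
    using that valid_sample_Dist[OF n d] by (simp add: D_def)
  have Hmeas: "H A B \<in> borel_measurable (initM d k r)" for A B
  proof -
    have "(\<lambda>\<omega>. fst \<omega> i c) \<in> borel_measurable (initM d k r)" if "i < k" "c < d" for i c
      by (rule measurable_compose[OF measurable_compose[OF measurable_fst measurable_initW_component[OF that(1)]] measurable_Rd_component[OF that(2)]])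
    moreover have "(\<lambda>\<omega>. snd \<omega> i) \<in> borel_measurable (initM d k r)" if "i < k" for i
      by (rule measurable_compose[OF measurable_compose[OF measurable_snd measurable_inita_component[OF that]]]) simp
    ultimately have W: "(\<lambda>\<omega>. W_iter d k \<eta>1 (snd \<omega>) A T1 (fst \<omega>) i c) \<in> borel_measurable (initM d k r)" if "i < k" "c < d" for i c
      using that by (intro measurable_W_iter)
    show ?thesis unfolding H_def[abs_def]
    proof (rule measurable_pac_functional)
      show "(\<lambda>\<omega>. signed_feature d (W_iter d k \<eta>1 (snd \<omega>) A T1 (fst \<omega>)) s ij) \<in> borel_measurable (initM d k r)" if "ij \<in> ?I" for s ij
        unfolding signed_feature_def using that
        by (intro borel_measurable_times borel_measurable_const measurable_maxact W) auto
    qed (use finite_set_pmf_Dist[OF n d] in \<open>auto simp: D_def\<close>)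
  qed
  have ES_sets: "ES S \<in> sets (initM d k r)" for S
  proof -
    have "ES S = init_good d k r pat \<inter> {\<omega> \<in> space (initM d k r). H (S1 S) (S2 S) \<omega> \<le> 1 / \<delta>}"
      by (auto simp: ES_def init_good_def)
    also have "\<dots> \<in> sets (initM d k r)"
      by (intro sets.Int init_good_sets[OF r(1)] borel_measurable_le Hmeas borel_measurable_const)
    finally show ?thesis .
  qed
  have Omega: "Omega n d k pat m r = measure_pmf P \<Otimes>\<^sub>M initM d k r"
    by (simp add: Omega_def P_def D_def)
  have E_sets: "E \<in> sets (Omega n d k pat m r)"
    unfolding E_def Omega
  proof (rule sets.countable_UN')
    show "countable (set_pmf P \<inter> {S. balanced (S1 S)})" by (intro countable_Int1) simp
    show "(\<lambda>S. {S} \<times> ES S) ` (set_pmf P \<inter> {S. balanced (S1 S)}) \<subseteq> sets (measure_pmf P \<Otimes>\<^sub>M initM d k r)"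
      by (intro image_subsetI pair_measureI[OF _ ES_sets]) simp
  qed
  have prob: "measure (Omega n d k pat m r) E \<ge> (1 - \<delta>) * (1 - 4 * exp (- real d) - 4 * exp (- real m / 36))"
  proof -
    interpret IM: prob_space "initM d k r" by (rule prob_space_initM)
    interpret PM: pair_prob_space "measure_pmf P" "initM d k r" ..
    define c where "c = (1 - \<delta>) * (1 - 2 * exp (- real m / 36))"
    have e36: "0 \<le> 1 - 2 * exp (- real m / 36)" using False exp_gt_zero[of "- real d"] by linarith
    have c0: "0 \<le> c" unfolding c_def using e36 \<delta> by simp
    \<comment> \<open>The initialization is frozen first. The first-layer weights then depend on
      \<open>S1 S\<close> alone, so relative to the independent half \<open>S2 S\<close> the
      features are fixed and the PAC-Bayes estimate applies. Balance of \<open>S1 S\<close> costs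
      \<open>2 * exp (- m / 36)\<close>, as \<open>3/40 \<ge> 1/36\<close>.\<close>
    have sec: "ennreal c \<le> emeasure (measure_pmf P) ((\<lambda>S. (S, \<omega>)) -` E)" if \<omega>: "\<omega> \<in> init_good d k r pat" for \<omega>
    proof -
      let ?m1 = "(m + 1) div 2"
      have "(1 - \<delta>) * measure_pmf.prob (iid_pmf ?m1 D) {A. balanced A}
         \<le> measure_pmf.prob P {S. balanced (S1 S) \<and> H (S1 S) (S2 S) \<omega> \<le> 1 / \<delta>}"
        unfolding P_def H_def
        by (rule prob_split_sample[where Q="\<lambda>A B. pac_functional D ?I (signed_feature d (W_iter d k \<eta>1 (snd \<omega>) A T1 (fst \<omega>))) \<theta> B \<le> 1 / \<delta>"])
           (use \<delta> in \<open>auto intro!: prob_pac_functional\<close>)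
      also have "\<dots> = measure_pmf.prob P ({S. balanced (S1 S) \<and> H (S1 S) (S2 S) \<omega> \<le> 1 / \<delta>} \<inter> set_pmf P)"
        by (simp add: measure_Int_set_pmf)
      also have "{S. balanced (S1 S) \<and> H (S1 S) (S2 S) \<omega> \<le> 1 / \<delta>} \<inter> set_pmf P = (\<lambda>S. (S, \<omega>)) -` E"
        using \<omega> by (auto simp: E_def ES_def)
      finally have 1: "(1 - \<delta>) * measure_pmf.prob (iid_pmf ?m1 D) {A. balanced A} \<le> measure_pmf.prob P ((\<lambda>S. (S, \<omega>)) -` E)" .
      have "exp (- (3 / 20) * real ?m1) \<le> exp (- real m / 36)"
      proof -
        have "m \<le> 2 * ?m1" by linarith
        then have "real m \<le> 2 * real ?m1" by linarith
        then show ?thesis by simp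
      qed
      then have "1 - 2 * exp (- real m / 36) \<le> measure_pmf.prob (iid_pmf ?m1 D) {A. balanced A}"
        using prob_balanced[of ?m1 n d pat, folded D_def] by linarith
      then have "c \<le> (1 - \<delta>) * measure_pmf.prob (iid_pmf ?m1 D) {A. balanced A}"
        unfolding c_def using \<delta> by (intro mult_left_mono) auto
      then show ?thesis using 1 by (simp add: measure_pmf.emeasure_eq_measure)
    qed
    have "ennreal (c * (1 - 2 * exp (- real d))) \<le> ennreal (c * measure (initM d k r) (init_good d k r pat))"
      by (intro ennreal_leI mult_left_mono measure_init_good on d r k c0)
    also have "\<dots> = (\<integral>\<^sup>+\<omega>. ennreal c * indicator (init_good d k r pat) \<omega> \<partial>initM d k r)"
      using c0 by (simp add: nn_integral_cmult_indicator init_good_sets[OF r(1)] IM.emeasure_eq_measure ennreal_mult)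
    also have "\<dots> \<le> (\<integral>\<^sup>+\<omega>. emeasure (measure_pmf P) ((\<lambda>S. (S, \<omega>)) -` E) \<partial>initM d k r)"
      by (intro nn_integral_mono) (use sec in \<open>auto simp: indicator_def\<close>)
    also have "\<dots> = emeasure (measure_pmf P \<Otimes>\<^sub>M initM d k r) E"
      by (rule PM.emeasure_pair_measure_alt2[symmetric]) (use E_sets Omega in simp)
    also have "\<dots> = ennreal (measure (Omega n d k pat m r) E)"
      unfolding Omega by (rule PM.emeasure_eq_measure)
    finally have "c * (1 - 2 * exp (- real d)) \<le> measure (Omega n d k pat m r) E"
      by (subst (asm) ennreal_le_iff) auto
    moreover have "(1 - \<delta>) * (1 - 4 * exp (- real d) - 4 * exp (- real m / 36)) \<le> c * (1 - 2 * exp (- real d))"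
    proof -
      \<comment> \<open>The product of the two success probabilities is
        \<open>1 - 2 * x - 2 * y + 4 * x * y\<close>, so the claimed bound has slack.\<close>
      have "1 - 4 * x - 4 * y \<le> (1 - 2 * y) * (1 - 2 * x)" if "0 \<le> x" "0 \<le> y" for x y :: real
        using that mult_nonneg_nonneg[OF that] by (simp add: algebra_simps)
      then show ?thesis unfolding c_def mult.assoc using \<delta> by (intro mult_left_mono) auto
    qed
    ultimately show ?thesis by linarith
  qed
  have good: "((\<lambda>T2. emp_loss d k (LW_W d k \<eta>1 T1 S W0 a0) (LW_a d k \<eta>1 T1 \<eta>2 T2 S W0 a0) (S2 S)) \<longlonglongrightarrow> 0) \<and>
      limsup (\<lambda>T2. ereal (test_err n d pat k (LW_W d k \<eta>1 T1 S W0 a0) (LW_a d k \<eta>1 T1 \<eta>2 T2 S W0 a0)))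
        \<le> ereal (300000000 * (sqrt (real d / real m) + sqrt (ln (1 / \<delta>) / real m)))"
    if mem: "(S, W0, a0) \<in> E" for S W0 a0
  proof -
    have S: "S \<in> set_pmf P" "balanced (S1 S)" and ig: "(W0, a0) \<in> init_good d k r pat" and Hle: "H (S1 S) (S2 S) (W0, a0) \<le> 1 / \<delta>"
      using mem by (auto simp: E_def ES_def)
    have len: "length S = m" using S(1) by (simp add: P_def length_iid_pmf)
    have SD: "set S \<subseteq> set_pmf D" using S(1) set_iid_pmf by (auto simp: P_def)
    have sub: "set (S1 S) \<subseteq> set_pmf D" "set (S2 S) \<subseteq> set_pmf D"
      unfolding S1_def S2_def by (rule order_trans[OF set_take_subset SD], rule order_trans[OF set_drop_subset SD])
    have len2: "length (S2 S) = m div 2" unfolding S2_def length_drop len by linarith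
    interpret tp: two_phase d k pat \<eta>1 r T1 "S1 S" a0 W0 "S2 S" \<eta>2
    proof
      show "orthonormal_system d pat" "3 \<le> d" "0 < \<eta>1" "\<eta>1 \<le> 1 / (4 * real k * (real T1 + 1))" "0 < r" "r \<le> \<eta>1 / 200" "0 < k" "0 < \<eta>2" "\<eta>2 < 8 * real k" "0 < T1"
        by fact+
      show "S1 S \<noteq> []" "S2 S \<noteq> []" using m37 len len2 by (auto simp: S1_def)
      show "valid_sample d pat s" if "s \<in> set (S1 S)" for s by (rule Dv[OF subsetD[OF sub(1) that]])
      show "valid_sample d pat s" if "s \<in> set (S2 S)" for s by (rule Dv[OF subsetD[OF sub(2) that]])
      show "real (length (S1 S)) / 10 \<le> real (length (filter (\<lambda>s. snd s = \<sigma>) (S1 S)))" if "\<sigma> \<in> {1, - 1}" for \<sigma>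
        using S(2) that unfolding balanced_def by blast
      show "vnorm d (W0 i) \<le> r" "a0 i \<in> {1, - 1}" if "i < k" for i using ig that by (auto simp: init_good_def)
      show "real k / (32 * real d) \<le> real (card (good_neurons d k pat 1 1 W0 a0))"
        "real k / (32 * real d) \<le> real (card (good_neurons d k pat 2 (- 1) W0 a0))" using ig by (auto simp: init_good_def)
    qed
    have V: "tp.V = LW_W d k \<eta>1 T1 S W0 a0" by (simp add: tp.V_def tp.W_def LW_W_def)
    have b: "tp.b t = LW_a d k \<eta>1 T1 \<eta>2 t S W0 a0" for t by (simp add: tp.b_def LW_a_def V)
    have loss: "(\<lambda>T2. emp_loss d k (LW_W d k \<eta>1 T1 S W0 a0) (LW_a d k \<eta>1 T1 \<eta>2 T2 S W0 a0) (S2 S)) \<longlonglongrightarrow> 0"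
      using tp.emp_loss_tendsto_0 unfolding V b .
    let ?err = "\<lambda>t. test_err n d pat k (LW_W d k \<eta>1 T1 S W0 a0) (LW_a d k \<eta>1 T1 \<eta>2 t S W0 a0)"
    let ?bnd = "300000000 * (sqrt (real d / real m) + sqrt (ln (1 / \<delta>) / real m))"
    have w: "0 \<le> ln (1 / \<delta>)" using \<delta> by simp
    have "\<forall>\<^sub>F t in sequentially. ?err t \<le> ?bnd"
    proof (cases "16 * d < m")
      case False
      \<comment> \<open>For \<open>m \<le> 16 * d\<close> the first square root is at least 1/4, so
        the large constant alone makes the bound exceed 1.\<close>
      have "1 / 4 \<le> sqrt (real d / real m)"
        by (rule real_le_rsqrt) (use False m37 in \<open>simp add: power2_eq_square field_simps\<close>)
      moreover have "0 \<le> sqrt (ln (1 / \<delta>) / real m)" using w by simp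
      moreover have "?err t \<le> 1" for t unfolding test_err_def by (rule measure_pmf.prob_le_1)
      moreover have "z \<le> 300000000 * (x + y)" if "1 / 4 \<le> x" "0 \<le> y" "z \<le> 1" for x y z :: real
      proof -
        have "300000000 * (1 / 4) \<le> 300000000 * (x + y)" using that by (intro mult_left_mono) auto
        then show ?thesis using that(3) by simp
      qed
      ultimately have "?err t \<le> ?bnd" for t by blast
      then show ?thesis by simp
    next
      case True
      have "pac_functional D ?I (signed_feature d tp.V) (\<nu> * sqrt (real M) * tp.radius / (4000 * sqrt (real d))) (S2 S) \<le> 1 / \<delta>"
        using Hle by (simp add: H_def V LW_W_def tp.radius_def \<theta>_def)
      then have "\<forall>\<^sub>F t in sequentially. real (length (S2 S)) / 2 * (1 - exp (- (\<nu>\<^sup>2 / (32000000 * real d)))) *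
          measure_pmf.prob D {s. snd s * net d k tp.V (tp.b t) (fst s) \<le> 0}
          \<le> real (length (S2 S)) * exp (- (\<nu>\<^sup>2 / (32000000 * real d))) + \<nu>\<^sup>2 + ln (1 / \<delta>)"
        using Dv M by (intro tp.eventually_test_error[OF _ sub(2) \<delta>(1) \<nu>(1)]) auto
      then show ?thesis
      proof eventually_elim
        case (elim t)
        have "measure_pmf.prob D {s. snd s * net d k tp.V (tp.b t) (fst s) \<le> 0} \<le> ?bnd"
        proof (rule pac_rate[OF _ _ _ w _ _ _ refl elim[unfolded \<nu>(2)]])
          show "real m / 3 \<le> real (length (S2 S))" unfolding len2 using m37 by linarith
          show "\<nu>2 = 16000000 * real d * ln (real m / real d)" using True by (simp add: \<nu>2_def)
        qed (use d True in auto)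
        moreover have "?err t \<le> measure_pmf.prob D {s. snd s * net d k tp.V (tp.b t) (fst s) \<le> 0}"
          unfolding V b D_def by (rule test_err_le[OF n d])
        ultimately show ?case by linarith
      qed
    qed
    then have "limsup (\<lambda>t. ereal (?err t)) \<le> ereal ?bnd"
      by (intro Limsup_bounded) (auto elim: eventually_mono)
    then show ?thesis using loss by blast
  qed
  show ?thesis
    by (rule bexI[OF _ E_sets]) (use good prob in blast)
qed

theorem theorem5p1:
  "\<exists>C::real. \<forall>n d k (pat :: nat \<Rightarrow> vec) m T1 (\<eta>1::real) (\<eta>2::real) (r::real) (\<delta>::real).
     n \<ge> 1 \<and> d \<ge> 3 \<and>
     (\<forall>i\<in>{1..d}. \<forall>j\<in>{1..d}. ip d (pat i) (pat j) = (if i = j then 1 else 0)) \<and>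
     T1 > 0 \<and> \<eta>1 > 0 \<and> \<eta>1 \<le> 1 / (4 * real k * (real T1 + 1)) \<and>
     \<eta>2 > 0 \<and> \<eta>2 < 8 * real k \<and> r > 0 \<and> r \<le> \<eta>1 / 200 \<and>
     real k > 8 * real d ^ 3 \<and> 0 < \<delta> \<and> \<delta> < 1
     \<longrightarrow>
     (\<exists>E \<in> sets (Omega n d k pat m r).
        E \<subseteq> {(S, W0, a0).
               ((\<lambda>T2. emp_loss d k (LW_W d k \<eta>1 T1 S W0 a0) (LW_a d k \<eta>1 T1 \<eta>2 T2 S W0 a0) (S2 S))
                  \<longlonglongrightarrow> 0) \<and>
               limsup (\<lambda>T2. ereal (test_err n d pat k (LW_W d k \<eta>1 T1 S W0 a0)
                                                  (LW_a d k \<eta>1 T1 \<eta>2 T2 S W0 a0)))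
                 \<le> ereal (C * (sqrt (real d / real m) + sqrt (ln (1 / \<delta>) / real m)))} \<and>
        measure (Omega n d k pat m r) E
          \<ge> (1 - \<delta>) * (1 - 4 * exp (- real d) - 4 * exp (- real m / 36)))"
  by (rule exI[of _ 300000000], intro allI impI good_event_exists) (simp_all add: orthonormal_system_def)

end
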